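(* Among all integers $p_1,p_2\ge 3$ with $\frac1{p_1}+\frac1{p_2}<\frac12$, the maximum of the optimal multiply transitive geodesic ball packing density $\delta^{opt}(\Gamma_{(2,p_1,p_2)})$ is realized with the parameters $(2,p_1,p_2)=(2,9,3)$, where the optimal ball is centred at the vertex $B$ (the centre of the rotation of order $p_1=9$), and the maximal density is $\delta^{opt}=0.607267\dots$.
   Context: $\mathbf{H}^2\times\mathbf{R}$ denotes the Riemannian product of the hyperbolic plane of curvature $-1$ and the real line, with geodesic distance $d$ and Riemannian volume $\mathrm{vol}$. A geodesic ball $B(\rho)$ of radius $\rho$ has volume $\mathrm{vol}(B(\rho))=2\pi\int_0^\rho\int_{-\pi/2}^{\pi/2}\tau\sinh(\tau\cos v)\,dv\,d\tau$. Groups. For integers $p_1,p_2\ge 3$ with $\frac1{p_1}+\frac1{p_2}<\frac12$, let $ABC\subset\mathbf{H}^2$ be a triangle with angles $\frac{\pi}{2},\frac{\pi}{p_1},\frac{\pi}{p_2}$ at $A,B,C$. Let $\Gamma_0$ be the discrete group of isometries of $\mathbf{H}^2$ generated by the rotation $\mathbf{g}_0$ by $\pi$ about $A$ and the rotation $\mathbf{g}_1$ by $2\pi/p_1$ about $B$, with senses chosen so that $\mathbf{g}_2=\mathbf{g}_0\mathbf{g}_1$ is a rotation by $2\pi/p_2$ about $C$. For a real number $r>0$ (the free lattice parameter) the space group $\Gamma=\Gamma_{(2,p_1,p_2)}$ is $\Gamma_0\times r\mathbf{Z}$, acting on $\mathbf{H}^2\times\mathbf{R}$ by $\Gamma_0$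 on the first factor and by the translations $t\mapsto t+kr$, $k\in\mathbf{Z}$, on the second. Multiply transitive packings. Let $K\in\mathbf{H}^2\times\mathbf{R}$ have nontrivial stabilizer $\Gamma_K=\{\mathbf{g}\in\Gamma: K^{\mathbf{g}}=K\}$; up to the action of $\Gamma$ and translation along the fibre, $K$ is one of the points $A$, $B$, $C$ (placed at fibre coordinate $0$). Put $\rho(K)=\min_{\mathbf{g}\in\Gamma\setminus\Gamma_K}\frac12 d(K,K^{\mathbf{g}})$, let $\mathcal{D}(K)=\{X: d(K,X)\le d(K^{\mathbf{g}},X)\ \forall\,\mathbf{g}\in\Gamma\}$ be the Dirichlet--Voronoi cell, and let $\delta(K)=\mathrm{vol}(B(\rho(K)))/\mathrm{vol}(\mathcal{D}(K))$ be the density of the packing formed by the $\Gamma$-images of the ball of radius $\rho(K)$ centred at $K$. The optimal multiply transitive density is $\delta^{opt}(\Gamma_{(2,p_1,p_2)})=\max\delta(K)$, the maximum being taken over all $K$ with nontrivial stabilizer and all lattice parameters $r>0$. A value written $0.607267\dots$ means a real number whose decimal expansion begins with the displayed digits. *)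

theory Defs
  imports "HOL-Analysis.Analysis" "HOL-Complex_Analysis.Riemann_Mapping" "HOL-Algebra.Bij" "HOL-Algebra.Generated_Groups"
begin

section \<open>The geometry of the product of the hyperbolic plane and the line\<close>

text \<open>The hyperbolic plane of curvature -1 is the Poincare unit disc with the metric
  tensor 4 |dz|^2 / (1 - |z|^2)^2.\<close>

abbreviation hyp_plane :: "complex set" where
  "hyp_plane \<equiv> ball 0 1"

definition hyp_dist :: "complex \<Rightarrow> complex \<Rightarrow> real" where
  "hyp_dist z w = arcosh (1 + 2 * (cmod (z - w))\<^sup>2 / ((1 - (cmod z)\<^sup>2) * (1 - (cmod w)\<^sup>2)))"

definition hyp_area :: "complex measure" where
  "hyp_area = density lborel
     (\<lambda>z. ennreal (4 / (1 - (cmod z)\<^sup>2)\<^sup>2) * indicator hyp_plane z)"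

definition H2R :: "(complex \<times> real) set" where
  "H2R = hyp_plane \<times> UNIV"

definition H2R_dist :: "complex \<times> real \<Rightarrow> complex \<times> real \<Rightarrow> real" where
  "H2R_dist X Y = sqrt ((hyp_dist (fst X) (fst Y))\<^sup>2 + (snd X - snd Y)\<^sup>2)"

definition H2R_vol :: "(complex \<times> real) set \<Rightarrow> real" where
  "H2R_vol S = measure (hyp_area \<Otimes>\<^sub>M lborel) S"

definition H2R_ball :: "complex \<times> real \<Rightarrow> real \<Rightarrow> (complex \<times> real) set" where
  "H2R_ball K \<rho> = {X \<in> H2R. H2R_dist K X \<le> \<rho>}"

section \<open>Triangles and rotations of the hyperbolic plane\<close>

text \<open>\<open>Moebius_function 0 P\<close> is an orientation-preserving isometry taking \<open>P\<close> to \<open>0\<close> with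
  positive derivative at \<open>P\<close>, and the geodesics through \<open>0\<close> are diameters. Hence
  \<open>Moebius_function 0 P Q\<close> points in the initial direction of the geodesic ray from \<open>P\<close>
  through \<open>Q\<close>, and since the model is conformal the Euclidean angle is the hyperbolic one.\<close>

definition hyp_angle :: "complex \<Rightarrow> complex \<Rightarrow> complex \<Rightarrow> real" where
  "hyp_angle Q P R =
     (let u = Moebius_function 0 P Q; v = Moebius_function 0 P R
      in arccos ((u \<bullet> v) / (norm u * norm v)))"

text \<open>Rotation about \<open>P\<close> by the signed angle \<open>\<theta>\<close>. It is made extensional on the disc, so that
  it is an element of \<open>BijGroup hyp_plane\<close>.\<close>

definition hyp_rotation :: "complex \<Rightarrow> real \<Rightarrow> complex \<Rightarrow> complex" where
  "hyp_rotation P \<theta> =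
     restrict (\<lambda>z. Moebius_function 0 (- P) (Moebius_function \<theta> P z)) hyp_plane"

definition admissible :: "nat \<Rightarrow> nat \<Rightarrow> bool" where
  "admissible p1 p2 \<longleftrightarrow> 3 \<le> p1 \<and> 3 \<le> p2 \<and> 1 / real p1 + 1 / real p2 < 1 / 2"

definition right_triangle :: "nat \<Rightarrow> nat \<Rightarrow> complex \<Rightarrow> complex \<Rightarrow> complex \<Rightarrow> bool" where
  "right_triangle p1 p2 A B C \<longleftrightarrow>
     A \<in> hyp_plane \<and> B \<in> hyp_plane \<and> C \<in> hyp_plane \<and> A \<noteq> B \<and> B \<noteq> C \<and> A \<noteq> C \<and>
     hyp_angle B A C = pi / 2 \<and>
     hyp_angle A B C = pi / real p1 \<and>
     hyp_angle A C B = pi / real p2"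

text \<open>The signs \<open>s\<close> and \<open>s'\<close> are the senses of rotation. The sense of \<open>g1\<close> depends on whether
  products of isometries are read from the right (as here) or from the left; the other
  convention replaces \<open>g1\<close> by its inverse and so leads to the same group.\<close>

definition rotation_generators ::
  "nat \<Rightarrow> nat \<Rightarrow> complex \<Rightarrow> complex \<Rightarrow> complex \<Rightarrow>
   (complex \<Rightarrow> complex) \<Rightarrow> (complex \<Rightarrow> complex) \<Rightarrow> bool" where
  "rotation_generators p1 p2 A B C g0 g1 \<longleftrightarrow>
     g0 = hyp_rotation A pi \<and>
     (\<exists>s\<in>{1, -1}. g1 = hyp_rotation B (s * (2 * pi / real p1))) \<and>
     (\<exists>s'\<in>{1, -1}. g0 \<otimes>\<^bsub>BijGroup hyp_plane\<^esub> g1 = hyp_rotation C (s' * (2 * pi / real p2)))"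

section \<open>Space groups\<close>

definition Gamma0 ::
  "(complex \<Rightarrow> complex) \<Rightarrow> (complex \<Rightarrow> complex) \<Rightarrow> (complex \<Rightarrow> complex) set" where
  "Gamma0 g0 g1 = generate (BijGroup hyp_plane) {g0, g1}"

definition Gamma ::
  "(complex \<Rightarrow> complex) set \<Rightarrow> real \<Rightarrow> (complex \<times> real \<Rightarrow> complex \<times> real) set" where
  "Gamma G0 r = {map_prod g (\<lambda>t. t + of_int k * r) | g k. g \<in> G0}"

definition stabilizer_at ::
  "(complex \<times> real \<Rightarrow> complex \<times> real) set \<Rightarrow> complex \<times> real \<Rightarrow>
   (complex \<times> real \<Rightarrow> complex \<times> real) set" where
  "stabilizer_at G K = {g \<in> G. g K = K}"

text \<open>Elements of \<open>Gamma\<close> are determined by, and only meaningful through, their values on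
  \<open>H2R\<close>; so being nontrivial means moving some point of \<open>H2R\<close>.\<close>

definition nontrivial_stabilizer ::
  "(complex \<times> real \<Rightarrow> complex \<times> real) set \<Rightarrow> complex \<times> real \<Rightarrow> bool" where
  "nontrivial_stabilizer G K \<longleftrightarrow> (\<exists>g \<in> stabilizer_at G K. \<exists>X \<in> H2R. g X \<noteq> X)"

section \<open>Ball packings\<close>

text \<open>On the reals, \<open>LEAST\<close> and \<open>GREATEST\<close> denote the minimum and the maximum of a set, and
  are unspecified if it is not attained.\<close>

definition packing_radius ::
  "(complex \<times> real \<Rightarrow> complex \<times> real) set \<Rightarrow> complex \<times> real \<Rightarrow> real" where
  "packing_radius G K = (LEAST x. \<exists>g \<in> G - stabilizer_at G K. x = H2R_dist K (g K) / 2)"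

definition dirichlet_cell ::
  "(complex \<times> real \<Rightarrow> complex \<times> real) set \<Rightarrow> complex \<times> real \<Rightarrow> (complex \<times> real) set" where
  "dirichlet_cell G K = {X \<in> H2R. \<forall>g \<in> G. H2R_dist K X \<le> H2R_dist (g K) X}"

definition packing_density ::
  "(complex \<times> real \<Rightarrow> complex \<times> real) set \<Rightarrow> complex \<times> real \<Rightarrow> real" where
  "packing_density G K =
     H2R_vol (H2R_ball K (packing_radius G K)) / H2R_vol (dirichlet_cell G K)"

definition multiply_transitive :: "(complex \<Rightarrow> complex) set \<Rightarrow> real \<Rightarrow> complex \<times> real \<Rightarrow> bool" where
  "multiply_transitive G0 r K \<longleftrightarrow> r > 0 \<and> K \<in> H2R \<and> nontrivial_stabilizer (Gamma G0 r) K"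

definition opt_density :: "(complex \<Rightarrow> complex) set \<Rightarrow> real" where
  "opt_density G0 =
     (GREATEST \<delta>. \<exists>r K. multiply_transitive G0 r K \<and> \<delta> = packing_density (Gamma G0 r) K)"

definition optimal_packing :: "(complex \<Rightarrow> complex) set \<Rightarrow> real \<Rightarrow> complex \<times> real \<Rightarrow> bool" where
  "optimal_packing G0 r K \<longleftrightarrow>
     multiply_transitive G0 r K \<and> packing_density (Gamma G0 r) K = opt_density G0"

end

theory Submission
  imports Defs "HOL-Complex_Analysis.Complex_Analysis" "HOL-Real_Asymp.Real_Asymp"
begin

text \<open>
  In the Minkowski model \<open>C \<times> R\<close> of the hyperbolic plane, the reflections in the sides of the triangle
  generate a group whose even words are \<open>\<Gamma>\<^sub>0\<close>. As for Coxeter groups, every word either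
  keeps a simple root positive or is shortened by the corresponding reflection. Hence the Dirichlet cell of
  a vertex of order \<open>n\<close> consists of the \<open>2 n\<close> copies of the triangle around it, and the nearest other point
  of its orbit is its mirror image in the opposite side, at twice the height \<open>h\<close>. Fibre translations by
  \<open>r\<close> cut the cell at height \<open>r / 2\<close>, and since the ball volume divided by the radius
  increases, the best choice is \<open>r = 2 h\<close>. The resulting density is \<open>\<pi> S(h) / (2 n F)\<close>, where \<open>F\<close> is
  the area of the triangle and \<open>2 \<pi> h S(h)\<close> the volume of the ball of radius \<open>h\<close>.

  Expanding \<open>S\<close> in powers of \<open>h\<close> bounds it by affine functions of \<open>cosh h\<close>, and \<open>cosh h\<close> is a
  quotient of trigonometric functions of the angles. This settles all cases except a vertex of order
  7, 8, 9 or 10 whose companion has order 3; these need sharp numerical values, the closest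
  competitor being \<open>(8, 3)\<close> with density \<open>0.607264\<dots>\<close>.
\<close>

section \<open>Reflection words and root positivity\<close>

text \<open>The group is known only through two generators, so its discreteness, its orbits and the
  tessellation have to be extracted from the words themselves. One computation yields all three: for
  a reduced word \<open>ws\<close> and a point \<open>x\<close> of the chamber,
  \<open>x - W ws x\<close> pairs nonnegatively with every vertex. Pairing it with chamber points
  shows that no image is closer than the point itself; following the first letter that moves a
  vertex bounds distances inside an orbit from below; that bound makes orbits discrete, which lets
  every point be moved into the chamber by minimising a sum over the vertices. Passing from
  reflections to rotations loses nothing for vertices, because each vertex is fixed by a reflection
  and any word can be given even length.

  The numerical difficulty is that \<open>(8, 3)\<close> misses the maximum by a few millionths. An
  affine bound in \<open>cosh h\<close> must be nearly exact at the actual radius, so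
  \<open>ball_series_le_tangent\<close> leaves the point of tangency free. For large orders only the
  slope matters, and for companions of order at least 4 the crude slope 4/3 is enough.\<close>

definition mform :: "complex \<times> real \<Rightarrow> complex \<times> real \<Rightarrow> real" where
  "mform x y = fst x \<bullet> fst y - snd x * snd y"

lemma mform_self: "mform x x = (norm (fst x))\<^sup>2 - (snd x)\<^sup>2"
  by (simp add: mform_def power2_norm_eq_inner power2_eq_square[of "snd x"])

lemma mform_commute: "mform x y = mform y x"
  by (simp add: mform_def inner_commute)

lemma mform_simps [simp]:
  "mform (x + y) z = mform x z + mform y z"
  "mform x (y + z) = mform x y + mform x z"
  "mform (x - y) z = mform x z - mform y z"
  "mform x (y - z) = mform x y - mform x z"
  "mform (- x) z = - mform x z"
  "mform x (- z) = - mform x z"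
  "mform (c *\<^sub>R x) z = c * mform x z"
  "mform x (c *\<^sub>R z) = c * mform x z"
  "mform 0 z = 0" "mform z 0 = 0"
  by (simp_all add: mform_def inner_add_left inner_add_right inner_diff_left inner_diff_right
      algebra_simps)

lemma mform_sum_left: "mform (\<Sum>i\<in>I. f i) z = (\<Sum>i\<in>I. mform (f i) z)"
  by (induction I rule: infinite_finite_induct) auto

definition mrefl :: "complex \<times> real \<Rightarrow> complex \<times> real \<Rightarrow> complex \<times> real" where
  "mrefl a x = x - (2 * mform x a) *\<^sub>R a"

lemma mrefl_linear: "linear (mrefl a)"
  by (rule linearI) (simp_all add: mrefl_def algebra_simps)

lemma mrefl_involution: "mform a a = 1 \<Longrightarrow> mrefl a (mrefl a x) = x"
  by (simp add: mrefl_def algebra_simps)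

lemma mrefl_adjoint: "mform (mrefl a x) y = mform x (mrefl a y)"
  by (simp add: mrefl_def mform_commute)

text \<open>The head of a word acts last, so concatenation is composition and a letter appended on
  the right acts first.\<close>

fun act :: "('i \<Rightarrow> complex \<times> real) \<Rightarrow> 'i list \<Rightarrow> complex \<times> real \<Rightarrow> complex \<times> real" where
  "act \<alpha> [] x = x"
| "act \<alpha> (i # ws) x = mrefl (\<alpha> i) (act \<alpha> ws x)"

lemma act_append: "act \<alpha> (us @ vs) x = act \<alpha> us (act \<alpha> vs x)"
  by (induction us) auto

lemma act_linear: "linear (act \<alpha> ws)"
proof (induction ws)
  case Nil
  have "act \<alpha> [] = (\<lambda>x. x)" by auto
  then show ?case by (simp add: module_hom_ident)
next
  case (Cons i ws)
  have "act \<alpha> (i # ws) = mrefl (\<alpha> i) \<circ> act \<alpha> ws" by auto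
  then show ?case using linear_compose[OF Cons mrefl_linear] by metis
qed

lemmas act_add = linear_add[OF act_linear]
  and act_diff = linear_diff[OF act_linear]
  and act_scale = linear_scale[OF act_linear]
  and act_neg = linear_neg[OF act_linear]

lemma act_adjoint: "mform (act \<alpha> ws x) y = mform x (act \<alpha> (rev ws) y)"
  by (induction ws arbitrary: x y) (auto simp: act_append mrefl_adjoint)

fun alt :: "'i \<Rightarrow> 'i \<Rightarrow> nat \<Rightarrow> 'i list" where
  "alt a b 0 = []"
| "alt a b (Suc k) = a # alt b a k"

lemma length_alt [simp]: "length (alt a b k) = k"
  by (induction k arbitrary: a b) auto

lemma alt_add: "alt a b (j + k) = alt a b j @ (if even j then alt a b k else alt b a k)"
  by (induction j arbitrary: a b) auto

lemma alt_Suc_snoc: "alt a b (Suc k) = alt a b k @ [if even k then a else b]"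
  using alt_add[of a b k 1] by simp

text \<open>The clause on the head is what the induction needs: a new first letter differs from the
  old head by hypothesis, so it is the other one of the two letters.\<close>

lemma alternating_word:
  assumes "set u \<subseteq> {s, t}" "s \<noteq> t" "\<And>us x vs. u \<noteq> us @ [x, x] @ vs"
  shows "\<exists>a b. {a, b} = {s, t} \<and> a \<noteq> b \<and> u = alt a b (length u) \<and> (u \<noteq> [] \<longrightarrow> hd u = a)"
  using assms(1,3)
proof (induction u)
  case Nil
  then show ?case using assms(2) by auto
next
  case (Cons x u)
  have nn: "\<And>us y vs. u \<noteq> us @ [y, y] @ vs"
    using Cons.prems(2) by (metis append_Cons)
  obtain a b where ab: "{a, b} = {s, t}" "a \<noteq> b" "u = alt a b (length u)" "u \<noteq> [] \<longrightarrow> hd u = a"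
    using Cons.IH[OF _ nn] Cons.prems(1) by auto
  show ?case
  proof (cases "u = []")
    case True
    then show ?thesis using Cons.prems(1) assms(2) by auto
  next
    case False
    have "x \<noteq> a"
    proof
      assume "x = a"
      then have "x # u = [] @ [x, x] @ tl u" using False ab(4) by (cases u) auto
      then show False using Cons.prems(2) by blast
    qed
    then have "x = b" using ab(1) Cons.prems(1) by auto
    then have "{b, a} = {s, t}" "b \<noteq> a" "x # u = alt b a (length (x # u))" "hd (x # u) = b"
      using ab by auto
    then show ?thesis by blast
  qed
qed

section \<open>The upper sheet and the finiteness of separated sets\<close>

definition hyperboloid :: "(complex \<times> real) set" where
  "hyperboloid = {x. mform x x = -1 \<and> snd x > 0}"

lemma hyperboloid_norm: "x \<in> hyperboloid \<Longrightarrow> (norm (fst x))\<^sup>2 = (snd x)\<^sup>2 - 1"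
  using dot_square_norm[of "fst x"] by (auto simp: hyperboloid_def mform_def power2_eq_square[of "snd x"])

lemma hyperboloid_less: "x \<in> hyperboloid \<Longrightarrow> norm (fst x) < snd x"
  by (rule power2_less_imp_less) (simp_all add: hyperboloid_norm hyperboloid_def)

text \<open>Cauchy-Schwarz, since on the upper sheet the planar part is shorter than the height. In
  this model \<open>- mform x y\<close> is the hyperbolic cosine of the distance.\<close>

lemma mform_hyperboloid_neg:
  assumes "x \<in> hyperboloid" "y \<in> hyperboloid"
  shows "mform x y < 0"
proof -
  have "fst x \<bullet> fst y \<le> norm (fst x) * norm (fst y)" by (rule norm_cauchy_schwarz)
  also have "\<dots> < snd x * snd y"
    using hyperboloid_less[OF assms(1)] hyperboloid_less[OF assms(2)]
    by (intro mult_strict_mono') auto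
  finally show ?thesis by (simp add: mform_def)
qed

lemma hyperboloid_sheet:
  assumes x: "x \<in> hyperboloid" and y: "mform y y = -1" "mform x y < 0"
  shows "y \<in> hyperboloid"
proof (rule ccontr)
  assume "y \<notin> hyperboloid"
  then have "snd y \<le> 0" using y by (auto simp: hyperboloid_def)
  moreover have "snd y \<noteq> 0"
    using y(1) inner_ge_zero[of "fst y"] by (auto simp: mform_def simp del: inner_ge_zero)
  ultimately have "- y \<in> hyperboloid" using y(1) by (auto simp: hyperboloid_def)
  from mform_hyperboloid_neg[OF x this] y(2) show False by simp
qed

text \<open>A bound on the distance to \<open>z\<close> bounds the height and hence the Euclidean
  norm, while the separation passes to the Euclidean metric because
  \<open>mform (x - y) (x - y)\<close> is at most the squared distance. A bounded set without limit
  points is finite.\<close>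

lemma finite_separated_hyperboloid:
  assumes S: "S \<subseteq> hyperboloid" and e: "e > 0" and z: "z \<in> hyperboloid"
    and sep: "\<And>x y. x \<in> S \<Longrightarrow> y \<in> S \<Longrightarrow> x \<noteq> y \<Longrightarrow> 1 + e \<le> - mform x y"
  shows "finite {x \<in> S. - mform x z \<le> M}"
proof -
  let ?T = "{x \<in> S. - mform x z \<le> M}"
  define d where "d = snd z - norm (fst z)"
  have d: "d > 0" using hyperboloid_less[OF z] by (simp add: d_def)
  have "norm x \<le> 2 * (M / d)" if "x \<in> ?T" for x
  proof -
    have x: "x \<in> hyperboloid" "- mform x z \<le> M" using that S by auto
    have "fst x \<bullet> fst z \<le> norm (fst x) * norm (fst z)" by (rule norm_cauchy_schwarz)
    also have "\<dots> \<le> snd x * norm (fst z)"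
      using hyperboloid_less[OF x(1)] by (intro mult_right_mono) auto
    finally have "snd x * d \<le> M" using x(2) by (simp add: mform_def d_def algebra_simps)
    then have "snd x \<le> M / d" using d by (simp add: field_simps)
    moreover have "norm x \<le> norm (fst x) + norm (snd x)"
      by (metis norm_Pair_le prod.collapse)
    ultimately show ?thesis using hyperboloid_less[OF x(1)] x(1) by (simp add: hyperboloid_def)
  qed
  then have "?T \<subseteq> cball 0 (2 * (M / d))" by auto
  moreover have "\<not> x islimpt ?T" for x
  proof (rule discrete_imp_not_islimpt[of "sqrt (2 * e)"])
    show "0 < sqrt (2 * e)" using e by simp
    have "y = x" if "x \<in> S" "y \<in> S" and "dist y x < sqrt (2 * e)" for x y
    proof (rule ccontr)
      assume "y \<noteq> x"
      then have "1 + e \<le> - mform y x" using sep that by blast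
      moreover have "mform x x = -1" "mform y y = -1" using that S by (auto simp: hyperboloid_def)
      ultimately have "2 * e \<le> mform (y - x) (y - x)" by (simp add: mform_commute)
      also have "\<dots> \<le> (norm (fst (y - x)))\<^sup>2 + (norm (snd (y - x)))\<^sup>2"
        unfolding mform_self by simp
      also have "\<dots> = (dist y x)\<^sup>2" by (simp add: dist_norm norm_prod_def)
      finally have "sqrt (2 * e) \<le> dist y x" by (intro real_le_lsqrt) auto
      then show False using that(3) by simp
    qed
    then show "\<And>x y. x \<in> ?T \<Longrightarrow> y \<in> ?T \<Longrightarrow> dist y x < sqrt (2 * e) \<Longrightarrow> y = x" by blast
  qed
  ultimately show ?thesis using finite_not_islimpt_in_compact[of "cball 0 (2 * (M / d))" ?T]
    by (auto simp: Int_absorb1)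
qed

text \<open>\<open>P j\<close> is the vertex opposite to the side with unit normal
  \<open>\<alpha> j\<close>, so vertices and normals are dual bases up to the factors
  \<open>h j\<close>; \<open>h j\<close> is the hyperbolic sine of the altitude from
  \<open>P j\<close>. The label \<open>m i j\<close> encodes the angle \<open>pi / m i j\<close>
  between two sides.\<close>

locale coxeter_system =
  fixes \<alpha> :: "'i::finite \<Rightarrow> complex \<times> real" and m :: "'i \<Rightarrow> 'i \<Rightarrow> nat"
    and P :: "'i \<Rightarrow> complex \<times> real" and h :: "'i \<Rightarrow> real"
  assumes unit: "mform (\<alpha> i) (\<alpha> i) = 1"
    and gram: "i \<noteq> j \<Longrightarrow> mform (\<alpha> i) (\<alpha> j) = - cos (pi / m i j)"
    and m_ge2: "i \<noteq> j \<Longrightarrow> m i j \<ge> 2"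
    and m_sym: "m i j = m j i"
    and dual: "mform (\<alpha> i) (P j) = (if i = j then h i else 0)"
    and h_pos: "h i > 0"
    and P_span: "span (range P) = UNIV"
    and P_hyperboloid: "P i \<in> hyperboloid"
    and nontrivial: "\<exists>j. j \<noteq> i"
begin

abbreviation "W \<equiv> act \<alpha>"

lemma W_rev_cancel [simp]: "W (rev ws) (W ws x) = x" "W ws (W (rev ws) x) = x"
proof -
  have "W (rev ws) (W ws x) = x" for ws x
    by (induction ws arbitrary: x) (auto simp: act_append mrefl_involution unit)
  from this this[of "rev ws"] show "W (rev ws) (W ws x) = x" "W ws (W (rev ws) x) = x"
    by simp_all
qed

lemma W_isometry [simp]: "mform (W ws x) (W ws y) = mform x y"
  by (simp add: act_adjoint)

lemma W_root: "W [i] (\<alpha> i) = - \<alpha> i"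
  by (simp add: mrefl_def unit algebra_simps scaleR_2)

lemma W_other_root: "i \<noteq> j \<Longrightarrow> W [i] (\<alpha> j) = \<alpha> j + (2 * cos (pi / m i j)) *\<^sub>R \<alpha> i"
  using gram[of j i] m_sym[of i j] by (simp add: mrefl_def)

text \<open>The roots of a dihedral group have quotients of sines as coordinates; multiplying by
  \<open>sin \<theta>\<close> avoids the division. The induction exchanges the two letters, and its
  recursion is the addition theorem for the sine.\<close>

lemma alt_root:
  assumes "a \<noteq> b" and "\<theta> = pi / m a b"
  shows "sin \<theta> *\<^sub>R W (alt a b k) (\<alpha> (if even k then a else b)) =
    sin ((real k + 1) * \<theta>) *\<^sub>R \<alpha> a + sin (real k * \<theta>) *\<^sub>R \<alpha> b"
  using assms
proof (induction k arbitrary: a b)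
  case 0
  then show ?case by simp
next
  case (Suc k)
  have IH: "sin \<theta> *\<^sub>R W (alt b a k) (\<alpha> (if even k then b else a)) =
    sin ((real k + 1) * \<theta>) *\<^sub>R \<alpha> b + sin (real k * \<theta>) *\<^sub>R \<alpha> a"
    using Suc.IH[of b a] Suc.prems m_sym by auto
  have "sin \<theta> *\<^sub>R W (alt a b (Suc k)) (\<alpha> (if even (Suc k) then a else b)) =
     W [a] (sin \<theta> *\<^sub>R W (alt b a k) (\<alpha> (if even k then b else a)))"
    by (simp only: act_scale) simp
  also have "\<dots> = sin ((real k + 1) * \<theta>) *\<^sub>R W [a] (\<alpha> b) + sin (real k * \<theta>) *\<^sub>R W [a] (\<alpha> a)"
    by (simp only: IH act_add act_scale)
  also have "\<dots> = sin ((real k + 1) * \<theta>) *\<^sub>R \<alpha> b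
      + (2 * cos \<theta> * sin ((real k + 1) * \<theta>) - sin (real k * \<theta>)) *\<^sub>R \<alpha> a"
    by (simp only: W_root W_other_root[OF Suc.prems(1)] Suc.prems(2)) (simp add: algebra_simps)
  also have "2 * cos \<theta> * sin ((real k + 1) * \<theta>) - sin (real k * \<theta>) = sin ((real (Suc k) + 1) * \<theta>)"
  proof -
    have "sin ((real (Suc k) + 1) * \<theta>) = sin ((real k + 1) * \<theta> + \<theta>)"
      and "sin (real k * \<theta>) = sin ((real k + 1) * \<theta> - \<theta>)"
      by (simp_all add: algebra_simps)
    then show ?thesis unfolding sin_add sin_diff by simp
  qed
  finally show ?case by (simp add: algebra_simps)
qed

lemma sin_angle_pos: "a \<noteq> b \<Longrightarrow> 0 < sin (pi / m a b)"
  using m_ge2[of a b] by (intro sin_gt_zero) (auto simp: field_simps)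

lemma alt_longest:
  assumes ab: "a \<noteq> b" and k: "k = m a b"
  shows "W (alt a b k) (\<alpha> (if even k then a else b)) = - \<alpha> a"
    and "W (alt a b k) (\<alpha> (if even k then b else a)) = - \<alpha> b"
proof -
  define \<theta> where "\<theta> = pi / m a b"
  have k2: "k \<ge> 2" using m_ge2[OF ab] k by simp
  have sp: "sin \<theta> > 0" using sin_angle_pos[OF ab] by (simp add: \<theta>_def)
  have kt: "real k * \<theta> = pi" using k2 k by (simp add: \<theta>_def)
  have "sin \<theta> *\<^sub>R W (alt a b k) (\<alpha> (if even k then a else b)) = sin \<theta> *\<^sub>R (- \<alpha> a)"
    using alt_root[OF ab \<theta>_def, of k] kt by (simp add: distrib_right add.commute)
  then show "W (alt a b k) (\<alpha> (if even k then a else b)) = - \<alpha> a"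
    using sp by (simp only: scaleR_cancel_left) simp
  obtain j where j: "k = Suc j" using k2 by (cases k) auto
  have "sin \<theta> *\<^sub>R W (alt a b j) (\<alpha> (if even j then a else b)) = sin \<theta> *\<^sub>R \<alpha> b"
  proof -
    have "(real j + 1) * \<theta> = pi" "real j * \<theta> = pi - \<theta>" using kt j by (auto simp: algebra_simps)
    then show ?thesis using alt_root[OF ab \<theta>_def, of j] by simp
  qed
  then have *: "W (alt a b j) (\<alpha> (if even j then a else b)) = \<alpha> b"
    using sp by (simp only: scaleR_cancel_left) simp
  have "W (alt a b k) (\<alpha> (if even k then b else a)) =
      W (alt a b j) (W [if even j then a else b] (\<alpha> (if even j then a else b)))"
    unfolding j alt_Suc_snoc act_append by simp
  also have "\<dots> = - \<alpha> b" by (simp only: W_root act_neg *)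
  finally show "W (alt a b k) (\<alpha> (if even k then b else a)) = - \<alpha> b" .
qed

lemma W_fixes_orthogonal:
  assumes "\<And>i. i \<in> set ws \<Longrightarrow> mform x (\<alpha> i) = 0"
  shows "W ws x = x"
  using assms by (induction ws) (auto simp: mrefl_def)

lemma set_alt: "set (alt a b k) \<subseteq> {a, b}"
  by (induction k arbitrary: a b) auto

text \<open>Both words act alike on the two roots, as \<open>alt_longest\<close> is symmetric in the
  letters, and both fix the orthogonal complement of the roots. The two parts make up the whole
  space because the Gram determinant is the square of a nonzero sine.\<close>

lemma braid:
  assumes ab: "a \<noteq> b"
  shows "W (alt a b (m a b)) = W (alt b a (m a b))"
proof
  fix x
  define k c where "k = m a b" and "c = cos (pi / m a b)"
  define \<xi> \<eta> where "\<xi> = mform x (\<alpha> a)" and "\<eta> = mform x (\<alpha> b)"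
  have g: "mform (\<alpha> a) (\<alpha> b) = - c" "mform (\<alpha> b) (\<alpha> a) = - c"
    using gram[OF ab] mform_commute[of "\<alpha> a" "\<alpha> b"] by (auto simp: c_def)
  have c1: "1 - c\<^sup>2 \<noteq> 0"
    using sin_angle_pos[OF ab] sin_cos_squared_add[of "pi / m a b"] by (simp add: c_def sin_squared_eq[symmetric])
  \<comment> \<open>Coefficients of the orthogonal projection to the span of the two roots, obtained
    by inverting their Gram matrix.\<close>
  define p q where "p = (\<xi> + c * \<eta>) / (1 - c\<^sup>2)" and "q = (\<eta> + c * \<xi>) / (1 - c\<^sup>2)"
  define y where "y = x - p *\<^sub>R \<alpha> a - q *\<^sub>R \<alpha> b"
  have "p - q * c = \<xi> * (1 - c\<^sup>2) / (1 - c\<^sup>2)" "q - p * c = \<eta> * (1 - c\<^sup>2) / (1 - c\<^sup>2)"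
    unfolding p_def q_def times_divide_eq_left diff_divide_distrib[symmetric]
    by (simp_all add: algebra_simps power2_eq_square)
  then have "p - q * c = \<xi>" "q - p * c = \<eta>" using c1 by auto
  then have y0: "mform y (\<alpha> a) = 0" "mform y (\<alpha> b) = 0"
    unfolding y_def using g unit by (auto simp: \<xi>_def \<eta>_def)
  have fy: "W (alt a b k) y = y" "W (alt b a k) y = y"
    using y0 set_alt[of a b k] set_alt[of b a k] by (auto intro!: W_fixes_orthogonal)
  have r: "W (alt a b k) (\<alpha> z) = W (alt b a k) (\<alpha> z)" if "z = a \<or> z = b" for z
    using alt_longest[OF ab k_def] alt_longest[OF ab[symmetric], of k] m_sym[of a b] that
    by (cases "even k") (auto simp: k_def)
  have "x = y + p *\<^sub>R \<alpha> a + q *\<^sub>R \<alpha> b" by (simp add: y_def)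
  then show "W (alt a b (m a b)) x = W (alt b a (m a b)) x"
    unfolding k_def[symmetric] by (simp add: act_add act_scale fy r)
qed

text \<open>Words are compared through their action, so this is minimal length in the group of
  linear maps and no presentation is involved.\<close>

definition reduced :: "'i list \<Rightarrow> bool" where
  "reduced ws \<longleftrightarrow> (\<forall>vs. W vs = W ws \<longrightarrow> length ws \<le> length vs)"

text \<open>Pairing with \<open>P j\<close> reads off the coefficient of \<open>\<alpha> j\<close>
  up to the factor \<open>h j > 0\<close>, so these are the nonnegative combinations of simple
  roots.\<close>

definition nonneg :: "complex \<times> real \<Rightarrow> bool" where
  "nonneg v \<longleftrightarrow> (\<forall>j. mform v (P j) \<ge> 0)"

lemma nonneg_comb: "nonneg x \<Longrightarrow> nonneg y \<Longrightarrow> p \<ge> 0 \<Longrightarrow> q \<ge> 0 \<Longrightarrow> nonneg (p *\<^sub>R x + q *\<^sub>R y)"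
  by (auto simp: nonneg_def)

lemma W_append: "W (us @ vs) = W us \<circ> W vs"
  by (rule ext) (simp add: act_append)

lemma W_cong: "W us = W us' \<Longrightarrow> W vs = W vs' \<Longrightarrow> W (us @ vs) = W (us' @ vs')"
  by (simp add: W_append)

lemma W_double: "W (us @ [x, x] @ vs) = W (us @ vs)"
  by (rule ext) (simp add: act_append mrefl_involution unit)

lemma reduced_exists: "\<exists>vs. reduced vs \<and> W vs = W ws"
proof -
  obtain vs where vs: "W vs = W ws" "\<And>us. W us = W ws \<Longrightarrow> length vs \<le> length us"
    using ex_has_least_nat[of "\<lambda>vs. W vs = W ws" ws length] by auto
  then show ?thesis unfolding reduced_def by metis
qed

text \<open>If \<open>ws\<close> cannot be shortened by appending \<open>i\<close>, split it as \<open>v @ u\<close> with \<open>u\<close> in a dihedral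
  subgroup containing \<open>i\<close> and \<open>v\<close> as short as possible: the induction hypothesis applies to \<open>v\<close>, and
  \<open>u\<close> is an alternating word shorter than the longest one.\<close>

lemma root_nonneg:
  assumes "reduced ws" and "\<And>vs. W vs = W (ws @ [s]) \<Longrightarrow> length ws \<le> length vs"
  shows "nonneg (W ws (\<alpha> s))"
  using assms
proof (induction "length ws" arbitrary: ws s rule: less_induct)
  case less
  show ?case
  proof (cases ws rule: rev_cases)
    case Nil
    have "mform (\<alpha> s) (P j) \<ge> 0" for j using dual[of s j] h_pos[of s] by auto
    then show ?thesis by (simp add: Nil nonneg_def)
  next
    case (snoc ws' t)
    have st: "s \<noteq> t"
    proof
      assume "s = t"
      then have "W ws' = W (ws @ [s])" using W_double[of ws' s "[]"] snoc by simp
      from less.prems(2)[OF this] show False using snoc by simp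
    qed
    \<comment> \<open>Factorisations that keep the length and have their right factor in the
      dihedral subgroup of \<open>s\<close> and \<open>t\<close>. The last letter \<open>t\<close>
      provides one, so the shortest \<open>v\<close> is strictly shorter than
      \<open>ws\<close>.\<close>
    define Q where "Q = (\<lambda>(v, u). W (v @ u) = W ws \<and> length v + length u = length ws \<and> set u \<subseteq> {s, t})"
    have "Q (ws', [t])" by (simp add: Q_def snoc)
    then obtain v u where Qvu: "Q (v, u)" and "\<And>v' u'. Q (v', u') \<Longrightarrow> length v \<le> length v'"
      using ex_has_least_nat[of Q "(ws', [t])" "\<lambda>(v, u). length v"] by auto
    note mn = this(2)
    have vu: "W (v @ u) = W ws" "length v + length u = length ws" "set u \<subseteq> {s, t}"
      using Qvu by (auto simp: Q_def)
    have lv: "length v < length ws" using mn[OF \<open>Q (ws', [t])\<close>] snoc by simp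
    have redv: "reduced v"
      unfolding reduced_def
    proof (intro allI impI)
      fix v' assume "W v' = W v"
      then have "W (v' @ u) = W ws" using vu(1) by (simp add: W_append)
      then show "length v \<le> length v'" using less.prems(1) vu(2) unfolding reduced_def by fastforce
    qed
    \<comment> \<open>If appending \<open>x\<close> shortened \<open>v\<close>, then
      \<open>x\<close> could be moved into the right factor, against the minimality of
      \<open>v\<close>.\<close>
    have up: "length v \<le> length v'" if "W v' = W (v @ [x])" "x \<in> {s, t}" for v' x
    proof (rule ccontr)
      assume "\<not> length v \<le> length v'"
      have W: "W (v' @ x # u) = W ws"
        using W_cong[OF that(1) refl, of "x # u"] vu(1) W_double[of v x u] by simp
      then have "length ws \<le> length (v' @ x # u)" using less.prems(1) unfolding reduced_def by blast
      then have "Q (v', x # u)"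
        using W vu that(2) \<open>\<not> length v \<le> length v'\<close> by (auto simp: Q_def)
      from mn[OF this] \<open>\<not> length v \<le> length v'\<close> show False by simp
    qed
    have pos: "nonneg (W v (\<alpha> x))" if "x \<in> {s, t}" for x
      using less.hyps[OF lv redv, of x] up[OF _ that] by blast
    \<comment> \<open>A minimal spelling of \<open>ws\<close> that ends in \<open>s\<close> would
      become shorter when \<open>s\<close> is appended, against the second hypothesis.\<close>
    have last_not_s: False if "W (v @ u' @ [s]) = W ws" "length v + length u' < length ws" for u'
    proof -
      have "W (v @ u') = W (v @ u' @ [s] @ [s])" using W_double[of "v @ u'" s "[]"] by simp
      also have "\<dots> = W (ws @ [s])" using W_cong[OF that(1) refl, of "[s]"] by simp
      finally show False using less.prems(2) that(2) by fastforce
    qed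
    have nodup: "u \<noteq> us @ [x, x] @ vs" for us x vs
    proof
      assume u: "u = us @ [x, x] @ vs"
      have "W (v @ us @ vs) = W ws" using W_double[of "v @ us" x vs] vu(1) u by simp
      then have "length ws \<le> length (v @ us @ vs)" using less.prems(1) unfolding reduced_def by blast
      then show False using vu(2) u by simp
    qed
    obtain a b where ab: "{a, b} = {s, t}" "a \<noteq> b" and u: "u = alt a b (length u)"
      using alternating_word[OF vu(3) st nodup] by blast
    have ab': "a = s \<and> b = t \<or> a = t \<and> b = s" using ab(1) by (auto simp: doubleton_eq_iff)
    define k where "k = length u"
    have k0: "k > 0" using lv vu(2) by (cases u) (auto simp: k_def)
    have mab: "m a b = m s t" using ab' m_sym[of s t] by auto
    \<comment> \<open>Otherwise \<open>u\<close> would end in \<open>s\<close>. Hence appending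
      \<open>s\<close> to \<open>u\<close> continues the alternation.\<close>
    have next_s: "s = (if even k then a else b)"
    proof (rule ccontr)
      assume c: "s \<noteq> (if even k then a else b)"
      obtain j where j: "k = Suc j" using k0 by (cases k) auto
      have "s = (if even j then a else b)" using c ab' j by (auto split: if_splits)
      then have "u = alt a b j @ [s]" using u j alt_Suc_snoc[of a b j] by (simp add: k_def)
      then show False using last_not_s[of "alt a b j"] vu j k_def by auto
    qed
    \<comment> \<open>If \<open>u\<close> contained the longest alternating word, the braid relation
      would rewrite its end so that it finishes with \<open>s\<close>.\<close>
    have km: "k < m s t"
    proof (rule ccontr)
      assume "\<not> k < m s t"
      then obtain j where j: "k = j + m s t" using le_Suc_ex[of "m s t" k] by (auto simp: add.commute)
      obtain c d where cd: "alt a b k = alt a b j @ alt c d (m s t)" "{c, d} = {s, t}" "c \<noteq> d"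
        using alt_add[of a b j "m s t"] j ab by (cases "even j") auto
      obtain n where n: "m s t = Suc n" using m_ge2[OF st] by (cases "m s t") auto
      have mcd: "m c d = m s t" using cd m_sym[of c d] by (auto simp: doubleton_eq_iff)
      have "W (alt a b k) = W (alt a b j @ alt d c (m s t))"
        using braid[OF cd(3)] mcd cd(1) by (simp add: W_append)
      moreover have "alt d c (m s t) = alt d c n @ [s]"
      proof -
        have "alt a b (Suc k) = alt a b k @ [s]" using alt_Suc_snoc[of a b k] next_s by simp
        then have "last (alt a b k @ [s]) = last (alt a b (Suc k))" by simp
        moreover have "last (alt a b k) \<noteq> s"
          using alt_Suc_snoc[of a b "k - 1"] k0 next_s ab by (cases k) auto
        moreover have "last (alt a b k) = last (alt c d (m s t))"
          using cd(1) n by simp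
        moreover have "last (alt c d (m s t)) = (if even n then c else d)"
          using n alt_Suc_snoc[of c d n] by simp
        ultimately have "s = (if even n then d else c)" using cd by auto
        then show ?thesis using n alt_Suc_snoc[of d c n] by simp
      qed
      ultimately have "W (v @ (alt a b j @ alt d c n) @ [s]) = W ws"
        using vu(1) u k_def W_cong[OF refl, of "alt a b k" "alt a b j @ alt d c (m s t)" v] by simp
      then show False using last_not_s[of "alt a b j @ alt d c n"] vu(2) j k_def n by simp
    qed
    define \<theta> where "\<theta> = pi / m a b"
    have sp: "sin \<theta> > 0" using sin_angle_pos[OF ab(2)] by (simp add: \<theta>_def)
    have m0: "0 < m s t" using km by simp
    have "\<theta> \<ge> 0" by (simp add: \<theta>_def)
    \<comment> \<open>This is where \<open>k < m s t\<close> enters: both angles stay within a half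
      turn, so both coefficients in \<open>alt_root\<close> are nonnegative.\<close>
    have le: "(real k + 1) * \<theta> \<le> pi"
    proof -
      have "(real k + 1) * \<theta> \<le> real (m s t) * \<theta>"
        using km \<open>\<theta> \<ge> 0\<close> by (intro mult_right_mono) linarith+
      also have "\<dots> = pi" using m0 mab by (simp add: \<theta>_def)
      finally show ?thesis .
    qed
    have s1: "sin ((real k + 1) * \<theta>) \<ge> 0" using le \<open>\<theta> \<ge> 0\<close> by (intro sin_ge_zero) auto
    have s2: "sin (real k * \<theta>) \<ge> 0" using le \<open>\<theta> \<ge> 0\<close> by (intro sin_ge_zero) (auto simp: algebra_simps)
    have "W ws (\<alpha> s) = W v (W (alt a b k) (\<alpha> s))"
      using vu(1) u by (metis act_append k_def)
    then have "sin \<theta> *\<^sub>R W ws (\<alpha> s) = W v (sin \<theta> *\<^sub>R W (alt a b k) (\<alpha> (if even k then a else b)))"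
      unfolding next_s[symmetric] by (simp only: act_scale)
    also have "\<dots> = sin ((real k + 1) * \<theta>) *\<^sub>R W v (\<alpha> a) + sin (real k * \<theta>) *\<^sub>R W v (\<alpha> b)"
      unfolding alt_root[OF ab(2) \<theta>_def] by (simp only: act_add act_scale)
    finally have "sin \<theta> *\<^sub>R W ws (\<alpha> s) = \<dots>" .
    moreover have "nonneg \<dots>" using pos ab s1 s2 by (intro nonneg_comb) auto
    ultimately have "nonneg (sin \<theta> *\<^sub>R W ws (\<alpha> s))" by simp
    then show ?thesis using sp by (auto simp: nonneg_def zero_le_mult_iff)
  qed
qed

section \<open>The chamber and distances inside orbits\<close>

lemma P_expansion: "x = (\<Sum>j\<in>UNIV. (mform x (\<alpha> j) / h j) *\<^sub>R P j)"
proof -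
  have "x \<in> span (P ` UNIV)" using P_span by simp
  then obtain c where x: "x = (\<Sum>v\<in>range P. c v *\<^sub>R v)" by (auto simp: span_finite)
  have inj: "inj P"
  proof (rule injI)
    fix i j assume "P i = P j"
    then show "i = j" using dual[of i i] dual[of i j] h_pos[of i] by (auto split: if_splits)
  qed
  have x': "x = (\<Sum>j\<in>UNIV. c (P j) *\<^sub>R P j)" unfolding x by (simp add: sum.reindex[OF inj])
  have "mform x (\<alpha> i) = c (P i) * h i" for i
  proof -
    have "mform x (\<alpha> i) = (\<Sum>j\<in>UNIV. c (P j) * mform (P j) (\<alpha> i))"
      by (subst x') (simp add: mform_sum_left)
    also have "\<dots> = (\<Sum>j\<in>UNIV. if j = i then c (P i) * h i else 0)"
      by (intro sum.cong) (auto simp: mform_commute[of _ "\<alpha> i"] dual)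
    finally show ?thesis by simp
  qed
  then have "mform x (\<alpha> j) / h j = c (P j)" for j using h_pos[of j] by simp
  then show ?thesis using x' by simp
qed

text \<open>By \<open>P_expansion\<close> this is the cone spanned by the vertices; its points on
  the hyperboloid form the triangle.\<close>

definition chamber :: "(complex \<times> real) set" where
  "chamber = {x. \<forall>i. mform x (\<alpha> i) \<ge> 0}"

lemma P_chamber: "P j \<in> chamber"
  using dual h_pos by (auto simp: chamber_def mform_commute[of "P j"] less_imp_le)

lemma nonneg_chamber:
  assumes "nonneg v" "x \<in> chamber"
  shows "mform x v \<ge> 0"
proof -
  have "mform x v = (\<Sum>j\<in>UNIV. mform x (\<alpha> j) / h j * mform (P j) v)"
    by (subst P_expansion[of x]) (simp add: mform_sum_left)
  also have "\<dots> \<ge> 0"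
    using assms h_pos by (intro sum_nonneg mult_nonneg_nonneg divide_nonneg_pos)
      (auto simp: chamber_def nonneg_def mform_commute[of "P _"])
  finally show ?thesis .
qed

lemma reduced_snocD:
  assumes "reduced (ws @ [i])"
  shows "reduced ws" "nonneg (W ws (\<alpha> i))"
proof -
  show r: "reduced ws"
    unfolding reduced_def
  proof (intro allI impI)
    fix vs assume "W vs = W ws"
    then have "W (vs @ [i]) = W (ws @ [i])" by (simp add: W_append)
    then show "length ws \<le> length vs" using assms unfolding reduced_def by fastforce
  qed
  show "nonneg (W ws (\<alpha> i))"
    using assms unfolding reduced_def by (intro root_nonneg[OF r]) fastforce
qed

lemma W_snoc: "W (ws @ [i]) x = W ws x - (2 * mform x (\<alpha> i)) *\<^sub>R W ws (\<alpha> i)"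
  by (simp add: act_append mrefl_def act_diff act_scale)

text \<open>By \<open>W_snoc\<close>, lengthening the word by one letter subtracts a nonnegative
  multiple of a root from the image of \<open>x\<close>, and that root is positive because the
  longer word is reduced.\<close>

lemma reduced_nonneg:
  assumes "reduced ws" "x \<in> chamber"
  shows "nonneg (x - W ws x)"
  using assms(1)
proof (induction ws rule: rev_induct)
  case (snoc i ws)
  have "x - W (ws @ [i]) x = 1 *\<^sub>R (x - W ws x) + (2 * mform x (\<alpha> i)) *\<^sub>R W ws (\<alpha> i)"
    by (simp add: W_snoc)
  moreover have "nonneg \<dots>"
    using snoc reduced_snocD[OF snoc.prems] assms(2) by (intro nonneg_comb) (auto simp: chamber_def)
  ultimately show ?case by (simp only:)
qed (simp add: nonneg_def)

text \<open>Pair \<open>reduced_nonneg\<close> with the second chamber point. In terms of distance,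
  no image of \<open>y\<close> is closer to \<open>x\<close> than \<open>y\<close> itself, which
  puts the triangle inside the Dirichlet cell of each of its vertices.\<close>

lemma chamber_closest:
  assumes "x \<in> chamber" "y \<in> chamber"
  shows "mform x (W ws y) \<le> mform x y"
proof -
  obtain vs where "reduced vs" "W vs = W ws" using reduced_exists by blast
  then show ?thesis using nonneg_chamber[OF reduced_nonneg assms(1), of vs y] assms(2) by simp
qed

text \<open>A word that moves \<open>P j\<close> contains the letter \<open>j\<close>. The letters
  before its first occurrence fix \<open>P j\<close>, so this occurrence contributes exactly
  \<open>2 * (h j)\<^sup>2\<close>, and every later letter contributes a nonnegative amount. The
  bound is the hyperbolic cosine of twice the altitude.\<close>

lemma vertex_orbit_gap:
  assumes "W ws (P j) \<noteq> P j"
  shows "1 + 2 * (h j)\<^sup>2 \<le> - mform (P j) (W ws (P j))"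
proof -
  obtain vs where vs: "reduced vs" "W vs = W ws" using reduced_exists by blast
  have fixed: "W us (P j) = P j" if "j \<notin> set us" for us
    using that dual by (intro W_fixes_orthogonal) (auto simp: mform_commute[of "P j"])
  have "2 * (h j)\<^sup>2 \<le> mform (P j - W vs (P j)) (P j)" if "j \<in> set vs"
    using vs(1) that
  proof (induction vs rule: rev_induct)
    case (snoc i us)
    show ?case
    proof (cases "i = j")
      case False
      have "W (us @ [i]) (P j) = W us (P j)"
        using False by (simp add: W_snoc mform_commute[of "P j"] dual)
      then show ?thesis using snoc reduced_snocD[OF snoc.prems(1)] False by auto
    next
      case True
      have "P j - W (us @ [i]) (P j) = (P j - W us (P j)) + (2 * h j) *\<^sub>R W us (\<alpha> j)"
        using True by (simp add: W_snoc mform_commute[of "P j"] dual)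
      then have eq: "mform (P j - W (us @ [i]) (P j)) (P j) =
          mform (P j - W us (P j)) (P j) + 2 * h j * mform (W us (\<alpha> j)) (P j)"
        by (simp only: mform_simps)
      show ?thesis
      proof (cases "j \<in> set us")
        case True
        have "mform (W us (\<alpha> j)) (P j) \<ge> 0"
          using reduced_snocD[OF snoc.prems(1)] \<open>i = j\<close> by (auto simp: nonneg_def)
        then show ?thesis
          unfolding eq using snoc.IH reduced_snocD[OF snoc.prems(1)] True h_pos[of j]
            mult_nonneg_nonneg[of "2 * h j" "mform (W us (\<alpha> j)) (P j)"] by linarith
      next
        case False
        have "mform (W us (\<alpha> j)) (P j) = h j"
          using fixed[of "rev us"] False dual[of j j] by (simp add: act_adjoint)
        then show ?thesis unfolding eq using fixed[OF False] by (simp add: power2_eq_square)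
      qed
    qed
  qed simp
  moreover have "j \<in> set vs" using fixed[of vs] vs(2) assms by auto
  moreover have "mform (P j) (P j) = -1" using P_hyperboloid by (simp add: hyperboloid_def)
  ultimately show ?thesis using vs(2) by (simp add: mform_commute)
qed

text \<open>If the word fixes \<open>x\<close>, the nonnegative terms that make up
  \<open>x - W ws x\<close> must all vanish. They are detected by the sum \<open>p\<close> of the
  vertices, which is strictly positive on nonzero nonnegative combinations of roots.\<close>

lemma W_fixed_chamber:
  assumes "reduced ws" "x \<in> chamber" "W ws x = x" "i \<in> set ws"
  shows "mform x (\<alpha> i) = 0"
proof -
  define p where "p = (\<Sum>j\<in>UNIV. P j)"
  have p_nonneg: "mform v p \<ge> 0" if "nonneg v" for v
    using that by (auto simp: p_def mform_commute[of v] mform_sum_left nonneg_def intro!: sum_nonneg)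
  have p_pos: "mform v p > 0" if "nonneg v" "v \<noteq> 0" for v
  proof (rule ccontr)
    assume "\<not> mform v p > 0"
    then have "(\<Sum>j\<in>UNIV. mform (P j) v) \<le> 0" by (simp add: p_def mform_commute[of v] mform_sum_left)
    then have "(\<Sum>j\<in>UNIV. mform (P j) v) = 0"
      using that by (intro antisym sum_nonneg) (auto simp: nonneg_def mform_commute[of "P _"])
    then have z: "mform (P j) v = 0" for j
      using that by (subst (asm) sum_nonneg_eq_0_iff) (auto simp: nonneg_def mform_commute[of "P _"])
    have "mform x v = 0" for x
      by (subst P_expansion[of x]) (simp add: mform_sum_left z)
    then have "mform (fst v, - snd v) v = 0" by blast
    then have "v = 0"
      by (auto simp: mform_def prod_eq_iff add_nonneg_eq_0_iff)
    then show False using that by simp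
  qed
  have nz: "W us (\<alpha> i) \<noteq> 0" for us i
    using W_isometry[of us "\<alpha> i" "\<alpha> i"] unit[of i] by (metis mform_simps(9) zero_neq_one)
  have "mform (x - W ws x) p = 0 \<longrightarrow> (\<forall>i\<in>set ws. mform x (\<alpha> i) = 0)"
    using assms(1)
  proof (induction ws rule: rev_induct)
    case (snoc i ws)
    note r = reduced_snocD[OF snoc.prems]
    have "mform (x - W (ws @ [i]) x) p =
        mform (x - W ws x) p + 2 * mform x (\<alpha> i) * mform (W ws (\<alpha> i)) p"
      by (simp add: W_snoc)
    moreover have "mform (x - W ws x) p \<ge> 0" using p_nonneg reduced_nonneg[OF r(1) assms(2)] by blast
    moreover have "mform (W ws (\<alpha> i)) p > 0" using p_pos[OF r(2) nz] .
    moreover have "mform x (\<alpha> i) \<ge> 0" using assms(2) by (simp add: chamber_def)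
    ultimately have "mform (x - W ws x) p = 0 \<and> mform x (\<alpha> i) = 0"
      if "mform (x - W (ws @ [i]) x) p = 0"
      using that add_nonneg_eq_0_iff[of "mform (x - W ws x) p" "2 * mform x (\<alpha> i) * mform (W ws (\<alpha> i)) p"]
      by (simp only: mult_nonneg_nonneg less_imp_le mult_eq_0_iff) auto
    then show ?case using snoc.IH[OF r(1)] by auto
  qed simp
  then show ?thesis using assms(3,4) by simp
qed

text \<open>For \<open>j \<noteq> i\<close> the vertex \<open>P j\<close> lies on the mirror of
  \<open>i\<close>, so a reflection keeps the form against \<open>P j\<close>, whose sign determines
  the sheet.\<close>

lemma W_hyperboloid [simp]: "W ws x \<in> hyperboloid \<longleftrightarrow> x \<in> hyperboloid"
proof -
  have step: "W [i] y \<in> hyperboloid" if y: "y \<in> hyperboloid" for i y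
  proof -
    obtain j where j: "j \<noteq> i" using nontrivial by blast
    have "W [i] (P j) = P j" using j by (simp add: mrefl_def mform_commute[of "P j"] dual)
    then have "mform (P j) (W [i] y) = mform (P j) y" by (metis W_isometry)
    moreover have "mform (W [i] y) (W [i] y) = -1" using y W_isometry[of "[i]" y y] by (simp only: hyperboloid_def mem_Collect_eq)
    ultimately show ?thesis
      using hyperboloid_sheet[OF P_hyperboloid[of j]] mform_hyperboloid_neg[OF P_hyperboloid y] by metis
  qed
  have *: "W ws x \<in> hyperboloid" if "x \<in> hyperboloid" for ws x
    using that step by (induction ws) auto
  show ?thesis using *[of "W ws x" "rev ws"] *[of x ws] by auto
qed

text \<open>Minimise, over all images of \<open>z\<close>, the sum of the hyperbolic cosines of the
  distances to the vertices. Reflecting a minimal image in side \<open>i\<close> changes the sum by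
  \<open>2 * mform (W ws z) (\<alpha> i) * h i\<close>, which therefore is nonnegative. The minimum
  exists because the orbit gap leaves finitely many small values.\<close>

lemma chamber_cover:
  assumes z: "z \<in> hyperboloid"
  shows "\<exists>ws. W ws z \<in> chamber"
proof -
  define f where "f ws = (\<Sum>j\<in>UNIV. - mform (P j) (W ws z))" for ws
  define O' where "O' j = {W ws (P j) | ws. True}" for j
  define M where "M = f []"
  have fin: "finite {x \<in> O' j. - mform x z \<le> M}" for j
  proof (rule finite_separated_hyperboloid[OF _ _ z, of _ "2 * (h j)\<^sup>2"])
    show "O' j \<subseteq> hyperboloid" using P_hyperboloid by (auto simp: O'_def)
    show "0 < 2 * (h j)\<^sup>2" using h_pos[of j] by simp
    fix x y assume "x \<in> O' j" "y \<in> O' j" "x \<noteq> y"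
    then obtain us vs where uv: "x = W us (P j)" "y = W vs (P j)" by (auto simp: O'_def)
    have m: "mform x y = mform (P j) (W (rev us @ vs) (P j))"
      unfolding uv by (simp add: act_adjoint act_append)
    have "W (rev us @ vs) (P j) \<noteq> P j"
      using \<open>x \<noteq> y\<close> uv by (auto simp: act_append) (metis W_rev_cancel(2))
    from vertex_orbit_gap[OF this] show "1 + 2 * (h j)\<^sup>2 \<le> - mform x y" by (simp add: m)
  qed
  \<comment> \<open>By adjointness a value of \<open>f\<close> depends only on the images of the
    vertices under the inverse word, and a value of at most \<open>M\<close> confines each of these
    images to a finite set.\<close>
  let ?F = "(\<lambda>g. \<Sum>j\<in>UNIV. - mform (g j) z) ` (\<Pi>\<^sub>E j\<in>UNIV. {x \<in> O' j. - mform x z \<le> M})"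
  have pos: "- mform (P j) (W ws z) > 0" for j ws
    using mform_hyperboloid_neg[OF P_hyperboloid, of "W ws z" j] z by simp
  have "f ws \<in> ?F" if "f ws \<le> M" for ws
  proof -
    have *: "mform (P j) (W ws z) = mform (W (rev ws) (P j)) z" for j
      by (simp add: act_adjoint)
    have "- mform (P j) (W ws z) \<le> f ws" for j
      unfolding f_def using pos by (intro member_le_sum) (auto simp: less_imp_le)
    then have "- mform (W (rev ws) (P j)) z \<le> M" for j using * that by (metis order_trans)
    then have "(\<lambda>j. W (rev ws) (P j)) \<in> (\<Pi>\<^sub>E j\<in>UNIV. {x \<in> O' j. - mform x z \<le> M})"
      by (auto simp: O'_def PiE_def)
    then show ?thesis unfolding f_def * by (rule rev_image_eqI) simp
  qed
  then have "range f \<inter> {..M} \<subseteq> ?F" by auto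
  moreover have "finite ?F" using fin by (intro finite_imageI finite_PiE) auto
  ultimately have finR: "finite (range f \<inter> {..M})" by (rule finite_subset)
  have ne: "f [] \<in> range f \<inter> {..M}" by (auto simp: M_def)
  define \<mu> where "\<mu> = Min (range f \<inter> {..M})"
  have "\<mu> \<in> range f \<inter> {..M}" unfolding \<mu>_def using finR ne by (intro Min_in) auto
  then obtain ws where ws: "f ws = \<mu>" "\<mu> \<le> M" by auto
  have mn: "f ws \<le> f vs" for vs
  proof (cases "f vs \<le> M")
    case True
    then show ?thesis unfolding ws \<mu>_def using finR by (intro Min_le) auto
  qed (use ws in linarith)
  have "mform (W ws z) (\<alpha> i) \<ge> 0" for i
  proof -
    have "f (i # ws) = f ws + (\<Sum>j\<in>UNIV. 2 * mform (W ws z) (\<alpha> i) * mform (P j) (\<alpha> i))"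
      by (simp add: f_def mrefl_def sum.distrib[symmetric])
    also have "(\<Sum>j\<in>UNIV. 2 * mform (W ws z) (\<alpha> i) * mform (P j) (\<alpha> i)) =
        (\<Sum>j\<in>UNIV. if j = i then 2 * mform (W ws z) (\<alpha> i) * h i else 0)"
      by (intro sum.cong) (auto simp: mform_commute[of "P _"] dual)
    finally have "0 \<le> mform (W ws z) (\<alpha> i) * h i" using mn[of "i # ws"] by (simp add: mult.commute)
    then show ?thesis using h_pos[of i] by (simp add: zero_le_mult_iff)
  qed
  then show ?thesis by (auto simp: chamber_def)
qed

end

section \<open>The hyperboloid model\<close>

text \<open>Inverse stereographic projection of the disc onto the hyperboloid.\<close>

definition lift :: "complex \<Rightarrow> complex \<times> real" where
  "lift z = ((2 / (1 - (cmod z)\<^sup>2)) *\<^sub>R z, (1 + (cmod z)\<^sup>2) / (1 - (cmod z)\<^sup>2))"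

lemma hyp_plane_norm: "z \<in> hyp_plane \<Longrightarrow> 0 < 1 - (cmod z)\<^sup>2"
  by (simp add: abs_square_less_1)

lemma mform_lift:
  assumes "z \<in> hyp_plane" "w \<in> hyp_plane"
  shows "- mform (lift z) (lift w) =
    1 + 2 * (cmod (z - w))\<^sup>2 / ((1 - (cmod z)\<^sup>2) * (1 - (cmod w)\<^sup>2))"
proof -
  define a b where "a = (cmod z)\<^sup>2" and "b = (cmod w)\<^sup>2"
  have "(cmod (z - w))\<^sup>2 = (cmod z)\<^sup>2 + (cmod w)\<^sup>2 - 2 * (z \<bullet> w)"
    by (simp add: power2_norm_eq_inner inner_diff inner_commute)
  then have n: "(1 + a) * (1 + b) - 4 * (z \<bullet> w) = (1 - a) * (1 - b) + 2 * (cmod (z - w))\<^sup>2"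
    by (simp add: a_def b_def algebra_simps)
  have nz: "(1 - a) * (1 - b) \<noteq> 0"
    using hyp_plane_norm[OF assms(1)] hyp_plane_norm[OF assms(2)] by (simp add: a_def b_def)
  have "- mform (lift z) (lift w) = ((1 + a) * (1 + b) - 4 * (z \<bullet> w)) / ((1 - a) * (1 - b))"
    by (simp add: mform_def lift_def a_def b_def diff_divide_distrib)
  also have "\<dots> = 1 + 2 * (cmod (z - w))\<^sup>2 / ((1 - a) * (1 - b))"
    unfolding n using nz by (simp add: add_divide_distrib)
  finally show ?thesis by (simp add: a_def b_def)
qed

lemma lift_hyperboloid: "z \<in> hyp_plane \<Longrightarrow> lift z \<in> hyperboloid"
  using mform_lift[of z z] hyp_plane_norm[of z] by (auto simp: hyperboloid_def lift_def add_pos_nonneg)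

lemma hyp_dist_lift:
  "z \<in> hyp_plane \<Longrightarrow> w \<in> hyp_plane \<Longrightarrow> hyp_dist z w = arcosh (- mform (lift z) (lift w))"
  by (simp add: hyp_dist_def mform_lift)

lemma mform_lift_ge1:
  assumes "z \<in> hyp_plane" "w \<in> hyp_plane"
  shows "1 \<le> - mform (lift z) (lift w)"
  unfolding mform_lift[OF assms] using hyp_plane_norm[OF assms(1)] hyp_plane_norm[OF assms(2)]
  by simp

lemma mform_lift_gt1:
  assumes "z \<in> hyp_plane" "w \<in> hyp_plane" "z \<noteq> w"
  shows "1 < - mform (lift z) (lift w)"
  unfolding mform_lift[OF assms(1,2)] using hyp_plane_norm[OF assms(1)] hyp_plane_norm[OF assms(2)] assms(3)
  by (simp add: divide_pos_pos)

lemma cosh_hyp_dist: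
  "z \<in> hyp_plane \<Longrightarrow> w \<in> hyp_plane \<Longrightarrow> cosh (hyp_dist z w) = - mform (lift z) (lift w)"
  using mform_lift_ge1 by (simp add: hyp_dist_lift)

lemma hyp_dist_nonneg: "z \<in> hyp_plane \<Longrightarrow> w \<in> hyp_plane \<Longrightarrow> 0 \<le> hyp_dist z w"
  using mform_lift_ge1 by (simp add: hyp_dist_lift)

lemma hyp_dist_le_iff:
  assumes "z \<in> hyp_plane" "w \<in> hyp_plane" "z' \<in> hyp_plane" "w' \<in> hyp_plane"
  shows "hyp_dist z w \<le> hyp_dist z' w' \<longleftrightarrow> mform (lift z') (lift w') \<le> mform (lift z) (lift w)"
  using mform_lift_ge1[OF assms(1,2)] mform_lift_ge1[OF assms(3,4)] assms
  by (simp add: hyp_dist_lift not_less[symmetric])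

lemma lift_inj: "z \<in> hyp_plane \<Longrightarrow> w \<in> hyp_plane \<Longrightarrow> lift z = lift w \<longleftrightarrow> z = w"
  using mform_lift_gt1[of z w] mform_lift[of w w] by (cases "z = w") auto

section \<open>Moebius maps as Lorentz transformations\<close>

lemma mform_nondegenerate: "(\<And>y. mform x y = 0) \<Longrightarrow> x = 0"
  using mform_def[of x "(fst x, - snd x)"] by (auto simp: prod_eq_iff add_nonneg_eq_0_iff)

text \<open>The Lorentz transformation induced by \<open>Moebius_function 0 a\<close>.\<close>

definition boost :: "complex \<Rightarrow> complex \<times> real \<Rightarrow> complex \<times> real" where
  "boost a x = (1 / (1 - (cmod a)\<^sup>2)) *\<^sub>R
     (fst x + a\<^sup>2 * cnj (fst x) - (2 * snd x) *\<^sub>R a, (1 + (cmod a)\<^sup>2) * snd x - 2 * (fst x \<bullet> a))"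

lemma boost_linear: "linear (boost a)"
  by (rule linearI) (simp_all add: boost_def prod_eq_iff algebra_simps inner_add_left)

lemmas boost_add = linear_add[OF boost_linear]
  and boost_diff = linear_diff[OF boost_linear]
  and boost_scale = linear_scale[OF boost_linear]

lemma snd_boost: "snd (boost a x) = - mform x (lift a)"
  by (simp add: boost_def mform_def lift_def diff_divide_distrib)

lemma boost_quadratic:
  assumes "a \<in> hyp_plane"
  shows "mform (boost a x) (boost a x) = mform x x"
proof -
  obtain v t where x: "x = (v, t)" by (cases x)
  define D where "D = 1 - (cmod a)\<^sup>2"
  have D: "D > 0" using hyp_plane_norm[OF assms] by (simp add: D_def)
  have "(norm (v + a\<^sup>2 * cnj v - (2 * t) *\<^sub>R a))\<^sup>2 - ((1 + (cmod a)\<^sup>2) * t - 2 * (v \<bullet> a))\<^sup>2 =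
      D\<^sup>2 * ((norm v)\<^sup>2 - t\<^sup>2)"
    unfolding D_def cmod_power2 inner_complex_def
    by (simp add: power2_eq_square algebra_simps)
  moreover have "mform (boost a x) (boost a x) = (1 / D)\<^sup>2 *
      ((norm (v + a\<^sup>2 * cnj v - (2 * t) *\<^sub>R a))\<^sup>2 - ((1 + (cmod a)\<^sup>2) * t - 2 * (v \<bullet> a))\<^sup>2)"
    unfolding boost_def mform_simps mform_self D_def[symmetric] x
    by (simp add: power_divide diff_divide_distrib[symmetric] power2_eq_square[of D])
  ultimately show ?thesis using D by (simp add: mform_self x power2_eq_square)
qed

lemma boost_isometry:
  assumes "a \<in> hyp_plane"
  shows "mform (boost a x) (boost a y) = mform x y"
  using boost_quadratic[OF assms, of "x + y"] boost_quadratic[OF assms, of x]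
    boost_quadratic[OF assms, of y] mform_commute[of x y] mform_commute[of "boost a x" "boost a y"]
  by (simp add: boost_add)

lemma boost_inj:
  assumes "a \<in> hyp_plane" "boost a x = boost a y"
  shows "x = y"
proof -
  have "mform (x - y) z = 0" for z
    using boost_isometry[OF assms(1), of "x - y" z] assms(2) by (simp add: boost_diff)
  then show ?thesis using mform_nondegenerate[of "x - y"] by simp
qed

lemma Moebius_in_plane: "a \<in> hyp_plane \<Longrightarrow> z \<in> hyp_plane \<Longrightarrow> Moebius_function t a z \<in> hyp_plane"
  using Moebius_function_norm_lt_1 by simp

lemma Moebius_denominator: "a \<in> hyp_plane \<Longrightarrow> z \<in> hyp_plane \<Longrightarrow> 1 - cnj a * z \<noteq> 0"
proof
  assume "a \<in> hyp_plane" "z \<in> hyp_plane" "1 - cnj a * z = 0"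
  then have "cmod (cnj a * z) = 1" by (metis eq_iff_diff_eq_0 norm_one)
  moreover have "cmod (cnj a * z) < 1 * 1"
    using \<open>a \<in> hyp_plane\<close> \<open>z \<in> hyp_plane\<close> unfolding norm_mult by (intro mult_strict_mono') auto
  ultimately show False by simp
qed

lemma Moebius_norm:
  assumes "a \<in> hyp_plane" "z \<in> hyp_plane"
  shows "1 - (cmod (Moebius_function t a z))\<^sup>2 =
    (1 - (cmod a)\<^sup>2) * (1 - (cmod z)\<^sup>2) / (cmod (1 - cnj a * z))\<^sup>2"
proof -
  have nz: "(cmod (1 - cnj a * z))\<^sup>2 \<noteq> 0" using Moebius_denominator[OF assms] by simp
  have "(cmod (1 - cnj a * z))\<^sup>2 - (cmod (z - a))\<^sup>2 = (1 - (cmod a)\<^sup>2) * (1 - (cmod z)\<^sup>2)"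
    unfolding cmod_power2 by (simp add: power2_eq_square algebra_simps)
  moreover have "cmod (Moebius_function t a z) = cmod (z - a) / cmod (1 - cnj a * z)"
    by (simp add: Moebius_function_def norm_mult norm_divide)
  ultimately show ?thesis
    using nz by (simp add: power_divide) (metis diff_divide_distrib divide_self nz)
qed

lemma boost_lift:
  assumes a: "a \<in> hyp_plane" and z: "z \<in> hyp_plane"
  shows "boost a (lift z) = lift (Moebius_function 0 a z)"
proof -
  define u N D Z where "u = Moebius_function 0 a z" and "N = 1 - cnj a * z"
    and "D = 1 - (cmod a)\<^sup>2" and "Z = 1 - (cmod z)\<^sup>2"
  have nz: "N \<noteq> 0" "D > 0" "Z > 0"
    using Moebius_denominator[OF assms] hyp_plane_norm[OF a] hyp_plane_norm[OF z]
    by (simp_all add: N_def D_def Z_def)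
  have u: "u * N = z - a" using nz by (simp add: u_def N_def Moebius_function_simple)
  have un: "1 - (cmod u)\<^sup>2 = D * Z / (cmod N)\<^sup>2"
    using Moebius_norm[OF assms, of 0] by (simp add: u_def N_def D_def Z_def)
  have N2: "complex_of_real ((cmod N)\<^sup>2) = N * cnj N"
    using complex_norm_square[of N] by simp
  have "fst (lift u) = (2 * (cmod N)\<^sup>2 / (D * Z)) *\<^sub>R u" by (simp add: lift_def un)
  also have "\<dots> = (2 / (D * Z)) *\<^sub>R (complex_of_real ((cmod N)\<^sup>2) * u)"
    by (simp add: scaleR_conv_of_real)
  \<comment> \<open>Multiplying by the squared modulus of the Moebius denominator clears it and
    leaves a polynomial in \<open>z\<close> and \<open>cnj z\<close>.\<close>
  also have "complex_of_real ((cmod N)\<^sup>2) * u = (z - a) * cnj N"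
    unfolding N2 u[symmetric] by simp
  also have "(z - a) * cnj N = z + a\<^sup>2 * cnj z - complex_of_real (1 + (cmod z)\<^sup>2) * a"
  proof -
    have "complex_of_real (1 + (cmod z)\<^sup>2) = 1 + z * cnj z" by (simp add: complex_norm_square[symmetric])
    then show ?thesis unfolding N_def by (simp add: algebra_simps power2_eq_square)
  qed
  also have "(2 / (D * Z)) *\<^sub>R (z + a\<^sup>2 * cnj z - complex_of_real (1 + (cmod z)\<^sup>2) * a) =
      (1 / D) *\<^sub>R ((2 / Z) *\<^sub>R z + a\<^sup>2 * cnj ((2 / Z) *\<^sub>R z) - (2 * ((1 + (cmod z)\<^sup>2) / Z)) *\<^sub>R a)"
    by (simp add: scaleR_conv_of_real algebra_simps add_divide_distrib)
  also have "\<dots> = fst (boost a (lift z))"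
    by (simp add: boost_def lift_def D_def Z_def)
  finally have 1: "fst (boost a (lift z)) = fst (lift u)" ..
  have "snd (boost a (lift z)) = 1 + 2 * (cmod (z - a))\<^sup>2 / (Z * D)"
    unfolding snd_boost using mform_lift[OF z a] by (simp add: Z_def D_def)
  also have "(cmod (z - a))\<^sup>2 = (cmod u)\<^sup>2 * (cmod N)\<^sup>2"
    by (simp add: u[symmetric] norm_mult power_mult_distrib)
  also have "1 + 2 * ((cmod u)\<^sup>2 * (cmod N)\<^sup>2) / (Z * D) = 1 + 2 * (cmod u)\<^sup>2 / (1 - (cmod u)\<^sup>2)"
    by (simp add: un mult.commute)
  also have "\<dots> = snd (lift u)"
    using hyp_plane_norm[OF Moebius_in_plane[OF assms, of 0]] by (simp add: lift_def u_def field_simps)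
  finally show ?thesis using 1 by (simp add: prod_eq_iff u_def)
qed

section \<open>Rotations, reflections and angles in centred coordinates\<close>

lemma boost_rotation:
  assumes "a \<in> hyp_plane" "z \<in> hyp_plane"
  shows "boost a (lift (hyp_rotation a \<theta> z)) =
    (cis \<theta> * fst (boost a (lift z)), snd (boost a (lift z)))"
proof -
  define w where "w = Moebius_function \<theta> a z"
  have w: "w = cis \<theta> * Moebius_function 0 a z"
    by (simp add: w_def Moebius_function_def cis_conv_exp)
  have wp: "w \<in> hyp_plane" using Moebius_in_plane[OF assms] by (simp add: w_def)
  have ma: "- a \<in> hyp_plane" using assms by simp
  have "hyp_rotation a \<theta> z = Moebius_function 0 (- a) w" using assms by (simp add: hyp_rotation_def w_def)
  moreover have "Moebius_function 0 a (Moebius_function 0 (- a) w) = w"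
    using assms wp by (intro Moebius_function_compose) auto
  ultimately have "boost a (lift (hyp_rotation a \<theta> z)) = lift w"
    using boost_lift[OF assms(1) Moebius_in_plane[OF ma wp]] by simp
  also have "\<dots> = (cis \<theta> * fst (lift (Moebius_function 0 a z)), snd (lift (Moebius_function 0 a z)))"
    by (simp add: lift_def w norm_mult)
  finally show ?thesis using boost_lift[OF assms] by simp
qed

lemma hyp_rotation_in_plane: "a \<in> hyp_plane \<Longrightarrow> z \<in> hyp_plane \<Longrightarrow> hyp_rotation a \<theta> z \<in> hyp_plane"
  by (simp add: hyp_rotation_def Moebius_function_norm_lt_1)

text \<open>With \<open>a\<close> moved to the origin, a geodesic through \<open>a\<close> becomes a
  diameter with unit normal \<open>\<eta>\<close>, and the reflection in it becomes the Euclidean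
  one.\<close>

lemma boost_refl:
  assumes a: "a \<in> hyp_plane" and \<alpha>: "mform \<alpha> \<alpha> = 1" "mform \<alpha> (lift a) = 0"
  defines "\<eta> \<equiv> fst (boost a \<alpha>)"
  shows "cmod \<eta> = 1" "boost a \<alpha> = (\<eta>, 0)"
    "boost a (mrefl \<alpha> x) = (- \<eta>\<^sup>2 * cnj (fst (boost a x)), snd (boost a x))"
proof -
  have s0: "snd (boost a \<alpha>) = 0" using \<alpha> by (simp add: snd_boost)
  then show b: "boost a \<alpha> = (\<eta>, 0)" by (simp add: prod_eq_iff \<eta>_def)
  have "(cmod \<eta>)\<^sup>2 = 1" using boost_isometry[OF a, of \<alpha> \<alpha>] \<alpha> s0 by (simp add: mform_self \<eta>_def)
  then show n: "cmod \<eta> = 1" by (simp add: power2_eq_1_iff) (smt (verit) norm_ge_zero)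
  define \<zeta> where "\<zeta> = fst (boost a x)"
  have "mform x \<alpha> = \<zeta> \<bullet> \<eta>" using boost_isometry[OF a, of x \<alpha>] by (simp add: b mform_def \<zeta>_def)
  then have "boost a (mrefl \<alpha> x) = boost a x - (2 * (\<zeta> \<bullet> \<eta>)) *\<^sub>R (\<eta>, 0)"
    by (simp add: mrefl_def boost_diff boost_scale b)
  moreover have "\<zeta> - (2 * (\<zeta> \<bullet> \<eta>)) *\<^sub>R \<eta> = - \<eta>\<^sup>2 * cnj \<zeta>"
  proof -
    have "complex_of_real (2 * (\<zeta> \<bullet> \<eta>)) = \<zeta> * cnj \<eta> + cnj \<zeta> * \<eta>"
      by (simp add: complex_eq_iff inner_complex_def)
    moreover have "\<eta> * cnj \<eta> = 1" using n by (simp add: complex_norm_square[symmetric])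
    ultimately show ?thesis unfolding scaleR_conv_of_real
      by (simp add: algebra_simps power2_eq_square) 
  qed
  ultimately show "boost a (mrefl \<alpha> x) = (- \<eta>\<^sup>2 * cnj (fst (boost a x)), snd (boost a x))"
    by (simp add: prod_eq_iff \<zeta>_def)
qed

text \<open>Reflections in diameters with unit normals \<open>\<eta>\<close> and
  \<open>\<kappa>\<close> compose to multiplication by the square of
  \<open>\<eta> * cnj \<kappa>\<close>. The form determines only the real part of this number, so
  the sense of rotation stays open and is recorded by \<open>s\<close>.\<close>

lemma rotation_eq_two_reflections:
  assumes P: "P \<in> hyp_plane"
    and \<alpha>: "mform \<alpha> \<alpha> = 1" "mform \<alpha> (lift P) = 0"
    and \<beta>: "mform \<beta> \<beta> = 1" "mform \<beta> (lift P) = 0"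
    and b: "mform \<alpha> \<beta> = - cos b"
  shows "\<exists>s\<in>{1, -1}. \<forall>z\<in>hyp_plane.
     lift (hyp_rotation P (s * (2 * b)) z) = mrefl \<alpha> (mrefl \<beta> (lift z)) \<and>
     lift (hyp_rotation P (- s * (2 * b)) z) = mrefl \<beta> (mrefl \<alpha> (lift z))"
proof -
  define \<eta> \<kappa> where "\<eta> = fst (boost P \<alpha>)" and "\<kappa> = fst (boost P \<beta>)"
  note A = boost_refl[OF P \<alpha>, folded \<eta>_def] and B = boost_refl[OF P \<beta>, folded \<kappa>_def]
  define \<epsilon> where "\<epsilon> = \<eta> * cnj \<kappa>"
  have re: "Re \<epsilon> = - cos b"
    using boost_isometry[OF P, of \<alpha> \<beta>] b by (simp add: A B mform_def \<epsilon>_def inner_complex_def)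
  have "cmod \<epsilon> = 1" by (simp add: \<epsilon>_def norm_mult A(1) B(1))
  then have "(Re \<epsilon>)\<^sup>2 + (Im \<epsilon>)\<^sup>2 = 1" by (metis cmod_power2 one_power2)
  then have "(Im \<epsilon>)\<^sup>2 = (sin b)\<^sup>2" using re sin_cos_squared_add[of b] by (metis add_diff_cancel_left' add.commute power2_minus)
  then obtain s where s: "s \<in> {1, -1::real}" "Im \<epsilon> = - s * sin b"
    by (metis insertCI mult_minus1 mult_minus_left mult_1 power2_eq_iff minus_minus)
  have "s * s = 1" using s(1) by auto
  have e2: "\<epsilon>\<^sup>2 = cis (s * (2 * b))"
  proof -
    have "cos (s * (2 * b)) = (cos b)\<^sup>2 - (sin b)\<^sup>2" "sin (s * (2 * b)) = 2 * s * sin b * cos b"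
      using s(1) by (auto simp: cos_double sin_double)
    then show ?thesis using re s \<open>s * s = 1\<close>
      by (auto simp: complex_eq_iff power2_eq_square)
  qed
  then have e2': "(cnj \<epsilon>)\<^sup>2 = cis (- s * (2 * b))" by (metis cis_cnj complex_cnj_power mult_minus_left)
  show ?thesis
  proof (rule bexI[OF _ s(1)], intro ballI conjI)
    fix z assume z: "z \<in> hyp_plane"
    have "boost P (mrefl \<alpha> (mrefl \<beta> (lift z))) = boost P (lift (hyp_rotation P (s * (2 * b)) z))"
      unfolding A(3) B(3) boost_rotation[OF P z] e2[symmetric] by (simp add: \<epsilon>_def power_mult_distrib)
    then show "lift (hyp_rotation P (s * (2 * b)) z) = mrefl \<alpha> (mrefl \<beta> (lift z))"
      using boost_inj[OF P] by metis
    have "boost P (mrefl \<beta> (mrefl \<alpha> (lift z))) = boost P (lift (hyp_rotation P (- s * (2 * b)) z))"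
      unfolding A(3) B(3) boost_rotation[OF P z] e2'[symmetric]
      by (simp add: \<epsilon>_def power_mult_distrib mult.commute)
    then show "lift (hyp_rotation P (- s * (2 * b)) z) = mrefl \<beta> (mrefl \<alpha> (lift z))"
      using boost_inj[OF P] by metis
  qed
qed

text \<open>The hyperbolic law of cosines, read off in coordinates centred at \<open>P\<close>:
  there \<open>q\<close> and \<open>r\<close> are the heights of the two lifted points and the
  square roots are the norms of their planar parts.\<close>

lemma hyp_angle_law:
  assumes "Q \<in> hyp_plane" "P \<in> hyp_plane" "R \<in> hyp_plane" "Q \<noteq> P" "R \<noteq> P"
  defines "q \<equiv> - mform (lift P) (lift Q)" and "r \<equiv> - mform (lift P) (lift R)"
  shows "cos (hyp_angle Q P R) * (sqrt (q\<^sup>2 - 1) * sqrt (r\<^sup>2 - 1)) = q * r + mform (lift Q) (lift R)"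
proof -
  define u v where "u = Moebius_function 0 P Q" and "v = Moebius_function 0 P R"
  have uv: "u \<in> hyp_plane" "v \<in> hyp_plane" using assms Moebius_in_plane by (auto simp: u_def v_def)
  have lu: "lift u = boost P (lift Q)" and lv: "lift v = boost P (lift R)"
    using assms boost_lift by (simp_all add: u_def v_def)
  have nz: "u \<noteq> 0" "v \<noteq> 0"
    using Moebius_denominator assms by (auto simp: u_def v_def Moebius_function_simple)
  have su: "snd (lift u) = q" "snd (lift v) = r"
    by (simp_all add: lu lv snd_boost q_def r_def mform_commute)
  have n: "norm (fst (lift u)) = sqrt (q\<^sup>2 - 1)" "norm (fst (lift v)) = sqrt (r\<^sup>2 - 1)"
    using hyperboloid_norm[OF lift_hyperboloid[OF uv(1)]] hyperboloid_norm[OF lift_hyperboloid[OF uv(2)]]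
    by (simp_all add: su[symmetric] real_sqrt_unique)
  have "\<bar>(u \<bullet> v) / (norm u * norm v)\<bar> \<le> 1"
    using Cauchy_Schwarz_ineq2[of u v] nz by (simp add: abs_mult field_simps)
  then have "cos (hyp_angle Q P R) = (u \<bullet> v) / (norm u * norm v)"
    by (simp add: hyp_angle_def u_def v_def Let_def cos_arccos_abs)
  then have "cos (hyp_angle Q P R) * (norm u * norm v) = u \<bullet> v" using nz by simp
  then have "cos (hyp_angle Q P R) * (norm (fst (lift u)) * norm (fst (lift v))) = fst (lift u) \<bullet> fst (lift v)"
    using hyp_plane_norm[OF uv(1)] hyp_plane_norm[OF uv(2)] by (simp add: lift_def) (simp add: field_simps)
  also have "\<dots> = mform (lift u) (lift v) + q * r" by (simp add: mform_def su)
  also have "mform (lift u) (lift v) = mform (lift Q) (lift R)"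
    using assms by (simp add: lu lv boost_isometry)
  finally show ?thesis by (simp add: n)
qed

section \<open>Hyperbolic area and its invariance\<close>

text \<open>The change of variables theorem applied below speaks of \<open>real ^ 'n\<close> and
  matrix determinants; this isometry carries it over to \<open>complex\<close>.\<close>

definition vec_complex :: "real^2 \<Rightarrow> complex" where
  "vec_complex v = Complex (v $ 1) (v $ 2)"

definition complex_vec :: "complex \<Rightarrow> real^2" where
  "complex_vec z = vector [Re z, Im z]"

lemma vec_complex_inverse [simp]: "complex_vec (vec_complex v) = v"
  by (simp add: vec_complex_def complex_vec_def vec_eq_iff forall_2)

lemma complex_vec_inverse [simp]: "vec_complex (complex_vec z) = z"
  by (simp add: vec_complex_def complex_vec_def)

lemma vec_complex_linear: "linear vec_complex"
  by (rule linearI) (simp_all add: vec_complex_def complex_eq_iff)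

lemma complex_vec_linear: "linear complex_vec"
  by (rule linearI) (simp_all add: complex_vec_def vec_eq_iff forall_2)

lemma vec_complex_measurable [measurable]: "vec_complex \<in> borel_measurable borel"
  by (intro borel_measurable_continuous_onI linear_continuous_on linear_conv_bounded_linear[THEN iffD1]
      vec_complex_linear)

lemma complex_vec_measurable [measurable]: "complex_vec \<in> borel_measurable borel"
  by (intro borel_measurable_continuous_onI linear_continuous_on linear_conv_bounded_linear[THEN iffD1]
      complex_vec_linear)

lemma lborel_complex_vec: "lborel = distr lborel borel vec_complex"
proof (rule lborel_eqI)
  fix l u :: complex
  assume le: "\<And>b. b \<in> Basis \<Longrightarrow> l \<bullet> b \<le> u \<bullet> b"
  have r: "Re l \<le> Re u" and i: "Im l \<le> Im u" using le[of 1] le[of \<i>] by (auto simp: Basis_complex_def)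
  have "vec_complex -` box l u = box (complex_vec l) (complex_vec u)"
    by (auto simp: vec_complex_def complex_vec_def mem_box_cart forall_2 box_complex_eq)
  then have "emeasure (distr lborel borel vec_complex) (box l u) =
      emeasure lborel (box (complex_vec l) (complex_vec u))"
    by (subst emeasure_distr) auto
  also have "\<dots> = (\<Prod>b\<in>Basis. (complex_vec u - complex_vec l) \<bullet> b)"
  proof -
    have "\<forall>b\<in>Basis. complex_vec l \<bullet> b \<le> complex_vec u \<bullet> b"
      using r i by (auto simp: Basis_vec_def complex_vec_def inner_axis forall_2)
    then show ?thesis by (subst emeasure_lborel_box_eq) (simp add: inner_diff_left)
  qed
  also have "(\<Prod>b\<in>Basis. (complex_vec u - complex_vec l) \<bullet> b) = (Re u - Re l) * (Im u - Im l)"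
  proof -
    have B: "(Basis :: (real^2) set) = {axis 1 1, axis 2 1}"
      by (auto simp: Basis_vec_def UNIV_2)
    show ?thesis unfolding B by (simp add: inner_axis complex_vec_def axis_eq_axis)
  qed
  also have "\<dots> = (\<Prod>b\<in>Basis. (u - l) \<bullet> b)"
    by (simp add: Basis_complex_def inner_complex_def complex_eq_iff)
  finally show "emeasure (distr lborel borel vec_complex) (box l u) = (\<Prod>b\<in>Basis. (u - l) \<bullet> b)" .
qed simp

lemma emeasure_complex_vec: "S \<in> sets borel \<Longrightarrow> emeasure lborel (S :: complex set) = emeasure lborel (vec_complex -` S)"
  by (subst lborel_complex_vec) (simp add: emeasure_distr)

section \<open>Change of variables under injective holomorphic maps\<close>

lemma holomorphic_restrict_measurable:
  assumes "h holomorphic_on U" "open U"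
  shows "(\<lambda>z. h z * indicator U z) \<in> borel_measurable borel"
proof -
  have "h \<in> borel_measurable (restrict_space borel U)"
    using assms by (intro borel_measurable_continuous_on_restrict holomorphic_on_imp_continuous_on)
  then have "(\<lambda>z. indicat_real U z *\<^sub>R h z) \<in> borel_measurable borel"
    using assms(2) by (subst (asm) borel_measurable_restrict_space_iff) auto
  moreover have "(\<lambda>z. indicat_real U z *\<^sub>R h z) = (\<lambda>z. h z * indicator U z)"
    by (auto simp: fun_eq_iff indicator_def)
  ultimately show ?thesis by simp
qed

lemma holomorphic_image_borel:
  assumes f: "f holomorphic_on U" "open U" "inj_on f U" and S: "S \<in> sets borel" "S \<subseteq> U"
  shows "f ` S \<in> sets borel"
proof -
  obtain g where g: "g holomorphic_on f ` U" "\<And>z. z \<in> U \<Longrightarrow> g (f z) = z"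
    using holomorphic_has_inverse[OF f] by metis
  have o: "open (f ` U)" using open_mapping_thm3[OF f] .
  have "f ` S = g -` S \<inter> f ` U"
    using g(2) S(2) by (auto simp: image_iff)
  moreover have "g \<in> borel_measurable (restrict_space borel (f ` U))"
    by (intro borel_measurable_continuous_on_restrict holomorphic_on_imp_continuous_on g)
  then have "g -` S \<inter> space (restrict_space borel (f ` U)) \<in> sets (restrict_space borel (f ` U))"
    using S(1) by (rule measurable_sets)
  ultimately have "f ` S \<in> sets (restrict_space borel (f ` U))" by (simp add: space_restrict_space)
  then show ?thesis using o by (subst (asm) sets_restrict_space_iff) auto
qed

text \<open>The real Jacobian of a holomorphic map is the squared modulus of its derivative.
  Boundedness of the image provides the finite measure that the theorem on differentiable images
  asks for.\<close>

lemma emeasure_holomorphic_image: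
  assumes f: "f holomorphic_on U" "open U" "inj_on f U" and b: "bounded (f ` U)"
    and S: "S \<in> sets borel" "S \<subseteq> U"
  shows "emeasure lborel (f ` S) = (\<integral>\<^sup>+z. ennreal ((cmod (deriv f z))\<^sup>2) * indicator S z \<partial>lborel)"
proof -
  define F F' where "F = complex_vec \<circ> f \<circ> vec_complex"
    and "F' v h = complex_vec (deriv f (vec_complex v) * vec_complex h)" for v h
  define T where "T = vec_complex -` S"
  have bl: "bounded_linear complex_vec" "bounded_linear vec_complex"
    using complex_vec_linear vec_complex_linear linear_conv_bounded_linear by auto
  have Tb: "T \<in> sets borel" unfolding T_def using measurable_sets[OF vec_complex_measurable S(1)] by simp
  have TL: "T \<in> sets lebesgue" using Tb by simp
  have der: "(F has_derivative F' v) (at v within T)" if "v \<in> T" for v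
  proof -
    have "(f has_field_derivative deriv f (vec_complex v)) (at (vec_complex v))"
      using that S f holomorphic_derivI by (auto simp: T_def)
    then have 1: "(f has_derivative (*) (deriv f (vec_complex v))) (at (vec_complex v) within vec_complex ` T)"
      by (auto simp: has_field_derivative_def intro: has_derivative_at_withinI)
    have "(f \<circ> vec_complex has_derivative (*) (deriv f (vec_complex v)) \<circ> vec_complex) (at v within T)"
      by (rule diff_chain_within[OF bounded_linear_imp_has_derivative[OF bl(2)] 1])
    from diff_chain_within[OF this bounded_linear_imp_has_derivative[OF bl(1)]]
    show ?thesis by (simp add: F_def F'_def[abs_def] o_def)
  qed
  have injF: "inj_on F T"
  proof (rule inj_onI)
    fix x y assume xy: "x \<in> T" "y \<in> T" "F x = F y"
    then have "f (vec_complex x) = f (vec_complex y)" by (metis F_def comp_apply complex_vec_inverse)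
    then have "vec_complex x = vec_complex y" using xy f(3) S(2) by (auto simp: T_def dest: inj_onD)
    then show "x = y" by (metis vec_complex_inverse)
  qed
  have det: "\<bar>det (matrix (F' v))\<bar> = (cmod (deriv f (vec_complex v)))\<^sup>2" for v
    by (simp add: det_2 matrix_def F'_def vec_complex_def complex_vec_def axis_def cmod_power2)
      (simp add: power2_eq_square)
  have FT: "F ` T = vec_complex -` (f ` S)"
  proof (intro equalityI subsetI)
    fix x assume "x \<in> vec_complex -` (f ` S)"
    then obtain s where "s \<in> S" "vec_complex x = f s" by auto
    then have "complex_vec s \<in> T" "x = F (complex_vec s)"
      by (auto simp: T_def F_def) (metis vec_complex_inverse)
    then show "x \<in> F ` T" by blast
  next
    fix x assume "x \<in> F ` T"
    then show "x \<in> vec_complex -` (f ` S)" by (auto simp: F_def T_def)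
  qed
  have fS: "f ` S \<in> sets borel" by (rule holomorphic_image_borel[OF f S])
  have FTb: "F ` T \<in> sets borel" unfolding FT using measurable_sets[OF vec_complex_measurable fS] by simp
  have "bounded (F ` T)"
  proof -
    have "F ` T \<subseteq> complex_vec ` (f ` U)" using S(2) by (auto simp: F_def T_def)
    then show ?thesis using bounded_linear_image[OF b bl(1)] bounded_subset by blast
  qed
  then have lm: "F ` T \<in> lmeasurable" using FTb by (intro bounded_set_imp_lmeasurable) auto
  have hi: "((\<lambda>v. \<bar>det (matrix (F' v))\<bar>) has_integral measure lebesgue (F ` T)) T"
    using has_measure_differentiable_image[OF TL der injF, of "measure lebesgue (F ` T)"] lm by blast
  have "emeasure lborel (f ` S) = emeasure lborel (F ` T)"
    by (simp add: FT emeasure_complex_vec[OF fS])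
  also have "\<dots> = ennreal (measure lebesgue (F ` T))"
    using emeasure_eq_measure2[OF lm] FTb by simp
  also have "\<dots> = (\<integral>\<^sup>+v. ennreal \<bar>det (matrix (F' v))\<bar> * indicator T v \<partial>lborel)"
    by (rule nn_integral_has_integral_lebesgue'[symmetric, OF _ hi]) simp
  also have "\<dots> = (\<integral>\<^sup>+v. ennreal ((cmod (deriv f (vec_complex v)))\<^sup>2) * indicator S (vec_complex v) \<partial>lborel)"
    by (simp add: det T_def indicator_def)
  also have "\<dots> = (\<integral>\<^sup>+z. ennreal ((cmod (deriv f z))\<^sup>2) * indicator S z \<partial>lborel)"
  proof -
    have m: "(\<lambda>z. deriv f z * indicator U z) \<in> borel_measurable borel"
      by (intro holomorphic_restrict_measurable holomorphic_deriv f)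
    have eq: "ennreal ((cmod (deriv f z))\<^sup>2) * indicator S z =
      ennreal ((cmod (deriv f z * indicator U z))\<^sup>2) * indicator S z" for z
      using S(2) by (auto simp: indicator_def)
    show ?thesis unfolding eq
      by (subst lborel_complex_vec, subst nn_integral_distr) (use m S(1) in measurable)
  qed
  finally show ?thesis .
qed

text \<open>The push-forward of the weighted measure and the restriction to the image agree on sets
  by \<open>emeasure_holomorphic_image\<close>, hence on integrals. Cutting \<open>f\<close> off
  outside \<open>U\<close> makes it measurable on the whole plane.\<close>

lemma nn_integral_holomorphic_image:
  assumes f: "f holomorphic_on U" "open U" "inj_on f U" and b: "bounded (f ` U)"
    and g [measurable]: "g \<in> borel_measurable borel"
  shows "(\<integral>\<^sup>+z. g z * indicator (f ` U) z \<partial>lborel) =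
    (\<integral>\<^sup>+w. ennreal ((cmod (deriv f w))\<^sup>2) * g (f w) * indicator U w \<partial>lborel)"
proof -
  define f0 where "f0 z = f z * indicator U z" for z
  define d where "d z = ennreal ((cmod (deriv f z))\<^sup>2) * indicator U z" for z
  have Ub [measurable]: "U \<in> sets borel" and fUb: "f ` U \<in> sets borel"
    using f(2) open_mapping_thm3[OF f] by auto
  have f0m [measurable]: "f0 \<in> borel_measurable borel"
    unfolding f0_def[abs_def] by (rule holomorphic_restrict_measurable[OF f(1,2)])
  have dm [measurable]: "d \<in> borel_measurable borel"
  proof -
    have "d = (\<lambda>z. ennreal ((cmod (deriv f z * indicator U z))\<^sup>2))"
      by (auto simp: d_def indicator_def)
    moreover have "(\<lambda>z. deriv f z * indicator U z) \<in> borel_measurable borel"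
      by (intro holomorphic_restrict_measurable holomorphic_deriv f)
    ultimately show ?thesis by simp
  qed
  have "distr (density lborel d) borel f0 = density lborel (indicator (f ` U))"
  proof (rule measure_eqI)
    fix X assume "X \<in> sets (distr (density lborel d) borel f0)"
    then have X: "X \<in> sets borel" by simp
    define S where "S = U \<inter> f0 -` X"
    have Sb: "S \<in> sets borel" unfolding S_def using measurable_sets[OF f0m X] by auto
    have "emeasure (distr (density lborel d) borel f0) X = (\<integral>\<^sup>+z. d z * indicator (f0 -` X) z \<partial>lborel)"
      using X by (simp add: emeasure_distr emeasure_density measurable_sets[OF f0m, simplified])
    also have "\<dots> = (\<integral>\<^sup>+z. ennreal ((cmod (deriv f z))\<^sup>2) * indicator S z \<partial>lborel)"
      by (intro nn_integral_cong) (auto simp: d_def S_def indicator_def)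
    also have "\<dots> = emeasure lborel (f ` S)"
      using emeasure_holomorphic_image[OF f b Sb] by (simp add: S_def)
    also have "f ` S = f ` U \<inter> X" by (auto simp: S_def f0_def)
    also have "emeasure lborel (f ` U \<inter> X) = emeasure (density lborel (indicator (f ` U))) X"
    proof -
      have "emeasure (density lborel (indicator (f ` U))) X =
          (\<integral>\<^sup>+z. indicator (f ` U) z * indicator X z \<partial>lborel)"
        using X fUb by (subst emeasure_density) auto
      also have "\<dots> = (\<integral>\<^sup>+z. indicator (f ` U \<inter> X) z \<partial>lborel)"
        by (intro nn_integral_cong) (auto simp: indicator_def)
      also have "\<dots> = emeasure lborel (f ` U \<inter> X)"
        using X fUb by (intro nn_integral_indicator) auto
      finally show ?thesis by simp
    qed
    finally show "emeasure (distr (density lborel d) borel f0) X = emeasure (density lborel (indicator (f ` U))) X" .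
  qed simp
  then have "(\<integral>\<^sup>+z. g z \<partial>distr (density lborel d) borel f0) = (\<integral>\<^sup>+z. g z \<partial>density lborel (indicator (f ` U)))"
    by simp
  then have "(\<integral>\<^sup>+w. d w * g (f0 w) \<partial>lborel) = (\<integral>\<^sup>+z. indicator (f ` U) z * g z \<partial>lborel)"
    using fUb by (simp add: nn_integral_distr nn_integral_density)
  moreover have "d w * g (f0 w) = ennreal ((cmod (deriv f w))\<^sup>2) * g (f w) * indicator U w" for w
    by (auto simp: d_def f0_def indicator_def)
  ultimately show ?thesis by (simp add: mult.commute)
qed

section \<open>Areas of disks and triangles\<close>

definition hyp_density :: "complex \<Rightarrow> ennreal" where
  "hyp_density z = ennreal (4 / (1 - (cmod z)\<^sup>2)\<^sup>2) * indicator hyp_plane z"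

lemma hyp_density_measurable [measurable]: "hyp_density \<in> borel_measurable borel"
proof -
  have [measurable]: "hyp_plane \<in> sets borel" by simp
  have "(\<lambda>z. ennreal (4 / (1 - (cmod z)\<^sup>2)\<^sup>2) * indicator hyp_plane z) \<in> borel_measurable borel"
    by measurable
  then show ?thesis by (simp only: hyp_density_def[abs_def])
qed

lemma sets_hyp_area [simp, measurable_cong]: "sets hyp_area = sets borel"
  by (simp add: hyp_area_def)

lemma space_hyp_area [simp]: "space hyp_area = UNIV"
  by (simp add: hyp_area_def)

lemma emeasure_hyp_area:
  "S \<in> sets borel \<Longrightarrow> emeasure hyp_area S = (\<integral>\<^sup>+z. hyp_density z * indicator S z \<partial>lborel)"
  unfolding hyp_area_def hyp_density_def[abs_def, symmetric] by (subst emeasure_density) auto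

lemma hyp_area_null:
  assumes "S \<in> null_sets lborel" shows "S \<in> null_sets hyp_area"
proof (rule null_setsI)
  show "S \<in> sets hyp_area" using assms by auto
  have "(\<integral>\<^sup>+z. hyp_density z * indicator S z \<partial>lborel) = 0"
    by (rule nn_integral_null_set[OF assms])
  then show "emeasure hyp_area S = 0" using assms by (subst emeasure_hyp_area) auto
qed

lemma line_null: "e \<noteq> 0 \<Longrightarrow> {z :: complex. e \<bullet> z = 0} \<in> null_sets hyp_area"
proof (rule hyp_area_null)
  assume "e \<noteq> 0"
  then have "negligible {z :: complex. e \<bullet> z = 0}" by (intro negligible_hyperplane) auto
  moreover have "closed {z :: complex. e \<bullet> z = 0}" by (rule closed_hyperplane)
  ultimately show "{z :: complex. e \<bullet> z = 0} \<in> null_sets lborel"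
    by (simp add: negligible_iff_null_sets null_sets_completion_iff borel_closed)
qed

text \<open>Condition \<open>iso\<close> is the infinitesimal form of being an isometry; under it
  the Jacobian cancels against the change of the hyperbolic density.\<close>

lemma emeasure_hyp_area_holomorphic:
  assumes f: "f holomorphic_on hyp_plane" "bij_betw f hyp_plane hyp_plane"
    and iso: "\<And>z. z \<in> hyp_plane \<Longrightarrow> cmod (deriv f z) * (1 - (cmod z)\<^sup>2) = 1 - (cmod (f z))\<^sup>2"
    and S: "S \<in> sets borel"
  shows "emeasure hyp_area {z \<in> hyp_plane. f z \<in> S} = emeasure hyp_area S"
proof -
  have im: "f ` hyp_plane = hyp_plane" and inj: "inj_on f hyp_plane"
    using f(2) by (auto simp: bij_betw_def)
  have "(\<lambda>z. f z * indicator hyp_plane z) \<in> borel_measurable borel"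
    by (rule holomorphic_restrict_measurable[OF f(1)]) simp
  from measurable_sets[OF this S]
  have "((\<lambda>z. f z * indicator hyp_plane z) -` S \<inter> space borel) \<inter> hyp_plane \<in> sets borel" by auto
  moreover have "((\<lambda>z. f z * indicator hyp_plane z) -` S \<inter> space borel) \<inter> hyp_plane = {z \<in> hyp_plane. f z \<in> S}"
    by auto
  ultimately have B: "{z \<in> hyp_plane. f z \<in> S} \<in> sets borel" by metis
  have "emeasure hyp_area S = (\<integral>\<^sup>+z. hyp_density z * indicator S z * indicator (f ` hyp_plane) z \<partial>lborel)"
    unfolding emeasure_hyp_area[OF S] im by (intro nn_integral_cong) (auto simp: hyp_density_def indicator_def)
  also have "\<dots> = (\<integral>\<^sup>+z. ennreal ((cmod (deriv f z))\<^sup>2) * (hyp_density (f z) * indicator S (f z)) * indicator hyp_plane z \<partial>lborel)"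
    using S by (intro nn_integral_holomorphic_image f inj) (auto simp: im)
  also have "\<dots> = (\<integral>\<^sup>+z. hyp_density z * indicator {z \<in> hyp_plane. f z \<in> S} z \<partial>lborel)"
  proof (rule nn_integral_cong)
    fix z
    have "ennreal ((cmod (deriv f z))\<^sup>2) * hyp_density (f z) = hyp_density z" if z: "z \<in> hyp_plane"
    proof -
      have fz: "f z \<in> hyp_plane" using z im by blast
      have "(cmod (deriv f z))\<^sup>2 * (4 / (1 - (cmod (f z))\<^sup>2)\<^sup>2) = 4 / (1 - (cmod z)\<^sup>2)\<^sup>2"
        unfolding iso[OF z, symmetric] power_mult_distrib
        using hyp_plane_norm[OF fz] iso[OF z] by auto
      then show ?thesis using z fz by (simp add: hyp_density_def ennreal_mult'[symmetric])
    qed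
    then show "ennreal ((cmod (deriv f z))\<^sup>2) * (hyp_density (f z) * indicator S (f z)) * indicator hyp_plane z =
        hyp_density z * indicator {z \<in> hyp_plane. f z \<in> S} z"
      by (auto simp: indicator_def mult.assoc[symmetric])
  qed
  also have "\<dots> = emeasure hyp_area {z \<in> hyp_plane. f z \<in> S}" using B by (simp add: emeasure_hyp_area)
  finally show ?thesis by simp
qed

section \<open>Moebius maps, rotations and reflections preserve area\<close>

lemma Moebius_deriv:
  assumes "a \<in> hyp_plane" "z \<in> hyp_plane"
  shows "(Moebius_function t a has_field_derivative
    exp (\<i> * of_real t) * (1 - cnj a * a) / (1 - cnj a * z)\<^sup>2) (at z)"
  unfolding Moebius_function_def using Moebius_denominator[OF assms]
  by (auto intro!: derivative_eq_intros simp: field_simps power2_eq_square)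

lemma Moebius_inverse:
  assumes "a \<in> hyp_plane" "z \<in> hyp_plane"
  shows "Moebius_function 0 (- a) (Moebius_function 0 a z) = z"
  using assms by (intro Moebius_function_compose) auto

lemma Moebius_bij:
  assumes "a \<in> hyp_plane"
  shows "bij_betw (Moebius_function 0 a) hyp_plane hyp_plane"
proof (rule bij_betwI[where g = "Moebius_function 0 (- a)"])
  have a: "- a \<in> hyp_plane" using assms by simp
  show "Moebius_function 0 a \<in> hyp_plane \<rightarrow> hyp_plane" "Moebius_function 0 (- a) \<in> hyp_plane \<rightarrow> hyp_plane"
    using Moebius_in_plane assms a by blast+
  show "Moebius_function 0 (- a) (Moebius_function 0 a z) = z" if "z \<in> hyp_plane" for z
    using Moebius_inverse[OF assms that] .
  show "Moebius_function 0 a (Moebius_function 0 (- a) z) = z" if "z \<in> hyp_plane" for z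
    using Moebius_inverse[OF a that] by simp
qed

lemma emeasure_hyp_area_Moebius:
  assumes a: "a \<in> hyp_plane" and S: "S \<in> sets borel"
  shows "emeasure hyp_area {z \<in> hyp_plane. Moebius_function 0 a z \<in> S} = emeasure hyp_area S"
proof (rule emeasure_hyp_area_holomorphic[OF _ Moebius_bij[OF a] _ S])
  show "Moebius_function 0 a holomorphic_on hyp_plane"
    using a by (intro Moebius_function_holomorphic) auto
  fix z assume z: "z \<in> hyp_plane"
  have "deriv (Moebius_function 0 a) z = (1 - cnj a * a) / (1 - cnj a * z)\<^sup>2"
    using DERIV_imp_deriv[OF Moebius_deriv[OF a z, of 0]] by simp
  moreover have "1 - cnj a * a = of_real (1 - (cmod a)\<^sup>2)"
    using complex_norm_square[of a] by (simp add: mult.commute)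
  ultimately have "cmod (deriv (Moebius_function 0 a) z) = (1 - (cmod a)\<^sup>2) / (cmod (1 - cnj a * z))\<^sup>2"
    using hyp_plane_norm[OF a] by (simp only: norm_divide norm_power norm_of_real)
  then show "cmod (deriv (Moebius_function 0 a) z) * (1 - (cmod z)\<^sup>2) = 1 - (cmod (Moebius_function 0 a z))\<^sup>2"
    unfolding Moebius_norm[OF a z] by simp
qed

lemma emeasure_hyp_area_rotate:
  assumes e: "cmod e = 1" and S: "S \<in> sets borel"
  shows "emeasure hyp_area {z \<in> hyp_plane. e * z \<in> S} = emeasure hyp_area S"
proof (rule emeasure_hyp_area_holomorphic[OF _ _ _ S])
  show "(*) e holomorphic_on hyp_plane" by (intro holomorphic_intros)
  show "bij_betw ((*) e) hyp_plane hyp_plane"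
    using e by (intro bij_betwI[where g = "\<lambda>z. z / e"]) (auto simp: norm_mult norm_divide)
  have "deriv ((*) e) z = e" for z by (rule DERIV_imp_deriv) (auto intro!: derivative_eq_intros)
  then show "cmod (deriv ((*) e) z) * (1 - (cmod z)\<^sup>2) = 1 - (cmod (e * z))\<^sup>2" for z
    using e by (simp add: norm_mult)
qed

lemma lborel_cnj: "lborel = distr lborel borel cnj"
proof -
  have cnj: "cnj = (\<lambda>x. 0 + (\<Sum>j\<in>Basis. ((if j = 1 then 1 else -1) * (x \<bullet> j)) *\<^sub>R j))"
    by (auto simp: Basis_complex_def complex_eq_iff)
  have "lborel = density (distr lborel borel cnj) (\<lambda>_. ennreal (\<Prod>j\<in>(Basis :: complex set). \<bar>if j = 1 then 1 else - 1 :: real\<bar>))"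
    unfolding cnj by (rule lborel_affine_euclidean) auto
  moreover have "(\<Prod>j\<in>(Basis :: complex set). \<bar>if j = 1 then 1 else - 1 :: real\<bar>) = 1"
    by (intro prod.neutral) auto
  ultimately show ?thesis by (simp add: density_1)
qed

text \<open>A reflection is not holomorphic; it is split into a rotation and complex conjugation,
  which preserves Lebesgue measure and the density.\<close>

lemma emeasure_hyp_area_reflect:
  assumes e: "cmod e = 1" and S: "S \<in> sets borel"
  shows "emeasure hyp_area {z \<in> hyp_plane. e * cnj z \<in> S} = emeasure hyp_area S"
proof -
  define S' where "S' = {z \<in> hyp_plane. e * z \<in> S}"
  have m: "(\<lambda>z. e * z) \<in> borel_measurable borel" by simp
  have "S' = (\<lambda>z. e * z) -` S \<inter> space borel \<inter> hyp_plane" by (auto simp: S'_def)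
  then have S': "S' \<in> sets borel" using measurable_sets[OF m S] by simp
  have cm: "cnj \<in> borel_measurable borel" by (intro borel_measurable_continuous_onI continuous_intros)
  have "{z \<in> hyp_plane. e * cnj z \<in> S} = cnj -` S' \<inter> space borel"
    by (auto simp: S'_def)
  then have B: "{z \<in> hyp_plane. e * cnj z \<in> S} \<in> sets borel" using measurable_sets[OF cm S'] by simp
  have "emeasure hyp_area S = emeasure hyp_area S'"
    using emeasure_hyp_area_rotate[OF e S] by (simp add: S'_def)
  also have "\<dots> = (\<integral>\<^sup>+z. hyp_density z * indicator S' z \<partial>lborel)" using S' by (rule emeasure_hyp_area)
  also have "\<dots> = (\<integral>\<^sup>+z. hyp_density (cnj z) * indicator S' (cnj z) \<partial>lborel)"
    using cm S' by (subst lborel_cnj, subst nn_integral_distr) auto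
  also have "\<dots> = (\<integral>\<^sup>+z. hyp_density z * indicator {z \<in> hyp_plane. e * cnj z \<in> S} z \<partial>lborel)"
    by (intro nn_integral_cong) (auto simp: hyp_density_def S'_def indicator_def)
  also have "\<dots> = emeasure hyp_area {z \<in> hyp_plane. e * cnj z \<in> S}"
    using B by (simp add: emeasure_hyp_area)
  finally show ?thesis by simp
qed

section \<open>Areas in polar coordinates\<close>

lemma exp_strip_inj:
  assumes "exp w = exp w'" "\<bar>Im w - Im w'\<bar> < 2 * pi"
  shows "w = w'"
  using assms exp_complex_eqI by blast

lemma nn_integral_complex_Fubini:
  assumes "g \<in> borel_measurable (borel :: complex measure)"
  shows "(\<integral>\<^sup>+z. g z \<partial>lborel) = (\<integral>\<^sup>+t. (\<integral>\<^sup>+s. g (Complex s t) \<partial>lborel) \<partial>lborel)"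
proof -
  have m: "(\<lambda>(x, y). Complex x y) \<in> borel_measurable (lborel \<Otimes>\<^sub>M lborel)"
  proof -
    have "continuous_on UNIV (\<lambda>p :: real \<times> real. Complex (fst p) (snd p))"
      unfolding Complex_eq by (intro continuous_intros)
    then show ?thesis
      unfolding lborel_prod case_prod_unfold by (simp add: borel_measurable_continuous_onI)
  qed
  have eq: "lborel = distr (lborel \<Otimes>\<^sub>M lborel) borel (\<lambda>(x, y). Complex x y)"
  proof (rule lborel_eqI)
    fix l u :: complex
    assume le: "\<And>b. b \<in> Basis \<Longrightarrow> l \<bullet> b \<le> u \<bullet> b"
    have "Re l \<le> Re u" "Im l \<le> Im u" using le[of 1] le[of \<i>] by (auto simp: Basis_complex_def)
    have "(\<lambda>(x, y). Complex x y) -` box l u \<inter> space (lborel \<Otimes>\<^sub>M lborel) =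
        {Re l <..< Re u} \<times> {Im l <..< Im u}"
      by (auto simp: box_complex_eq space_pair_measure)
    then have "emeasure (distr (lborel \<Otimes>\<^sub>M lborel) borel (\<lambda>(x, y). Complex x y)) (box l u) =
        emeasure (lborel \<Otimes>\<^sub>M lborel) ({Re l <..< Re u} \<times> {Im l <..< Im u})"
      using m by (subst emeasure_distr) auto
    also have "\<dots> = ennreal (Re u - Re l) * ennreal (Im u - Im l)"
      using \<open>Re l \<le> Re u\<close> \<open>Im l \<le> Im u\<close> by (subst lborel.emeasure_pair_measure_Times) auto
    also have "\<dots> = (\<Prod>b\<in>Basis. (u - l) \<bullet> b)"
      using \<open>Re l \<le> Re u\<close> \<open>Im l \<le> Im u\<close>
      by (simp add: Basis_complex_def inner_complex_def complex_eq_iff ennreal_mult)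
    finally show "emeasure (distr (lborel \<Otimes>\<^sub>M lborel) borel (\<lambda>(x, y). Complex x y)) (box l u) =
        (\<Prod>b\<in>Basis. (u - l) \<bullet> b)" .
  qed simp
  have "(\<integral>\<^sup>+z. g z \<partial>lborel) = (\<integral>\<^sup>+p. g (case p of (x, y) \<Rightarrow> Complex x y) \<partial>(lborel \<Otimes>\<^sub>M lborel))"
    using m assms by (subst eq, subst nn_integral_distr) auto
  also have "\<dots> = (\<integral>\<^sup>+t. (\<integral>\<^sup>+s. g (Complex s t) \<partial>lborel) \<partial>lborel)"
    using measurable_compose[OF m assms] lborel_pair.nn_integral_snd[of "\<lambda>p. g (case p of (x, y) \<Rightarrow> Complex x y)"]
    by simp
  finally show ?thesis .
qed

text \<open>The radial part of the area in the logarithmic coordinate \<open>s\<close> with modulus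
  \<open>exp s\<close>. Changing the sign of \<open>s\<close> turns the domain into a ray
  \<open>{a..}\<close>, on which \<open>F\<close> is an antiderivative with a limit at
  infinity.\<close>

lemma nn_integral_radial:
  assumes "0 < R" "R < (1::real)"
  shows "(\<integral>\<^sup>+s. ennreal (4 * exp (2 * s) / (1 - exp (2 * s))\<^sup>2) * indicator {s. exp s \<le> R} s \<partial>lborel) =
    ennreal (2 * R\<^sup>2 / (1 - R\<^sup>2))"
proof -
  define F where "F s = - 2 / (1 - exp (- 2 * s))" for s :: real
  define a where "a = - ln R"
  have a: "a > 0" using assms by (simp add: a_def)
  have sets: "exp (- s) \<le> R \<longleftrightarrow> s \<in> {a..}" for s
  proof -
    have "exp (- s) \<le> R \<longleftrightarrow> - s \<le> ln R" using assms(1) by (metis exp_ln exp_le_cancel_iff)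
    then show ?thesis by (auto simp: a_def)
  qed
  have "(\<integral>\<^sup>+s. ennreal (4 * exp (2 * s) / (1 - exp (2 * s))\<^sup>2) * indicator {s. exp s \<le> R} s \<partial>lborel) =
    (\<integral>\<^sup>+s. ennreal (4 * exp (2 * s) / (1 - exp (2 * s))\<^sup>2) * indicator {s. exp s \<le> R} s \<partial>distr lborel borel uminus)"
    by (simp add: lborel_distr_uminus)
  also have "\<dots> = (\<integral>\<^sup>+s. ennreal (4 * exp (- 2 * s) / (1 - exp (- 2 * s))\<^sup>2) * indicator {a..} s \<partial>lborel)"
    using sets by (subst nn_integral_distr) (auto simp: indicator_def)
  also have "\<dots> = ennreal (- 2 - F a)"
  proof (rule nn_integral_FTC_atLeast)
    show "(F has_real_derivative 4 * exp (- 2 * s) / (1 - exp (- 2 * s))\<^sup>2) (at s)" if "a \<le> s" for s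
      using that a unfolding F_def
      by (auto intro!: derivative_eq_intros simp: power2_eq_square)
    have "((\<lambda>s::real. - 2 / (1 - exp (- 2 * s))) \<longlongrightarrow> - 2) at_top" by real_asymp
    then show "(F \<longlongrightarrow> - 2) at_top" by (simp add: F_def[abs_def])
  qed auto
  also have "- 2 - F a = 2 * R\<^sup>2 / (1 - R\<^sup>2)"
  proof -
    have "exp (- 2 * a) = R\<^sup>2" using assms by (simp add: a_def exp_double[symmetric] power2_eq_square exp_add[symmetric] mult_2[symmetric] flip: exp_double) (metis exp_ln exp_double power2_eq_square)
    moreover have "R\<^sup>2 < 1" using assms by (simp add: abs_square_less_1)
    ultimately show ?thesis by (simp add: F_def field_simps)
  qed
  finally show ?thesis .
qed

definition polar_region :: "real set \<Rightarrow> (real \<Rightarrow> real) \<Rightarrow> complex set" where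
  "polar_region J R = {of_real r * cis t | r t. t \<in> J \<and> 0 < r \<and> r \<le> R t}"

text \<open>The map \<open>exp\<close> sends a half strip injectively into the disc and turns polar
  coordinates into Cartesian ones; integrating over the real part first leaves
  \<open>nn_integral_radial\<close>. The restriction of \<open>J\<close> to
  \<open>{0<..<2*pi}\<close> keeps \<open>exp\<close> injective.\<close>

lemma polar_region:
  assumes J: "J \<in> sets borel" "J \<subseteq> {0<..<2*pi}" and R: "R \<in> borel_measurable borel"
    and R01: "\<And>t. t \<in> J \<Longrightarrow> 0 < R t \<and> R t < 1"
  shows polar_region_borel: "polar_region J R \<in> sets borel"
    and emeasure_polar_region: "emeasure hyp_area (polar_region J R) =
      (\<integral>\<^sup>+t. ennreal (2 * (R t)\<^sup>2 / (1 - (R t)\<^sup>2)) * indicator J t \<partial>lborel)"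
proof -
  define U where "U = {w. Re w < 0 \<and> Im w \<in> {0<..<2*pi}}"
  have Re_m: "Re \<in> borel_measurable borel" and Im_m: "Im \<in> borel_measurable borel"
    by (auto intro: borel_measurable_continuous_onI continuous_intros)
  note [measurable] = J(1) R Re_m Im_m
  have oU: "open U"
  proof -
    have "U = {w. Re w < 0} \<inter> {w. 0 < Im w} \<inter> {w. Im w < 2 * pi}" by (auto simp: U_def)
    then show ?thesis
      by (auto intro!: open_Int open_halfspace_Re_lt open_halfspace_Im_lt open_halfspace_Im_gt)
  qed
  have hol: "exp holomorphic_on U" by (intro holomorphic_intros)
  have inj: "inj_on exp U"
    by (rule inj_onI, rule exp_strip_inj) (auto simp: U_def abs_if)
  have sub: "exp ` U \<subseteq> hyp_plane" by (auto simp: U_def)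
  define T where "T = {w. Im w \<in> J \<and> exp (Re w) \<le> R (Im w)}"
  have Tm: "T \<in> sets borel" unfolding T_def by measurable
  have TU: "T \<subseteq> U"
  proof
    fix w assume "w \<in> T"
    then have w: "Im w \<in> J" "exp (Re w) \<le> R (Im w)" by (auto simp: T_def)
    then have "exp (Re w) < 1" using R01[of "Im w"] by linarith
    with w(1) show "w \<in> U" using J(2) by (auto simp: U_def)
  qed
  have S: "polar_region J R = exp ` T"
  proof (intro equalityI subsetI)
    fix z assume "z \<in> polar_region J R"
    then obtain r t where z: "z = of_real r * cis t" "t \<in> J" "0 < r" "r \<le> R t" by (auto simp: polar_region_def)
    then have "z = exp (Complex (ln r) t)" by (simp add: exp_eq_polar exp_of_real[symmetric])
    moreover have "Complex (ln r) t \<in> T" using z by (simp add: T_def)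
    ultimately show "z \<in> exp ` T" by blast
  next
    fix z assume "z \<in> exp ` T"
    then obtain w where "z = exp w" "w \<in> T" by auto
    then have "z = of_real (exp (Re w)) * cis (Im w)" "Im w \<in> J" "0 < exp (Re w)" "exp (Re w) \<le> R (Im w)"
      by (auto simp: T_def exp_eq_polar)
    then show "z \<in> polar_region J R" unfolding polar_region_def by blast
  qed
  show B: "polar_region J R \<in> sets borel"
    unfolding S by (rule holomorphic_image_borel[OF hol oU inj Tm TU])
  have d: "deriv exp w = exp w" for w :: complex by (rule DERIV_imp_deriv) (rule DERIV_exp)
  have "emeasure hyp_area (polar_region J R) =
      (\<integral>\<^sup>+z. hyp_density z * indicator (polar_region J R) z * indicator (exp ` U) z \<partial>lborel)"
    unfolding emeasure_hyp_area[OF B] using TU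
    by (intro nn_integral_cong) (auto simp: S indicator_def)
  also have "\<dots> = (\<integral>\<^sup>+w. ennreal ((cmod (deriv exp w))\<^sup>2) *
      (hyp_density (exp w) * indicator (polar_region J R) (exp w)) * indicator U w \<partial>lborel)"
    using B sub by (intro nn_integral_holomorphic_image hol oU inj) (auto intro: bounded_subset[OF bounded_ball])
  also have "\<dots> = (\<integral>\<^sup>+w. ennreal (4 * exp (2 * Re w) / (1 - exp (2 * Re w))\<^sup>2) * indicator T w \<partial>lborel)"
  proof (rule nn_integral_cong)
    fix w :: complex
    have "exp w \<in> polar_region J R \<longleftrightarrow> w \<in> T" if "w \<in> U"
      using inj that TU unfolding S by (auto dest: inj_onD)
    moreover have "ennreal ((cmod (deriv exp w))\<^sup>2) * hyp_density (exp w) =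
        ennreal (4 * exp (2 * Re w) / (1 - exp (2 * Re w))\<^sup>2)" if "w \<in> U"
      using that unfolding hyp_density_def d
      by (simp add: U_def ennreal_mult'[symmetric] exp_double)
    ultimately show "ennreal ((cmod (deriv exp w))\<^sup>2) *
        (hyp_density (exp w) * indicator (polar_region J R) (exp w)) * indicator U w =
        ennreal (4 * exp (2 * Re w) / (1 - exp (2 * Re w))\<^sup>2) * indicator T w"
      using TU by (auto simp: indicator_def mult.assoc[symmetric])
  qed
  also have "\<dots> = (\<integral>\<^sup>+t. (\<integral>\<^sup>+s. ennreal (4 * exp (2 * s) / (1 - exp (2 * s))\<^sup>2) * indicator T (Complex s t) \<partial>lborel) \<partial>lborel)"
    using Tm by (subst nn_integral_complex_Fubini) auto
  also have "\<dots> = (\<integral>\<^sup>+t. ennreal (2 * (R t)\<^sup>2 / (1 - (R t)\<^sup>2)) * indicator J t \<partial>lborel)"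
  proof (rule nn_integral_cong)
    fix t
    show "(\<integral>\<^sup>+s. ennreal (4 * exp (2 * s) / (1 - exp (2 * s))\<^sup>2) * indicator T (Complex s t) \<partial>lborel) =
        ennreal (2 * (R t)\<^sup>2 / (1 - (R t)\<^sup>2)) * indicator J t"
    proof (cases "t \<in> J")
      case True
      then have "indicator T (Complex s t) = (indicator {s. exp s \<le> R t} s :: ennreal)" for s
        by (auto simp: T_def indicator_def)
      then show ?thesis using True R01[OF True] by (simp add: nn_integral_radial)
    next
      case False
      then have "indicator T (Complex s t) = (0 :: ennreal)" for s by (auto simp: T_def indicator_def)
      then show ?thesis using False by simp
    qed
  qed
  finally show "emeasure hyp_area (polar_region J R) = \<dots>" .
qed

lemma polar_region_iff:
  assumes "J \<subseteq> {0<..<2*pi}" "t \<in> {0<..<2*pi}" "0 < r"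
  shows "of_real r * cis t \<in> polar_region J R \<longleftrightarrow> t \<in> J \<and> r \<le> R t"
proof
  assume "of_real r * cis t \<in> polar_region J R"
  then obtain r' t' where e: "of_real r * cis t = of_real r' * cis t'" "t' \<in> J" "0 < r'" "r' \<le> R t'"
    by (auto simp: polar_region_def)
  have "r = r'" using arg_cong[OF e(1), of cmod] assms(3) e(3) by (simp add: norm_mult)
  then have "cis t = cis t'" using e(1) assms(3) by simp
  then have "exp (Complex 0 t) = exp (Complex 0 t')" by (simp add: exp_eq_polar)
  moreover have "\<bar>Im (Complex 0 t) - Im (Complex 0 t')\<bar> < 2 * pi"
    using assms(1,2) e(2) by (auto simp: abs_if)
  ultimately have "Complex 0 t = Complex 0 t'" by (rule exp_strip_inj)
  then show "t \<in> J \<and> r \<le> R t" using e \<open>r = r'\<close> by simp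
qed (use assms in \<open>auto simp: polar_region_def\<close>)

lemma polar_form:
  assumes "z \<noteq> 0" "Im z \<noteq> 0"
  obtains r t where "z = of_real r * cis t" "0 < r" "r = cmod z" "t \<in> {0<..<2*pi}"
proof
  show "z = of_real (cmod z) * cis (Arg2pi z)" using Arg2pi_eq[of z] by (simp add: cis_conv_exp)
  have "Arg2pi z \<noteq> 0" using assms by (auto simp: Arg2pi_eq_0 complex_is_Real_iff)
  then show "Arg2pi z \<in> {0<..<2*pi}" using Arg2pi_ge_0[of z] Arg2pi_lt_2pi[of z] by auto
qed (use assms in auto)

lemma emeasure_hyp_area_disc:
  assumes "0 < R" "R < 1"
  shows "emeasure hyp_area (cball 0 R) = ennreal (4 * pi * R\<^sup>2 / (1 - R\<^sup>2))"
proof -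
  let ?P = "polar_region {0<..<2*pi} (\<lambda>_. R)"
  have N: "{z. Im z = 0} \<in> null_sets hyp_area" using line_null[of \<i>] by (simp add: inner_complex_def)
  have B: "?P \<in> sets borel" using assms by (intro polar_region_borel) auto
  have "emeasure hyp_area (cball 0 R) = emeasure hyp_area ?P"
  proof (rule emeasure_eq_AE)
    show "AE z in hyp_area. z \<in> cball 0 R \<longleftrightarrow> z \<in> ?P"
    proof (rule AE_mp[OF AE_not_in[OF N]], rule AE_I2, rule impI)
      fix z assume "z \<notin> {z. Im z = 0}"
      then have "Im z \<noteq> 0" "z \<noteq> 0" by auto
      then obtain r t where z: "z = of_real r * cis t" "0 < r" "r = cmod z" "t \<in> {0<..<2*pi}"
        using polar_form by metis
      have "z \<in> ?P \<longleftrightarrow> r \<le> R"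
        using polar_region_iff[OF subset_refl z(4,2), of "\<lambda>_. R"] z(1,4) by simp
      then show "z \<in> cball 0 R \<longleftrightarrow> z \<in> ?P" using z(3) by simp
    qed
  qed (use B in auto)
  also have "\<dots> = (\<integral>\<^sup>+t. ennreal (2 * R\<^sup>2 / (1 - R\<^sup>2)) * indicator {0<..<2*pi} t \<partial>lborel)"
    using assms by (intro emeasure_polar_region) auto
  also have "\<dots> = ennreal (2 * R\<^sup>2 / (1 - R\<^sup>2)) * ennreal (2 * pi)"
    by (simp add: nn_integral_cmult_indicator)
  also have "\<dots> = ennreal (4 * pi * R\<^sup>2 / (1 - R\<^sup>2))"
  proof -
    have "R\<^sup>2 < 1" using assms by (simp add: abs_square_less_1)
    then show ?thesis by (subst ennreal_mult[symmetric]) (auto simp: field_simps)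
  qed
  finally show ?thesis .
qed

section \<open>Sectors and dihedral symmetry\<close>

definition sector :: "real \<Rightarrow> real \<Rightarrow> complex set" where
  "sector a c = {of_real r * cis t | r t. 0 < r \<and> a < t \<and> t < c}"

lemma sector_eq_exp: "sector a c = exp ` {w. a < Im w \<and> Im w < c}"
proof (intro equalityI subsetI)
  fix z assume "z \<in> sector a c"
  then obtain r t where z: "z = of_real r * cis t" "0 < r" "a < t" "t < c" by (auto simp: sector_def)
  then have "z = exp (Complex (ln r) t)" by (simp add: exp_eq_polar exp_of_real[symmetric])
  then show "z \<in> exp ` {w. a < Im w \<and> Im w < c}" using z by (intro rev_image_eqI[of "Complex (ln r) t"]) auto
next
  fix z :: complex assume "z \<in> exp ` {w. a < Im w \<and> Im w < c}"
  then obtain w where "z = exp w" "a < Im w" "Im w < c" by auto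
  then have "z = of_real (exp (Re w)) * cis (Im w)" "0 < exp (Re w)" "a < Im w" "Im w < c"
    by (auto simp: exp_eq_polar)
  then show "z \<in> sector a c" unfolding sector_def by blast
qed

lemma sector_borel:
  assumes "c - a \<le> 2 * pi"
  shows "sector a c \<in> sets borel"
proof -
  have "{w. a < Im w \<and> Im w < c} = {w. a < Im w} \<inter> {w. Im w < c}" by auto
  then have o: "open {w. a < Im w \<and> Im w < c}"
    by (metis open_Int open_halfspace_Im_gt open_halfspace_Im_lt)
  have "inj_on exp {w. a < Im w \<and> Im w < c}"
  proof (rule inj_onI)
    fix w w' :: complex
    assume w: "w \<in> {w. a < Im w \<and> Im w < c}" "w' \<in> {w. a < Im w \<and> Im w < c}" and e: "exp w = exp w'"
    have "\<bar>Im w - Im w'\<bar> < 2 * pi" using w assms unfolding mem_Collect_eq by linarith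
    then show "w = w'" by (rule exp_strip_inj[OF e])
  qed
  from holomorphic_image_borel[OF _ o this _ subset_refl] o
  show ?thesis unfolding sector_eq_exp by (auto intro!: holomorphic_intros)
qed

lemma sector_disjoint:
  assumes "0 \<le> a" "c \<le> a'" "c' \<le> 2 * pi"
  shows "sector a c \<inter> sector a' c' = {}"
proof (rule ccontr)
  assume "sector a c \<inter> sector a' c' \<noteq> {}"
  then obtain w w' :: complex where w: "exp w = exp w'" "a < Im w" "Im w < c" "a' < Im w'" "Im w' < c'"
    unfolding sector_eq_exp by auto
  then have "\<bar>Im w - Im w'\<bar> < 2 * pi" using w(2-) assms by linarith
  then have "w = w'" by (rule exp_strip_inj[OF w(1)])
  then have "Im w = Im w'" by (rule arg_cong)
  then show False using w(2-) assms by linarith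
qed

text \<open>\<open>cis (2 * b) * cnj z\<close> is the mirror image of \<open>z\<close> in the line
  with direction \<open>cis b\<close>, so the argument \<open>t\<close> becomes
  \<open>2 * b - t\<close>.\<close>

lemma sector_reflect:
  "cis (2 * b) * cnj z \<in> sector (2 * b - c) (2 * b - a) \<longleftrightarrow> z \<in> sector a c"
proof -
  have *: "cis (2 * b) * cnj z \<in> sector (2 * b - c) (2 * b - a)" if "z \<in> sector a c" for z a c
  proof -
    obtain r t where z: "z = of_real r * cis t" "0 < r" "a < t" "t < c" using \<open>z \<in> sector a c\<close> by (auto simp: sector_def)
    have "cis (2 * b) * cnj z = of_real r * cis (2 * b - t)"
      by (simp add: z(1) cis_cnj cis_mult mult.left_commute)
    moreover have "2 * b - c < 2 * b - t" "2 * b - t < 2 * b - a" using z(3,4) by auto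
    ultimately show ?thesis using z(2) unfolding sector_def by blast
  qed
  have e: "cis (2 * b) * cnj (cis (2 * b) * cnj z) = z" by (simp add: cis_cnj cis_mult mult.assoc[symmetric])
  show ?thesis
    using *[of z a c] *[of "cis (2 * b) * cnj z" "2 * b - c" "2 * b - a", unfolded e] by auto
qed

lemma inner_rotated_self: "(\<i> * c) \<bullet> (complex_of_real r * c) = 0"
  by (simp add: inner_complex_def)

text \<open>The rays at the multiples of \<open>b\<close> cut the disc into \<open>2 * n\<close>
  sectors. The two given reflections generate those in all these rays, so neighbouring pieces of
  \<open>E\<close> are mirror images of each other, and the rays themselves are null sets.\<close>

lemma emeasure_dihedral:
  assumes E: "E \<in> sets borel" "E \<subseteq> hyp_plane" and n: "n > 0" and b: "b = pi / real n"
    and inv: "\<And>z. z \<in> E \<Longrightarrow> cnj z \<in> E" "\<And>z. z \<in> E \<Longrightarrow> cis (2 * b) * cnj z \<in> E"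
  shows "emeasure hyp_area E = of_nat (2 * n) * emeasure hyp_area (E \<inter> sector 0 b)"
proof -
  have b0: "b > 0" and bn: "2 * real n * b = 2 * pi" using n by (simp_all add: b)
  define S where "S k = E \<inter> sector (real k * b) (real (Suc k) * b)" for k
  have "b \<le> pi" using n by (simp add: b divide_le_eq)
  then have "b \<le> 2 * pi" using pi_gt_zero by linarith
  then have S_borel: "S k \<in> sets borel" for k
    unfolding S_def using E(1) pi_gt_zero by (intro sets.Int sector_borel) (auto simp: algebra_simps)
  \<comment> \<open>The reflections in the rays \<open>0\<close> and \<open>b\<close> compose to the
    rotation by \<open>2 * b\<close>; following one reflection by this rotation gives the reflection
    in the next ray.\<close>
  have rot: "cis (2 * b * real k) * cnj z \<in> E" if "z \<in> E" for k z
  proof (induction k)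
    case 0
    then show ?case using inv(1)[OF that] by simp
  next
    case (Suc k)
    have "cis (2 * b * real (Suc k)) * cnj z = cis (2 * b) * cnj (cnj (cis (2 * b * real k) * cnj z))"
      by (simp add: cis_mult algebra_simps)
    then show ?case using inv(2)[OF inv(1)[OF Suc]] by (simp only:)
  qed
  have step: "emeasure hyp_area (S (Suc k)) = emeasure hyp_area (S k)" for k
  proof -
    define e where "e = cis (2 * b * real (Suc k))"
    have e1: "cmod e = 1" by (simp add: e_def)
    have ee: "e * cnj (e * cnj z) = z" for z by (simp add: e_def cis_cnj cis_mult mult.assoc[symmetric])
    have "{z \<in> hyp_plane. e * cnj z \<in> S k} = S (Suc k)"
    proof -
      have "e * cnj z \<in> E \<longleftrightarrow> z \<in> E" for z
        using rot[of z "Suc k", folded e_def] rot[of "e * cnj z" "Suc k", folded e_def] ee[of z]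
        by metis
      moreover have "e * cnj z \<in> sector (real k * b) (real (Suc k) * b) \<longleftrightarrow>
          z \<in> sector (real (Suc k) * b) (real (Suc (Suc k)) * b)" for z
        using sector_reflect[of "real (Suc k) * b" z "real (Suc (Suc k)) * b" "real (Suc k) * b"]
        by (simp add: e_def algebra_simps)
      ultimately show ?thesis using E(2) by (auto simp: S_def)
    qed
    then show ?thesis using emeasure_hyp_area_reflect[OF e1 S_borel, of k] by simp
  qed
  have Sk: "emeasure hyp_area (S k) = emeasure hyp_area (S 0)" for k
    by (induction k) (use step in auto)
  define N where "N = (\<Union>k<2*n. {z. (\<i> * cis (real k * b)) \<bullet> z = 0})"
  have N: "N \<in> null_sets hyp_area"
    unfolding N_def by (intro null_sets_UN' line_null) (auto simp: cis_neq_zero)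
  have "emeasure hyp_area E = emeasure hyp_area (\<Union>k<2*n. S k)"
  proof (rule emeasure_eq_AE)
    show "AE z in hyp_area. z \<in> E \<longleftrightarrow> z \<in> (\<Union>k<2*n. S k)"
    proof (rule AE_mp[OF AE_not_in[OF N]], rule AE_I2, rule impI, rule iffI)
      fix z assume zN: "z \<notin> N" and z: "z \<in> E"
      have "0 \<in> N" using n unfolding N_def by (intro UN_I[of 0]) auto
      then have "z \<noteq> 0" using zN by metis
      define t where "t = Arg2pi z"
      have zt: "z = of_real (cmod z) * cis t" using Arg2pi_eq[of z] by (simp add: t_def cis_conv_exp)
      have t: "0 \<le> t" "t < 2 * pi" using Arg2pi_ge_0 Arg2pi_lt_2pi by (auto simp: t_def)
      define k where "k = nat \<lfloor>t / b\<rfloor>"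
      have k: "real k \<le> t / b" "t / b < real (Suc k)"
        using t b0 by (simp_all add: k_def) linarith
      then have k': "real k * b \<le> t" "t < real (Suc k) * b" using b0 by (simp_all add: field_simps)
      have kn: "k < 2 * n"
      proof -
        have "real k * b < (2 * real n) * b" using k'(1) t(2) bn by linarith
        then have "real k < 2 * real n" using b0 by (simp only: mult_less_cancel_right_pos)
        then show ?thesis by linarith
      qed
      have "t \<noteq> real k * b"
      proof
        assume "t = real k * b"
        then have "z = of_real (cmod z) * cis (real k * b)" using zt by simp
        then have "(\<i> * cis (real k * b)) \<bullet> z = 0"
          by (metis inner_rotated_self)
        then show False using zN kn by (auto simp: N_def)
      qed
      then have "z \<in> S k" using z k' \<open>z \<noteq> 0\<close> zt k'(1) unfolding S_def sector_def
        by (metis (mono_tags, lifting) Int_iff mem_Collect_eq zero_less_norm_iff le_less)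
      then show "z \<in> (\<Union>k<2*n. S k)" using kn by blast
    qed (auto simp: S_def)
  qed (use E S_borel in auto)
  also have "\<dots> = (\<Sum>k<2*n. emeasure hyp_area (S k))"
  proof (rule sum_emeasure[symmetric])
    have "S k \<inter> S l = {}" if "k < l" "l < 2 * n" for k l
    proof -
      have "real (Suc k) * b \<le> real l * b" using that b0 by (intro mult_right_mono) auto
      moreover have "real (Suc l) * b \<le> 2 * real n * b" using that b0 by (intro mult_right_mono) auto
      ultimately have "sector (real k * b) (real (Suc k) * b) \<inter> sector (real l * b) (real (Suc l) * b) = {}"
        using b0 bn by (intro sector_disjoint) auto
      then show ?thesis by (auto simp: S_def)
    qed
    then show "disjoint_family_on S {..<2*n}"
      unfolding disjoint_family_on_def by (metis inf_commute lessThan_iff linorder_neqE_nat)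
  qed (use S_borel in auto)
  also have "\<dots> = of_nat (2 * n) * emeasure hyp_area (S 0)" by (subst Sk) simp
  finally show ?thesis by (simp add: S_def)
qed

section \<open>The reflection system of a triangle\<close>

datatype vertex = VA | VB | VC

lemma UNIV_vertex: "UNIV = {VA, VB, VC}"
  using vertex.exhaust by blast

instance vertex :: finite
  by standard (simp add: UNIV_vertex)

text \<open>Sides are named after the opposite vertices. The sides \<open>VA\<close> and
  \<open>VB\<close> meet at \<open>C\<close>, where the angle is \<open>pi / p2\<close>, and
  likewise for the other pairs.\<close>

definition cox_m :: "nat \<Rightarrow> nat \<Rightarrow> vertex \<Rightarrow> vertex \<Rightarrow> nat" where
  "cox_m p1 p2 i j = (if {i, j} = {VA, VB} then p2 else if {i, j} = {VA, VC} then p1 else 2)"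

lemma cox_m_simps [simp]:
  "cox_m p1 p2 VA VB = p2" "cox_m p1 p2 VB VA = p2" "cox_m p1 p2 VA VC = p1"
  "cox_m p1 p2 VC VA = p1" "cox_m p1 p2 VB VC = 2" "cox_m p1 p2 VC VB = 2"
  by (auto simp: cox_m_def doubleton_eq_iff)

lemma span_three:
  fixes v :: "vertex \<Rightarrow> complex \<times> real"
  assumes "\<And>i j. mform (\<alpha> i) (v j) = (if i = j then h i else 0)" "\<And>i. h i > 0"
  shows "span (range v) = UNIV"
proof -
  have inj: "inj v"
  proof (rule injI)
    fix i j assume "v i = v j"
    then show "i = j" using assms(1)[of i i] assms(1)[of i j] assms(2)[of i] by (auto split: if_splits)
  qed
  have "independent (range v)"
  proof (rule independent_if_scalars_zero)
    fix f x assume s: "(\<Sum>x\<in>range v. f x *\<^sub>R x) = 0" and "x \<in> range v"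
    then obtain i where x: "x = v i" by auto
    have "0 = mform (\<Sum>j\<in>UNIV. f (v j) *\<^sub>R v j) (\<alpha> i)"
      using s by (simp add: sum.reindex[OF inj])
    also have "\<dots> = (\<Sum>j\<in>UNIV. if j = i then f (v i) * h i else 0)"
      unfolding mform_sum_left using assms(1) by (intro sum.cong) (auto simp: mform_commute[of "v _"])
    also have "\<dots> = f (v i) * h i" by simp
    finally show "f x = 0" using assms(2)[of i] x by simp
  qed simp
  moreover have "card (range v) = DIM(complex \<times> real)"
    using card_image[OF inj] by (simp add: UNIV_vertex)
  ultimately have "dim (range v) = DIM(complex \<times> real)" by (metis dim_eq_card_independent)
  then show ?thesis by (simp only: dim_eq_full)
qed

text \<open>The right angle turns the law of cosines into \<open>z = x * y\<close> for the
  hyperbolic cosines of the sides and makes the legs the altitudes from \<open>B\<close> and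
  \<open>C\<close>. The three equations for \<open>h\<close> follow by expressing the angles through
  the sides.\<close>

lemma right_triangle_roots:
  assumes adm: "admissible p1 p2" and T: "right_triangle p1 p2 A B C"
  obtains \<alpha> h where
    "coxeter_system \<alpha> (cox_m p1 p2) (\<lambda>i. lift (case i of VA \<Rightarrow> A | VB \<Rightarrow> B | VC \<Rightarrow> C)) h"
    "(h VB)\<^sup>2 + 1 = (cos (pi / p2) / sin (pi / p1))\<^sup>2"
    "(h VC)\<^sup>2 + 1 = (cos (pi / p1) / sin (pi / p2))\<^sup>2"
    "(h VA)\<^sup>2 = (cos (pi / p1))\<^sup>2 + (cos (pi / p2))\<^sup>2 - 1"
proof -
  have pl: "A \<in> hyp_plane" "B \<in> hyp_plane" "C \<in> hyp_plane" "A \<noteq> B" "B \<noteq> C" "A \<noteq> C"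
    using T by (auto simp: right_triangle_def)
  have ang: "hyp_angle B A C = pi / 2" "hyp_angle A B C = pi / p1" "hyp_angle A C B = pi / p2"
    using T unfolding right_triangle_def by blast+
  define a b c where "a = lift A" and "b = lift B" and "c = lift C"
  define x y z where "x = - mform a b" and "y = - mform a c" and "z = - mform b c"
  define X Y where "X = sqrt (x\<^sup>2 - 1)" and "Y = sqrt (y\<^sup>2 - 1)"
  define Z where "Z = sqrt (z\<^sup>2 - 1)"
  have x1: "x > 1" "y > 1" "z > 1"
    using mform_lift_gt1 pl by (auto simp: x_def y_def z_def a_def b_def c_def)
  have X: "X > 0" "X\<^sup>2 = x\<^sup>2 - 1" and Y: "Y > 0" "Y\<^sup>2 = y\<^sup>2 - 1" and Z: "Z > 0" "Z\<^sup>2 = z\<^sup>2 - 1"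
    using x1 by (simp_all add: X_def Y_def Z_def)
  have m [simp]: "mform a a = -1" "mform b b = -1" "mform c c = -1"
    using pl lift_hyperboloid by (auto simp: a_def b_def c_def hyperboloid_def)
  have m' [simp]: "mform a b = -x" "mform b a = -x" "mform a c = -y" "mform c a = -y"
     "mform b c = -z" "mform c b = -z"
    by (simp_all add: x_def y_def z_def mform_commute)
  have zxy: "z = x * y"
    using hyp_angle_law[of B A C] pl unfolding ang
    by (simp add: a_def[symmetric] b_def[symmetric] c_def[symmetric])
  have cB: "cos (pi / p1) * (X * Z) = y * X\<^sup>2"
  proof -
    have "cos (pi / p1) * (X * Z) = x * z - y"
      using hyp_angle_law[of A B C] pl unfolding ang
      by (simp add: a_def[symmetric] b_def[symmetric] c_def[symmetric] X_def Z_def)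
    also have "\<dots> = y * (x\<^sup>2 - 1)" by (simp add: zxy power2_eq_square algebra_simps)
    finally show ?thesis by (simp only: X)
  qed
  have cC: "cos (pi / p2) * (Y * Z) = x * Y\<^sup>2"
  proof -
    have "cos (pi / p2) * (Y * Z) = y * z - x"
      using hyp_angle_law[of A C B] pl unfolding ang
      by (simp add: a_def[symmetric] b_def[symmetric] c_def[symmetric] Y_def Z_def mult.commute)
    also have "\<dots> = x * (y\<^sup>2 - 1)" by (simp add: zxy power2_eq_square algebra_simps)
    finally show ?thesis by (simp only: Y)
  qed
  have cosB: "cos (pi / p1) = y * X / Z" and cosC: "cos (pi / p2) = x * Y / Z"
    using cB cC X Y Z by (simp_all add: field_simps power2_eq_square)
  have Z2: "Z\<^sup>2 = x\<^sup>2 * y\<^sup>2 - 1" by (simp add: Z zxy power_mult_distrib)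
  \<comment> \<open>\<open>\<alpha> VB\<close> and \<open>\<alpha> VC\<close> are the unit tangent
    vectors at \<open>a\<close> along the legs: because of the right angle, the direction of one leg
    is normal to the other. \<open>\<alpha> VA\<close> is the combination of the three vertices that
    is orthogonal to \<open>b\<close> and \<open>c\<close>.\<close>
  define \<alpha> where "\<alpha> i = (case i of
      VA \<Rightarrow> (1 / (Z * X * Y)) *\<^sub>R ((z\<^sup>2 - 1) *\<^sub>R a - (x * (y\<^sup>2 - 1)) *\<^sub>R b - (y * (x\<^sup>2 - 1)) *\<^sub>R c)
    | VB \<Rightarrow> (1 / X) *\<^sub>R (b - x *\<^sub>R a) | VC \<Rightarrow> (1 / Y) *\<^sub>R (c - y *\<^sub>R a))" for i
  define h where "h i = (case i of VA \<Rightarrow> X * Y / Z | VB \<Rightarrow> X | VC \<Rightarrow> Y)" for i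
  define P where "P i = (case i of VA \<Rightarrow> A | VB \<Rightarrow> B | VC \<Rightarrow> C)" for i
  have dual: "mform (\<alpha> i) (lift (P j)) = (if i = j then h i else 0)" for i j
  proof -
    have eq: "(z\<^sup>2 - 1) * - 1 - x * (y\<^sup>2 - 1) * - x - y * (x\<^sup>2 - 1) * - y = X\<^sup>2 * Y\<^sup>2"
      unfolding X(2) Y(2) zxy by (simp add: power2_eq_square algebra_simps)
    have "mform (\<alpha> VA) a = (1 / (Z * X * Y)) *
        ((z\<^sup>2 - 1) * - 1 - x * (y\<^sup>2 - 1) * - x - y * (x\<^sup>2 - 1) * - y)"
      unfolding \<alpha>_def by simp
    also have "\<dots> = X * Y / Z"
      unfolding eq using X(1) Y(1) Z(1) by (simp add: power2_eq_square)
    finally have AA: "mform (\<alpha> VA) a = X * Y / Z" .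
    have AB: "mform (\<alpha> VA) b = 0" "mform (\<alpha> VA) c = 0"
      by (simp_all add: \<alpha>_def zxy power2_eq_square algebra_simps)
    have XX: "(x\<^sup>2 - 1) / X = X" "(y\<^sup>2 - 1) / Y = Y"
      unfolding X(2)[symmetric] Y(2)[symmetric] using X(1) Y(1) by (simp_all add: power2_eq_square)
    have BB: "mform (\<alpha> VB) b = X" "mform (\<alpha> VB) a = 0" "mform (\<alpha> VB) c = 0"
      unfolding \<alpha>_def vertex.case mform_simps m m' using X(1)
      by (simp_all add: zxy XX flip: power2_eq_square)
    have CC: "mform (\<alpha> VC) c = Y" "mform (\<alpha> VC) a = 0" "mform (\<alpha> VC) b = 0"
      unfolding \<alpha>_def vertex.case mform_simps m m' using Y(1)
      by (simp_all add: zxy XX flip: power2_eq_square)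
    show ?thesis
      by (cases i; cases j)
        (simp_all add: P_def h_def a_def[symmetric] b_def[symmetric] c_def[symmetric] AA AB BB CC)
  qed
  have hp: "h i > 0" for i using X Y Z by (cases i) (auto simp: h_def)
  note D = dual[of _ VA, unfolded P_def, simplified, folded a_def]
    dual[of _ VB, unfolded P_def, simplified, folded b_def]
    dual[of _ VC, unfolded P_def, simplified, folded c_def]
  have DA: "mform v (\<alpha> VA) = (1 / (Z * X * Y)) * ((z\<^sup>2 - 1) * mform v a - (x * (y\<^sup>2 - 1)) * mform v b - (y * (x\<^sup>2 - 1)) * mform v c)"
    and DB: "mform v (\<alpha> VB) = (1 / X) * (mform v b - x * mform v a)"
    and DC: "mform v (\<alpha> VC) = (1 / Y) * (mform v c - y * mform v a)" for v
    by (simp_all add: \<alpha>_def)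
  have uA: "mform (\<alpha> VA) (\<alpha> VA) = 1"
    unfolding DA D using X Y Z by (simp add: h_def Z(2)[symmetric]) (simp add: power2_eq_square)
  have uB: "mform (\<alpha> VB) (\<alpha> VB) = 1" "mform (\<alpha> VC) (\<alpha> VC) = 1"
    unfolding DB DC D using X Y by (simp_all add: h_def)
  have gAB: "mform (\<alpha> VA) (\<alpha> VB) = - cos (pi / p2)" "mform (\<alpha> VA) (\<alpha> VC) = - cos (pi / p1)"
    "mform (\<alpha> VB) (\<alpha> VC) = 0"
    unfolding DB DC D using X Y by (simp_all add: h_def cosB cosC)
  have p: "p1 \<ge> 3" "p2 \<ge> 3" using adm by (auto simp: admissible_def)
  have cs: "coxeter_system \<alpha> (cox_m p1 p2) (\<lambda>i. lift (P i)) h"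
  proof
    fix i j :: vertex
    show "mform (\<alpha> i) (\<alpha> i) = 1" by (cases i) (simp_all add: uA uB)
    show "i \<noteq> j \<Longrightarrow> mform (\<alpha> i) (\<alpha> j) = - cos (pi / cox_m p1 p2 i j)"
      by (cases i; cases j) (simp_all add: gAB mform_commute[of "\<alpha> VB" "\<alpha> VA"]
          mform_commute[of "\<alpha> VC" "\<alpha> VA"] mform_commute[of "\<alpha> VC" "\<alpha> VB"])
    show "i \<noteq> j \<Longrightarrow> 2 \<le> cox_m p1 p2 i j" using p by (cases i; cases j) simp_all
    show "cox_m p1 p2 i j = cox_m p1 p2 j i" by (simp add: cox_m_def insert_commute)
    show "mform (\<alpha> i) (lift (P j)) = (if i = j then h i else 0)" by (rule dual)
    show "0 < h i" by (rule hp)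
    show "span (range (\<lambda>i. lift (P i))) = UNIV" by (rule span_three[OF dual hp])
    show "lift (P i) \<in> hyperboloid" using pl lift_hyperboloid by (cases i) (auto simp: P_def)
    show "\<exists>j. j \<noteq> i" by (cases i) auto
  qed
  have sB: "(sin (pi / p1))\<^sup>2 = Y\<^sup>2 / Z\<^sup>2"
  proof -
    have "(sin (pi / p1))\<^sup>2 = 1 - y\<^sup>2 * X\<^sup>2 / Z\<^sup>2"
      by (simp add: sin_squared_eq cosB power_divide power_mult_distrib)
    also have "\<dots> = (Z\<^sup>2 - y\<^sup>2 * X\<^sup>2) / Z\<^sup>2" using Z(1) by (simp add: diff_divide_distrib)
    also have "Z\<^sup>2 - y\<^sup>2 * X\<^sup>2 = Y\<^sup>2" by (simp add: Z2 X Y algebra_simps)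
    finally show ?thesis .
  qed
  have sC: "(sin (pi / p2))\<^sup>2 = X\<^sup>2 / Z\<^sup>2"
  proof -
    have "(sin (pi / p2))\<^sup>2 = 1 - x\<^sup>2 * Y\<^sup>2 / Z\<^sup>2"
      by (simp add: sin_squared_eq cosC power_divide power_mult_distrib)
    also have "\<dots> = (Z\<^sup>2 - x\<^sup>2 * Y\<^sup>2) / Z\<^sup>2" using Z(1) by (simp add: diff_divide_distrib)
    also have "Z\<^sup>2 - x\<^sup>2 * Y\<^sup>2 = X\<^sup>2" by (simp add: Z2 X Y algebra_simps)
    finally show ?thesis .
  qed
  show ?thesis
  proof (rule that)
    show "coxeter_system \<alpha> (cox_m p1 p2) (\<lambda>i. lift (case i of VA \<Rightarrow> A | VB \<Rightarrow> B | VC \<Rightarrow> C)) h"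
      using cs by (simp add: P_def)
    show "(h VB)\<^sup>2 + 1 = (cos (pi / p2) / sin (pi / p1))\<^sup>2"
      unfolding power_divide sB using X(1) Y(1) Z(1) by (simp add: h_def cosC power_divide power_mult_distrib X(2))
    show "(h VC)\<^sup>2 + 1 = (cos (pi / p1) / sin (pi / p2))\<^sup>2"
      unfolding power_divide sC using X(1) Y(1) Z(1) by (simp add: h_def cosB power_divide power_mult_distrib Y(2))
    have "X\<^sup>2 * Y\<^sup>2 = y\<^sup>2 * X\<^sup>2 + x\<^sup>2 * Y\<^sup>2 - Z\<^sup>2" by (simp add: Z2 X Y algebra_simps)
    then show "(h VA)\<^sup>2 = (cos (pi / p1))\<^sup>2 + (cos (pi / p2))\<^sup>2 - 1"
      using Z(1) by (simp add: h_def cosB cosC power_divide power_mult_distrib diff_divide_distrib add_divide_distrib)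
  qed
qed

section \<open>Parity of words through determinants\<close>

fun det3 :: "complex \<times> real \<Rightarrow> complex \<times> real \<Rightarrow> complex \<times> real \<Rightarrow> real" where
  "det3 (u, s) (v, t) (w, r) = Re u * (Im v * r - t * Im w) - Im u * (Re v * r - t * Re w) + s * (Re v * Im w - Im v * Re w)"

lemma det3_mrefl:
  assumes "mform \<alpha> \<alpha> = 1"
  shows "det3 (mrefl \<alpha> x) (mrefl \<alpha> y) (mrefl \<alpha> z) = - det3 x y z"
proof -
  obtain a1 a2 a3 where a: "\<alpha> = (Complex a1 a2, a3)" by (metis complex.exhaust surj_pair)
  obtain x1 x2 x3 where x: "x = (Complex x1 x2, x3)" by (metis complex.exhaust surj_pair)
  obtain y1 y2 y3 where y: "y = (Complex y1 y2, y3)" by (metis complex.exhaust surj_pair)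
  obtain z1 z2 z3 where z: "z = (Complex z1 z2, z3)" by (metis complex.exhaust surj_pair)
  have *: "a1 * a1 + a2 * a2 - a3 * a3 = 1" using assms by (simp add: mform_def a inner_complex_def)
  define p q r where "p = x1 * a1 + x2 * a2 - x3 * a3" and "q = y1 * a1 + y2 * a2 - y3 * a3"
    and "r = z1 * a1 + z2 * a2 - z3 * a3"
  have "det3 (mrefl \<alpha> x) (mrefl \<alpha> y) (mrefl \<alpha> z) =
      det3 x y z - 2 * (p * det3 \<alpha> y z + q * det3 x \<alpha> z + r * det3 x y \<alpha>)"
    by (simp add: a x y z mrefl_def mform_def inner_complex_def p_def[symmetric] q_def[symmetric] r_def[symmetric])
      (simp add: algebra_simps)
  \<comment> \<open>Cramer's rule expands \<open>\<alpha>\<close> in \<open>x\<close>,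
    \<open>y\<close>, \<open>z\<close>; pairing this expansion with \<open>\<alpha>\<close> gives
    the identity, whose factor is \<open>mform \<alpha> \<alpha> = 1\<close>.\<close>
  also have "p * det3 \<alpha> y z + q * det3 x \<alpha> z + r * det3 x y \<alpha> =
      (a1 * a1 + a2 * a2 - a3 * a3) * det3 x y z"
    by (simp add: a x y z p_def q_def r_def algebra_simps)
  finally show ?thesis by (simp add: *)
qed

context coxeter_system
begin

lemma det3_W: "det3 (W ws x) (W ws y) (W ws z) = (-1) ^ length ws * det3 x y z"
  by (induction ws) (simp_all add: det3_mrefl unit)

text \<open>The determinant of a word is the sign of its length, evaluated here on a basis of
  determinant 1.\<close>

lemma parity: "W us = W vs \<Longrightarrow> even (length us) = even (length vs)"
  using det3_W[of us "(1, 0)" "(\<i>, 0)" "(0, 1)"] det3_W[of vs "(1, 0)" "(\<i>, 0)" "(0, 1)"]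
  by (cases "even (length us)"; cases "even (length vs)") auto

end

section \<open>The rotation subgroup\<close>

text \<open>Isometries act on the disc and words on Minkowski space. The two are compared through
  \<open>lift\<close>, and only on the disc, since elements of the group are determined
  there.\<close>

definition tracks :: "(vertex \<Rightarrow> complex \<times> real) \<Rightarrow> vertex list \<Rightarrow> (complex \<Rightarrow> complex) \<Rightarrow> bool" where
  "tracks \<alpha> ws g \<longleftrightarrow> (\<forall>z\<in>hyp_plane. g z \<in> hyp_plane \<and> lift (g z) = act \<alpha> ws (lift z))"

lemma hyp_rotation_Bij:
  assumes P: "P \<in> hyp_plane"
  shows "hyp_rotation P \<theta> \<in> Bij hyp_plane"
proof -
  have inv: "hyp_rotation P \<theta>' (hyp_rotation P \<theta> z) = z" if z: "z \<in> hyp_plane" and e: "\<theta>' = - \<theta>" for z \<theta> \<theta>'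
  proof -
    have z1: "hyp_rotation P \<theta> z \<in> hyp_plane" by (rule hyp_rotation_in_plane[OF P z])
    then have z2: "hyp_rotation P \<theta>' (hyp_rotation P \<theta> z) \<in> hyp_plane" by (rule hyp_rotation_in_plane[OF P])
    have "boost P (lift (hyp_rotation P \<theta>' (hyp_rotation P \<theta> z))) = boost P (lift z)"
      by (simp add: boost_rotation[OF P z1] boost_rotation[OF P z] e mult.assoc[symmetric] cis_mult)
    then show ?thesis using boost_inj[OF P] lift_inj[OF z2 z] by blast
  qed
  have "bij_betw (hyp_rotation P \<theta>) hyp_plane hyp_plane"
  proof (rule bij_betwI[where g = "hyp_rotation P (- \<theta>)"])
    show "hyp_rotation P \<theta> (hyp_rotation P (- \<theta>) z) = z" if "z \<in> hyp_plane" for z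
      using inv[OF that, of \<theta> "- \<theta>"] by simp
    show "hyp_rotation P (- \<theta>) (hyp_rotation P \<theta> z) = z" if "z \<in> hyp_plane" for z
      using inv[OF that] by simp
  qed (use hyp_rotation_in_plane[OF P] in blast)+
  then show ?thesis by (simp add: Bij_def hyp_rotation_def)
qed

lemma Gamma0_subgroup:
  assumes "g0 \<in> Bij hyp_plane" "g1 \<in> Bij hyp_plane"
  shows "subgroup (Gamma0 g0 g1) (BijGroup hyp_plane)"
  unfolding Gamma0_def using assms
  by (intro group.generate_is_subgroup group_BijGroup) (auto simp: BijGroup_def)

lemma Gamma0_words:
  assumes cs: "coxeter_system \<alpha> (cox_m p1 p2) (\<lambda>i. lift (p i)) h"
    and pl: "\<And>i. p i \<in> hyp_plane"
    and R: "rotation_generators p1 p2 (p VA) (p VB) (p VC) g0 g1"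
  shows "g \<in> Gamma0 g0 g1 \<Longrightarrow> \<exists>ws. even (length ws) \<and> tracks \<alpha> ws g"
    and "even (length ws) \<Longrightarrow> \<exists>g\<in>Gamma0 g0 g1. tracks \<alpha> ws g"
proof -
  interpret coxeter_system \<alpha> "cox_m p1 p2" "\<lambda>i. lift (p i)" h by fact
  let ?\<Gamma> = "Gamma0 g0 g1" and ?B = "BijGroup hyp_plane"
  obtain s1 where g0: "g0 = hyp_rotation (p VA) pi" and s1: "s1 \<in> {1, -1}"
    and g1: "g1 = hyp_rotation (p VB) (s1 * (2 * pi / real p1))"
    using R unfolding rotation_generators_def by blast
  have bij: "g0 \<in> Bij hyp_plane" "g1 \<in> Bij hyp_plane"
    unfolding g0 g1 using hyp_rotation_Bij pl by auto
  interpret S: subgroup ?\<Gamma> ?B by (rule Gamma0_subgroup[OF bij])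
  have \<Gamma>B: "g \<in> Bij hyp_plane" if "g \<in> ?\<Gamma>" for g
    using S.mem_carrier[OF that] by (simp add: BijGroup_def)
  have tr_mult: "tracks \<alpha> (us @ vs) (f \<otimes>\<^bsub>?B\<^esub> g)"
    if "tracks \<alpha> us f" "tracks \<alpha> vs g" "f \<in> Bij hyp_plane" "g \<in> Bij hyp_plane" for us vs f g
    using that by (auto simp: tracks_def BijGroup_def compose_def act_append)
  have tr_inv: "tracks \<alpha> (rev us) (inv\<^bsub>?B\<^esub> f)" if t: "tracks \<alpha> us f" and f: "f \<in> Bij hyp_plane" for us f
  proof -
    have "inv_into hyp_plane f z \<in> hyp_plane \<and> f (inv_into hyp_plane f z) = z" if "z \<in> hyp_plane" for z
      using Bij_inv_into_mem[OF f that] f that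
      by (simp add: Bij_def bij_betw_def f_inv_into_f del: mem_ball mem_ball_0)
    then have *: "inv_into hyp_plane f z \<in> hyp_plane \<and> lift z = W us (lift (inv_into hyp_plane f z))"
      if "z \<in> hyp_plane" for z
      using t that unfolding tracks_def by metis
    show ?thesis
      unfolding tracks_def inv_BijGroup[OF f]
    proof (intro ballI conjI)
      fix z assume z: "z \<in> hyp_plane"
      from *[OF z] have "W (rev us) (lift z) = lift (inv_into hyp_plane f z)" by (metis W_rev_cancel(1))
      then show "lift (restrict (inv_into hyp_plane f) hyp_plane z) = W (rev us) (lift z)" using z by simp
      show "restrict (inv_into hyp_plane f) hyp_plane z \<in> hyp_plane" using *[OF z] z by simp
    qed
  qed
  have tr_one: "tracks \<alpha> [] \<one>\<^bsub>?B\<^esub>"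
    by (simp add: tracks_def BijGroup_def)
  have orth: "mform (\<alpha> i) (lift (p j)) = 0" if "i \<noteq> j" for i j using dual that by simp
  have t0: "tracks \<alpha> [VB, VC] g0 \<or> tracks \<alpha> [VC, VB] g0"
  proof -
    have o: "mform (\<alpha> VB) (lift (p VA)) = 0" "mform (\<alpha> VC) (lift (p VA)) = 0"
      and g: "mform (\<alpha> VB) (\<alpha> VC) = - cos (pi / 2)"
      using orth gram[of VB VC] by auto
    obtain s where s: "s \<in> {1, -1::real}" and
      r: "\<forall>z\<in>hyp_plane. lift (hyp_rotation (p VA) (s * (2 * (pi / 2))) z) = mrefl (\<alpha> VB) (mrefl (\<alpha> VC) (lift z)) \<and>
        lift (hyp_rotation (p VA) (- s * (2 * (pi / 2))) z) = mrefl (\<alpha> VC) (mrefl (\<alpha> VB) (lift z))"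
      using rotation_eq_two_reflections[OF pl unit o(1) unit o(2) g] by blast
    then show ?thesis using s hyp_rotation_in_plane[OF pl]
      unfolding tracks_def g0 by auto
  qed
  have t1: "tracks \<alpha> [VA, VC] g1 \<or> tracks \<alpha> [VC, VA] g1"
  proof -
    have o: "mform (\<alpha> VA) (lift (p VB)) = 0" "mform (\<alpha> VC) (lift (p VB)) = 0"
      and g: "mform (\<alpha> VA) (\<alpha> VC) = - cos (pi / p1)"
      using orth gram[of VA VC] by auto
    obtain s where s: "s \<in> {1, -1::real}" and
      r: "\<forall>z\<in>hyp_plane. lift (hyp_rotation (p VB) (s * (2 * (pi / p1))) z) = mrefl (\<alpha> VA) (mrefl (\<alpha> VC) (lift z)) \<and>
        lift (hyp_rotation (p VB) (- s * (2 * (pi / p1))) z) = mrefl (\<alpha> VC) (mrefl (\<alpha> VA) (lift z))"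
      using rotation_eq_two_reflections[OF pl unit o(1) unit o(2) g] by blast
    then show ?thesis using s s1 hyp_rotation_in_plane[OF pl]
      unfolding tracks_def g1 by auto
  qed
  have e0: "\<exists>ws. even (length ws) \<and> tracks \<alpha> ws g0"
    using t0 by (auto intro: exI[of _ "[VB, VC]"] exI[of _ "[VC, VB]"])
  have e1: "\<exists>ws. even (length ws) \<and> tracks \<alpha> ws g1"
    using t1 by (auto intro: exI[of _ "[VA, VC]"] exI[of _ "[VC, VA]"])
  have gen: "\<exists>ws. even (length ws) \<and> tracks \<alpha> ws g" if "g \<in> ?\<Gamma>" for g
    using that[unfolded Gamma0_def]
  proof (induction g rule: generate.induct)
    case one
    then show ?case using tr_one by (intro exI[of _ "[]"]) auto
  next
    case (incl g)
    then show ?case using e0 e1 by auto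
  next
    case (inv g)
    then have gB: "g \<in> Bij hyp_plane" using bij by auto
    obtain ws where "even (length ws)" "tracks \<alpha> ws g" using inv e0 e1 by auto
    then show ?case using tr_inv[OF _ gB] by (intro exI[of _ "rev ws"]) auto
  next
    case (eng f g)
    then have fg: "f \<in> Bij hyp_plane" "g \<in> Bij hyp_plane" using \<Gamma>B by (auto simp: Gamma0_def)
    obtain us vs where "even (length us)" "tracks \<alpha> us f" "even (length vs)" "tracks \<alpha> vs g"
      using eng by blast
    then show ?case using tr_mult[OF _ _ fg] by (intro exI[of _ "us @ vs"]) auto
  qed
  then show "g \<in> ?\<Gamma> \<Longrightarrow> \<exists>ws. even (length ws) \<and> tracks \<alpha> ws g" .
  define H where "H = {ws. \<exists>g\<in>?\<Gamma>. tracks \<alpha> ws g}"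
  have H_nil: "[] \<in> H" using tr_one S.one_closed unfolding H_def by blast
  have H_append: "us @ vs \<in> H" if "us \<in> H" "vs \<in> H" for us vs
    using that tr_mult \<Gamma>B S.m_closed unfolding H_def by blast
  have H_rev: "rev us \<in> H" if "us \<in> H" for us
    using that tr_inv \<Gamma>B S.m_inv_closed unfolding H_def by blast
  have H_cong: "vs \<in> H" if "us \<in> H" "W us = W vs" for us vs
    using that unfolding H_def tracks_def by auto
  have g\<Gamma>: "g0 \<in> ?\<Gamma>" "g1 \<in> ?\<Gamma>" unfolding Gamma0_def by (auto intro: generate.incl)
  have BC: "[VB, VC] \<in> H" "[VC, VB] \<in> H"
    using t0 g\<Gamma> H_rev[of "[VB, VC]"] H_rev[of "[VC, VB]"] unfolding H_def by auto
  have AC: "[VA, VC] \<in> H" "[VC, VA] \<in> H"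
    using t1 g\<Gamma> H_rev[of "[VA, VC]"] H_rev[of "[VC, VA]"] unfolding H_def by auto
  \<comment> \<open>The rotation about the third vertex: in the product of the other two the inner
    letters \<open>VC\<close> cancel.\<close>
  have AB: "[VA, VB] \<in> H" "[VB, VA] \<in> H"
    using H_cong[OF H_append[OF AC(1) BC(2)], of "[VA, VB]"] W_double[of "[VA]" VC "[VB]"]
      H_cong[OF H_append[OF BC(1) AC(2)], of "[VB, VA]"] W_double[of "[VB]" VC "[VA]"] by auto
  have dbl: "[i, i] \<in> H" for i
    using H_cong[OF H_nil, of "[i, i]"] W_double[of "[]" i "[]"] by auto
  have two: "[i, j] \<in> H" for i j
    using AB AC BC dbl by (cases i; cases j) auto
  have "ws \<in> H" if "even (length ws)" for ws
    using that
  proof (induction ws rule: induct_list012)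
    case (3 x y zs)
    then show ?case using H_append[OF two[of x y], of zs] by simp
  qed (use H_nil in auto)
  then show "even (length ws) \<Longrightarrow> \<exists>g\<in>?\<Gamma>. tracks \<alpha> ws g" by (simp add: H_def)
qed

text \<open>Of the generators only one fact is kept: the group consists of the even words. In this
  form the results apply also to an image of the triangle under the group, which is how an arbitrary
  centre is reduced to a vertex.\<close>

locale rotation_group = coxeter_system \<alpha> m "\<lambda>i. lift (p i)" h
  for \<alpha> :: "vertex \<Rightarrow> complex \<times> real" and m p h +
  fixes G :: "(complex \<Rightarrow> complex) set"
  assumes p_plane: "p i \<in> hyp_plane"
    and element_word: "g \<in> G \<Longrightarrow> \<exists>ws. even (length ws) \<and> tracks \<alpha> ws g"
    and word_element: "even (length ws) \<Longrightarrow> \<exists>g\<in>G. tracks \<alpha> ws g"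
begin

section \<open>Orbits, gaps and fixed points of the rotation group\<close>

lemma G_in_plane: "g \<in> G \<Longrightarrow> z \<in> hyp_plane \<Longrightarrow> g z \<in> hyp_plane"
  using element_word unfolding tracks_def by blast

lemma W_fixes_vertex: "i \<noteq> j \<Longrightarrow> W [i] (lift (p j)) = lift (p j)"
  using dual[of i j] by (simp add: mrefl_def mform_commute)

text \<open>Append the reflection in a side through \<open>p j\<close>: it changes the parity of the
  word but not its effect on that vertex.\<close>

lemma even_word:
  obtains vs where "even (length vs)" "W vs (lift (p j)) = W ws (lift (p j))"
proof (cases "even (length ws)")
  case False
  obtain i where "i \<noteq> j" using nontrivial by blast
  then show ?thesis using that[of "ws @ [i]"] False W_fixes_vertex[of i j] by (simp add: act_append)
qed (use that in auto)

lemma orbit_eq: "{lift (g (p j)) | g. g \<in> G} = {W ws (lift (p j)) | ws. True}"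
proof (intro equalityI subsetI)
  fix x assume "x \<in> {lift (g (p j)) | g. g \<in> G}"
  then show "x \<in> {W ws (lift (p j)) | ws. True}"
    using element_word p_plane unfolding tracks_def by blast
next
  fix x assume "x \<in> {W ws (lift (p j)) | ws. True}"
  then obtain ws where ws: "x = W ws (lift (p j))" by blast
  obtain vs where "even (length vs)" "W vs (lift (p j)) = W ws (lift (p j))" using even_word by blast
  moreover obtain g where "g \<in> G" "tracks \<alpha> vs g" using word_element calculation(1) by blast
  ultimately have "x = lift (g (p j))" using p_plane ws by (simp add: tracks_def)
  then show "x \<in> {lift (g (p j)) | g. g \<in> G}" using \<open>g \<in> G\<close> by blast
qed

lemma cosh_gap: "cosh (2 * arsinh (h j)) = 1 + 2 * (h j)\<^sup>2"
  by (simp add: cosh_double_cosh cosh_square_eq)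

lemma gap_pos: "0 < arsinh (h j)"
  using h_pos[of j] by simp

lemma vertex_gap:
  assumes "g \<in> G" "g (p j) \<noteq> p j"
  shows "2 * arsinh (h j) \<le> hyp_dist (p j) (g (p j))"
proof -
  have gp: "g (p j) \<in> hyp_plane" using G_in_plane[OF assms(1) p_plane] .
  obtain ws where ws: "lift (g (p j)) = W ws (lift (p j))"
    using element_word[OF assms(1)] p_plane unfolding tracks_def by blast
  then have "W ws (lift (p j)) \<noteq> lift (p j)" using assms(2) lift_inj[OF gp p_plane] by metis
  from vertex_orbit_gap[OF this]
  have "cosh (2 * arsinh (h j)) \<le> cosh (hyp_dist (p j) (g (p j)))"
    unfolding cosh_gap cosh_hyp_dist[OF p_plane gp] ws .
  then show ?thesis
    using gap_pos[of j] hyp_dist_nonneg[OF p_plane gp] by (simp add: cosh_real_nonneg_le_iff)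
qed

text \<open>In the word \<open>[j, i]\<close> the letter \<open>i\<close> fixes \<open>p j\<close>
  and only makes the length even; then \<open>j\<close> reflects \<open>p j\<close> in the opposite
  side.\<close>

lemma vertex_gap_attained: "\<exists>g\<in>G. g (p j) \<noteq> p j \<and> hyp_dist (p j) (g (p j)) = 2 * arsinh (h j)"
proof -
  obtain i where i: "i \<noteq> j" using nontrivial by blast
  obtain g where g: "g \<in> G" "tracks \<alpha> [j, i] g" using word_element[of "[j, i]"] by auto
  have gp: "g (p j) \<in> hyp_plane" using G_in_plane[OF g(1) p_plane] .
  have "lift (g (p j)) = W [j] (W [i] (lift (p j)))" using g(2) p_plane by (simp add: tracks_def)
  also have l: "\<dots> = lift (p j) - (2 * h j) *\<^sub>R \<alpha> j"
    unfolding W_fixes_vertex[OF i] by (simp add: mrefl_def mform_commute[of _ "\<alpha> j"] dual)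
  finally have "lift (g (p j)) = lift (p j) - (2 * h j) *\<^sub>R \<alpha> j" .
  moreover have "mform (lift (p j)) (\<alpha> j) = h j" by (simp add: mform_commute[of _ "\<alpha> j"] dual)
  ultimately have "- mform (lift (p j)) (lift (g (p j))) = 1 + 2 * (h j)\<^sup>2"
    using P_hyperboloid[of j] by (simp add: hyperboloid_def power2_eq_square)
  then have "cosh (hyp_dist (p j) (g (p j))) = cosh (2 * arsinh (h j))"
    unfolding cosh_gap cosh_hyp_dist[OF p_plane gp] .
  then have d: "hyp_dist (p j) (g (p j)) = 2 * arsinh (h j)"
    using gap_pos[of j] hyp_dist_nonneg[OF p_plane gp] arcosh_cosh_real[of "hyp_dist (p j) (g (p j))"]
      arcosh_cosh_real[of "2 * arsinh (h j)"] by simp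
  then have "g (p j) \<noteq> p j" using gap_pos[of j] hyp_dist_lift[OF p_plane gp] P_hyperboloid[of j]
    by (auto simp: hyperboloid_def)
  then show ?thesis using g(1) d by blast
qed

text \<open>Move \<open>z\<close> into the chamber and conjugate the word accordingly. A reduced,
  even and nonempty word has two different letters, so by \<open>W_fixed_chamber\<close> the point
  lies on two sides and is a vertex.\<close>

lemma fixed_point_vertex:
  assumes g: "g \<in> G" and z: "z \<in> hyp_plane" "g z = z" and x: "x \<in> hyp_plane" "g x \<noteq> x"
  shows "\<exists>f\<in>G. \<exists>j. z = f (p j)"
proof -
  obtain ws where ws: "even (length ws)" "tracks \<alpha> ws g" using element_word[OF g] by blast
  obtain us where us: "W us (lift z) \<in> chamber" using chamber_cover[OF lift_hyperboloid[OF z(1)]] by blast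
  define y where "y = W us (lift z)"
  obtain vs where vs: "reduced vs" "W vs = W (us @ ws @ rev us)" using reduced_exists by blast
  have fz: "W ws (lift z) = lift z" using ws(2) z by (metis tracks_def)
  have fy: "W vs y = y" unfolding vs y_def act_append W_rev_cancel fz ..
  have ev: "even (length vs)" using parity[OF vs(2)] ws(1) by simp
  have letters: "mform y (\<alpha> i) = 0" if "i \<in> set vs" for i
    using W_fixed_chamber[OF vs(1) us[folded y_def] fy that] .
  obtain i k where ik: "i \<in> set vs" "k \<in> set vs" "i \<noteq> k"
  proof (cases vs)
    case Nil
    have "W us (W ws (W (rev us) w)) = w" for w using vs(2) Nil by (metis act.simps(1) act_append)
    then have "W ws w = w" for w by (metis W_rev_cancel)
    then have "lift (g x) = lift x" using ws(2) x(1) by (simp add: tracks_def)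
    then show thesis using lift_inj[of "g x" x] x G_in_plane[OF g x(1)] by blast
  next
    case (Cons a us')
    then obtain b us'' where c: "vs = a # b # us''" using ev by (cases us') auto
    have "a \<noteq> b"
    proof
      assume "a = b"
      then have "W us'' = W vs" using W_double[of "[]" a us''] c by simp
      then show False using vs(1) c unfolding reduced_def by fastforce
    qed
    then show thesis using that[of a b] c by simp
  qed
  obtain j where j: "\<And>l. l \<noteq> i \<Longrightarrow> l \<noteq> k \<Longrightarrow> l = j" "j \<noteq> i" "j \<noteq> k"
    using ik(3) by (cases i; cases k) (metis vertex.distinct vertex.exhaust)+
  have "y = (\<Sum>l\<in>UNIV. (mform y (\<alpha> l) / h l) *\<^sub>R lift (p l))" by (rule P_expansion[of y])
  also have "\<dots> = (\<Sum>l\<in>UNIV. if l = j then (mform y (\<alpha> j) / h j) *\<^sub>R lift (p j) else 0)"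
  proof (intro sum.cong refl)
    fix l
    have "mform y (\<alpha> l) = 0" if "l \<noteq> j" using letters ik(1,2) j(1)[of l] that by blast
    then show "(mform y (\<alpha> l) / h l) *\<^sub>R lift (p l) =
        (if l = j then (mform y (\<alpha> j) / h j) *\<^sub>R lift (p j) else 0)"
      by (cases "l = j") simp_all
  qed
  also have "\<dots> = (mform y (\<alpha> j) / h j) *\<^sub>R lift (p j)" by simp
  finally obtain c where c: "y = c *\<^sub>R lift (p j)" by blast
  have yH: "y \<in> hyperboloid" using lift_hyperboloid[OF z(1)] by (simp add: y_def)
  have pH: "mform (lift (p j)) (lift (p j)) = -1" "snd (lift (p j)) > 0" "mform y y = -1" "snd y > 0"
    using yH P_hyperboloid[of j] unfolding hyperboloid_def by blast+
  have "mform y y = c * c * mform (lift (p j)) (lift (p j))"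
    unfolding c by (simp only: mform_simps mult.assoc)
  then have "c * c = 1" unfolding pH by simp
  moreover have "snd y = c * snd (lift (p j))" unfolding c by simp
  then have "c > 0" using pH(2,4) by (simp add: zero_less_mult_iff)
  ultimately have "c = 1" using square_eq_1_iff[of c] by auto
  then have "lift z = W (rev us) (lift (p j))" using c unfolding y_def by (metis W_rev_cancel(1) scaleR_one)
  then obtain f where f: "f \<in> G" "lift z = lift (f (p j))" using orbit_eq[of j] by blast
  then have "z = f (p j)" using lift_inj[OF z(1) G_in_plane[OF f(1) p_plane]] by blast
  then show ?thesis using f(1) by blast
qed

text \<open>Conjugation by the word of \<open>f\<close> produces the reflections in the sides of the
  image triangle. It maps even words to even words, so the group stays the same.\<close>

lemma transport:
  assumes f: "f \<in> G"
  shows "\<exists>\<alpha>'. rotation_group \<alpha>' m (\<lambda>i. f (p i)) h G"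
proof -
  obtain us where us: "even (length us)" "tracks \<alpha> us f" using element_word[OF f] by blast
  have fp: "f (p i) \<in> hyp_plane" for i using G_in_plane[OF f p_plane] .
  have lf: "lift (f (p i)) = W us (lift (p i))" for i using us(2) p_plane by (simp add: tracks_def)
  define \<alpha>' where "\<alpha>' i = W us (\<alpha> i)" for i
  have d: "mform (\<alpha>' i) (lift (f (p j))) = (if i = j then h i else 0)" for i j
    by (simp add: \<alpha>'_def lf dual)
  have r: "mrefl (\<alpha>' i) x = W us (mrefl (\<alpha> i) (W (rev us) x))" for i x
  proof -
    have "mform x (\<alpha>' i) = mform (W (rev us) x) (\<alpha> i)" by (simp add: \<alpha>'_def act_adjoint)
    then show ?thesis by (simp add: mrefl_def act_diff act_scale \<alpha>'_def)
  qed
  have A: "act \<alpha>' ws x = W (us @ ws @ rev us) x" for ws x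
    by (induction ws) (simp_all add: act_append r)
  have A': "W ws x = act \<alpha>' (rev us @ ws @ us) x" for ws x
  proof -
    have "act \<alpha>' (rev us @ ws @ us) x = W (us @ (rev us @ ws @ us) @ rev us) x" by (rule A)
    then show ?thesis by (simp add: act_append)
  qed
  have "rotation_group \<alpha>' m (\<lambda>i. f (p i)) h G"
  proof
    fix i j :: vertex and g ws
    show "mform (\<alpha>' i) (\<alpha>' i) = 1" by (simp add: \<alpha>'_def unit)
    show "i \<noteq> j \<Longrightarrow> mform (\<alpha>' i) (\<alpha>' j) = - cos (pi / m i j)" by (simp add: \<alpha>'_def gram)
    show "i \<noteq> j \<Longrightarrow> 2 \<le> m i j" by (rule m_ge2)
    show "m i j = m j i" by (rule m_sym)
    show "mform (\<alpha>' i) (lift (f (p j))) = (if i = j then h i else 0)" by (rule d)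
    show "0 < h i" by (rule h_pos)
    show "span (range (\<lambda>i. lift (f (p i)))) = UNIV" by (rule span_three[OF d h_pos])
    show "lift (f (p i)) \<in> hyperboloid" using lift_hyperboloid[OF fp] .
    show "\<exists>j. j \<noteq> i" by (rule nontrivial)
    show "f (p i) \<in> hyp_plane" by (rule fp)
    show "g \<in> G \<Longrightarrow> \<exists>ws. even (length ws) \<and> tracks \<alpha>' ws g"
    proof -
      assume "g \<in> G"
      then obtain ws where "even (length ws)" "tracks \<alpha> ws g" using element_word by blast
      then have "even (length (rev us @ ws @ us))" "tracks \<alpha>' (rev us @ ws @ us) g"
        unfolding tracks_def A'[symmetric] by auto
      then show ?thesis by blast
    qed
    show "even (length ws) \<Longrightarrow> \<exists>g\<in>G. tracks \<alpha>' ws g"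
      using word_element[of "us @ ws @ rev us"] unfolding tracks_def A by auto
  qed
  then show ?thesis by blast
qed

end

section \<open>The volume of a ball as a power series\<close>

text \<open>The integral of \<open>(1 - t\<^sup>2) ^ k\<close> from -1 to 1, given by its
  recursion.\<close>

primrec wallis :: "nat \<Rightarrow> real" where
  "wallis 0 = 2"
| "wallis (Suc k) = wallis k * (2 * real (Suc k) / (2 * real (Suc k) + 1))"

lemma wallis_pos: "0 < wallis k"
  by (induction k) auto

lemma wallis_Suc_le: "wallis (Suc k) \<le> wallis k"
  using mult_left_le[of "2 * real (Suc k) / (2 * real (Suc k) + 1)" "wallis k"] wallis_pos[of k]
  unfolding wallis.simps by (simp add: less_imp_le)

lemma wallis_antimono: "j \<le> k \<Longrightarrow> wallis k \<le> wallis j"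
  by (rule lift_Suc_antimono_le[of wallis, OF wallis_Suc_le])

text \<open>Integration by parts, written as an exact derivative: \<open>?f\<close> vanishes at both
  ends, and its derivative combines the integrands with exponents \<open>Suc k\<close> and
  \<open>k\<close>.\<close>

lemma wallis_integral:
  assumes "0 \<le> \<rho>"
  shows "((\<lambda>t. (\<rho>\<^sup>2 - t\<^sup>2) ^ k) has_integral wallis k * \<rho> ^ (2 * k + 1)) {-\<rho>..\<rho>}"
proof (induction k)
  case 0
  show ?case using has_integral_const_real[of "1 :: real" "-\<rho>" \<rho>] assms by simp
next
  case (Suc k)
  let ?f = "\<lambda>t. t * (\<rho>\<^sup>2 - t\<^sup>2) ^ Suc k"
  let ?f' = "\<lambda>t. (2 * real k + 3) * (\<rho>\<^sup>2 - t\<^sup>2) ^ Suc k - 2 * real (Suc k) * \<rho>\<^sup>2 * (\<rho>\<^sup>2 - t\<^sup>2) ^ k"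
  have "(?f has_real_derivative ?f' t) (at t within S)" for t S
  proof -
    have "((\<lambda>t. \<rho>\<^sup>2 - t\<^sup>2) has_real_derivative - 2 * t) (at t within S)"
      by (auto intro!: derivative_eq_intros)
    from DERIV_mult'[OF DERIV_ident DERIV_power_Suc[OF this, of k]]
    have "(?f has_real_derivative (\<rho>\<^sup>2 - t\<^sup>2) ^ Suc k + t * (real (Suc k) * (\<rho>\<^sup>2 - t\<^sup>2) ^ k * (- 2 * t))) (at t within S)"
      by (simp add: algebra_simps)
    moreover have "(\<rho>\<^sup>2 - t\<^sup>2) ^ Suc k + t * (real (Suc k) * (\<rho>\<^sup>2 - t\<^sup>2) ^ k * (- 2 * t)) = ?f' t"
    proof -
      define q where "q = \<rho>\<^sup>2 - t\<^sup>2"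
      have "t * t = \<rho>\<^sup>2 - q" by (simp add: q_def power2_eq_square)
      then have "t * (real (Suc k) * q ^ k * (- 2 * t)) = - 2 * real (Suc k) * q ^ k * (\<rho>\<^sup>2 - q)"
        by (metis (no_types, lifting) mult.assoc mult.commute mult.left_commute)
      then show ?thesis unfolding q_def[symmetric] by (simp add: algebra_simps)
    qed
    ultimately show ?thesis by simp
  qed
  then have "(?f' has_integral ?f \<rho> - ?f (- \<rho>)) {-\<rho>..\<rho>}"
    using assms by (intro fundamental_theorem_of_calculus)
      (auto simp: has_real_derivative_iff_has_vector_derivative[symmetric])
  then have "((\<lambda>t. ?f' t + 2 * real (Suc k) * \<rho>\<^sup>2 * (\<rho>\<^sup>2 - t\<^sup>2) ^ k) has_integral
      0 + 2 * real (Suc k) * \<rho>\<^sup>2 * (wallis k * \<rho> ^ (2 * k + 1))) {-\<rho>..\<rho>}"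
    by (intro has_integral_add has_integral_mult_right Suc) simp
  then have "((\<lambda>t. inverse (2 * real k + 3) * ((2 * real k + 3) * (\<rho>\<^sup>2 - t\<^sup>2) ^ Suc k)) has_integral
      inverse (2 * real k + 3) * (2 * real (Suc k) * \<rho>\<^sup>2 * (wallis k * \<rho> ^ (2 * k + 1)))) {-\<rho>..\<rho>}"
    by (intro has_integral_mult_right) simp
  moreover have "inverse (2 * real k + 3) * ((2 * real k + 3) * x) = x" for x by simp
  moreover have "inverse (2 * real k + 3) * (2 * real (Suc k) * \<rho>\<^sup>2 * (wallis k * \<rho> ^ (2 * k + 1))) =
      wallis (Suc k) * \<rho> ^ (2 * Suc k + 1)"
    by (simp add: divide_inverse power2_eq_square)
  ultimately show ?case by simp
qed

lemma cosh_minus_1_sums: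
  "(\<lambda>k. x ^ (2 * k + 2) / fact (2 * k + 2)) sums (cosh x - 1 :: real)"
proof -
  have "(\<lambda>n. if even n then x ^ n /\<^sub>R fact n else 0) sums cosh x" by (rule cosh_converges)
  moreover have "strict_mono (\<lambda>k::nat. 2 * k)" by (simp add: strict_mono_def)
  ultimately have "(\<lambda>k. (if even (2 * k) then x ^ (2 * k) /\<^sub>R fact (2 * k) else 0)) sums cosh x"
    by (subst (asm) sums_mono_reindex[symmetric, of "\<lambda>k. 2 * k"]) (auto elim!: evenE)
  then have "(\<lambda>k. x ^ (2 * k) / fact (2 * k)) sums cosh x" by (simp add: divide_inverse mult.commute)
  then have "(\<lambda>k. x ^ (2 * Suc k) / fact (2 * Suc k)) sums (cosh x - x ^ (2 * 0) / fact (2 * 0))"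
    by (subst sums_Suc_iff)  simp
  then show ?thesis by simp
qed

text \<open>\<open>2 * pi * h * ball_series h\<close> is the volume of the ball of radius \<open>h\<close>.\<close>

definition ball_series :: "real \<Rightarrow> real" where
  "ball_series h = (\<Sum>k. wallis (Suc k) * (h ^ (2 * k + 2) / fact (2 * k + 2)))"

lemma ball_series_sums:
  "(\<lambda>k. wallis (Suc k) * (h ^ (2 * k + 2) / fact (2 * k + 2))) sums ball_series h"
proof -
  have "summable (\<lambda>k. wallis (Suc k) * (h ^ (2 * k + 2) / fact (2 * k + 2)))"
  proof (rule summable_comparison_test')
    show "summable (\<lambda>k. 2 * (h ^ (2 * k + 2) / fact (2 * k + 2)))"
      by (intro summable_mult sums_summable[OF cosh_minus_1_sums])
    fix k :: nat
    define c where "c = h ^ (2 * k + 2) / fact (2 * k + 2)"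
    have "0 \<le> c" unfolding c_def by (intro divide_nonneg_pos zero_le_even_power) auto
    moreover have "wallis (Suc k) \<le> 2" using wallis_antimono[of 0 "Suc k"] by simp
    ultimately have "norm (wallis (Suc k) * c) \<le> 2 * c"
      using wallis_pos[of "Suc k"] by (simp add: mult_right_mono del: wallis.simps)
    then show "norm (wallis (Suc k) * (h ^ (2 * k + 2) / fact (2 * k + 2))) \<le> 2 * (h ^ (2 * k + 2) / fact (2 * k + 2))"
      unfolding c_def .
  qed
  then show ?thesis unfolding ball_series_def by (rule summable_sums)
qed

text \<open>The slice of the ball at height \<open>t\<close> is a hyperbolic disc of radius
  \<open>sqrt (\<rho>\<^sup>2 - t\<^sup>2)\<close>, whose area is the integrand. Only even powers
  occur in the series of cosh, so the root disappears, and nonnegative terms may be integrated one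
  by one.\<close>

lemma ball_integral:
  assumes "0 \<le> \<rho>"
  shows "(\<integral>\<^sup>+t. ennreal (2 * pi * (cosh (sqrt (\<rho>\<^sup>2 - t\<^sup>2)) - 1)) * indicator {-\<rho>..\<rho>} t \<partial>lborel) =
    ennreal (2 * pi * \<rho> * ball_series \<rho>)"
proof -
  define f where "f k t = 2 * pi * ((\<rho>\<^sup>2 - t\<^sup>2) ^ Suc k / fact (2 * k + 2))" for k :: nat and t
  have f_nonneg: "0 \<le> f k t" if "t \<in> {-\<rho>..\<rho>}" for k t
  proof -
    have "t\<^sup>2 \<le> \<rho>\<^sup>2" using that by (intro abs_le_square_iff[THEN iffD1]) auto
    then show ?thesis by (simp add: f_def)
  qed
  have sums: "(\<lambda>k. f k t) sums (2 * pi * (cosh (sqrt (\<rho>\<^sup>2 - t\<^sup>2)) - 1))" if "t \<in> {-\<rho>..\<rho>}" for t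
  proof -
    have "t\<^sup>2 \<le> \<rho>\<^sup>2" using that by (intro abs_le_square_iff[THEN iffD1]) auto
    then have "sqrt (\<rho>\<^sup>2 - t\<^sup>2) ^ (2 * k + 2) = (\<rho>\<^sup>2 - t\<^sup>2) ^ Suc k" for k
      by (metis (no_types, lifting) add_2_eq_Suc' diff_ge_0_iff_ge mult_Suc_right power_mult real_sqrt_pow2 add.commute)
    then show ?thesis
      using sums_mult[OF cosh_minus_1_sums[of "sqrt (\<rho>\<^sup>2 - t\<^sup>2)"], of "2 * pi"] by (simp only: f_def)
  qed
  have int: "(\<integral>\<^sup>+t. ennreal (f k t) * indicator {-\<rho>..\<rho>} t \<partial>lborel) =
      ennreal (2 * pi * \<rho> * (wallis (Suc k) * (\<rho> ^ (2 * k + 2) / fact (2 * k + 2))))" for k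
  proof (rule nn_integral_has_integral_lebesgue'[OF f_nonneg])
    have "((\<lambda>t. 2 * pi / fact (2 * k + 2) * (\<rho>\<^sup>2 - t\<^sup>2) ^ Suc k) has_integral
        2 * pi / fact (2 * k + 2) * (wallis (Suc k) * \<rho> ^ (2 * Suc k + 1))) {-\<rho>..\<rho>}"
      by (intro has_integral_mult_right wallis_integral assms)
    then show "(f k has_integral 2 * pi * \<rho> * (wallis (Suc k) * (\<rho> ^ (2 * k + 2) / fact (2 * k + 2)))) {-\<rho>..\<rho>}"
      unfolding f_def[abs_def] by (simp add: mult_ac del: wallis.simps fact_Suc)
  qed
  have "(\<integral>\<^sup>+t. ennreal (2 * pi * (cosh (sqrt (\<rho>\<^sup>2 - t\<^sup>2)) - 1)) * indicator {-\<rho>..\<rho>} t \<partial>lborel) =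
      (\<integral>\<^sup>+t. (\<Sum>k. ennreal (f k t) * indicator {-\<rho>..\<rho>} t) \<partial>lborel)"
  proof (rule nn_integral_cong)
    fix t
    show "ennreal (2 * pi * (cosh (sqrt (\<rho>\<^sup>2 - t\<^sup>2)) - 1)) * indicator {-\<rho>..\<rho>} t =
      (\<Sum>k. ennreal (f k t) * indicator {-\<rho>..\<rho>} t)"
    proof (cases "t \<in> {-\<rho>..\<rho>}")
      case True
      then show ?thesis
        using suminf_ennreal_eq[OF f_nonneg[OF True] sums[OF True]] by simp
    qed simp
  qed
  also have "\<dots> = (\<Sum>k. \<integral>\<^sup>+t. ennreal (f k t) * indicator {-\<rho>..\<rho>} t \<partial>lborel)"
    by (rule nn_integral_suminf) (simp add: f_def)
  also have "\<dots> = (\<Sum>k. ennreal (2 * pi * \<rho> * (wallis (Suc k) * (\<rho> ^ (2 * k + 2) / fact (2 * k + 2)))))"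
    by (simp only: int)
  also have "\<dots> = ennreal (2 * pi * \<rho> * ball_series \<rho>)"
    using assms wallis_pos by (intro suminf_ennreal_eq sums_mult ball_series_sums)
      (auto intro!: mult_nonneg_nonneg divide_nonneg_pos simp: less_imp_le simp del: wallis.simps)
  finally show ?thesis .
qed

section \<open>Estimates for the ball volume\<close>

lemma ball_series_mono:
  assumes "0 \<le> x" "x \<le> y"
  shows "ball_series x \<le> ball_series y"
  using assms wallis_pos
  by (intro sums_le[OF _ ball_series_sums ball_series_sums] mult_left_mono divide_right_mono power_mono)
    (auto simp: less_imp_le simp del: wallis.simps)

lemma ball_series_nonneg: "0 \<le> h \<Longrightarrow> 0 \<le> ball_series h"
  using ball_series_mono[of 0 h] by (simp add: ball_series_def)

lemma wallis_values:
  "wallis 1 = 4 / 3" "wallis 2 = 16 / 15" "wallis 3 = 32 / 35" "wallis 4 = 256 / 315" "wallis 5 = 512 / 693"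
  by (simp_all add: eval_nat_numeral)

text \<open>Comparing power series coefficients, \<open>\<kappa> * (cosh h - 1) - ball_series h\<close> can only be negative
  through its first few terms.\<close>

lemma ball_series_le_cosh:
  assumes \<kappa>: "512 / 693 \<le> \<kappa>"
    and a: "(4 / 3 - \<kappa>) * h\<^sup>2 / 2 - (\<kappa> - 16 / 15) * (h\<^sup>2)\<^sup>2 / 24 - (\<kappa> - 32 / 35) * (h\<^sup>2) ^ 3 / 720
      - (\<kappa> - 256 / 315) * (h\<^sup>2) ^ 4 / 40320 \<le> a"
  shows "ball_series h \<le> \<kappa> * (cosh h - 1) + a"
proof -
  define c where "c k = h ^ (2 * k + 2) / fact (2 * k + 2)" for k
  have c0: "c k \<ge> 0" for k unfolding c_def by (intro divide_nonneg_pos zero_le_even_power) auto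
  have s: "(\<lambda>k. (wallis (Suc k) - \<kappa>) * c k) sums (ball_series h - \<kappa> * (cosh h - 1))"
    using sums_diff[OF ball_series_sums[of h] sums_mult[OF cosh_minus_1_sums[of h], of \<kappa>]]
    by (simp only: c_def left_diff_distrib)
  have "ball_series h - \<kappa> * (cosh h - 1) = (\<Sum>k<4. (wallis (Suc k) - \<kappa>) * c k) + (\<Sum>k. (wallis (Suc (k + 4)) - \<kappa>) * c (k + 4))"
    using suminf_split_initial_segment[OF sums_summable[OF s], of 4] sums_unique[OF s] by simp
  also have "(\<Sum>k. (wallis (Suc (k + 4)) - \<kappa>) * c (k + 4)) \<le> 0"
  proof (rule suminf_le_const)
    show "summable (\<lambda>k. (wallis (Suc (k + 4)) - \<kappa>) * c (k + 4))"
      using summable_iff_shift[of "\<lambda>k. (wallis (Suc k) - \<kappa>) * c k" 4] sums_summable[OF s] by simp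
    fix n
    \<comment> \<open>The tail begins with \<open>wallis 5 = 512 / 693\<close>, which is the
      threshold assumed for \<open>\<kappa>\<close>.\<close>
    have "wallis (Suc (k + 4)) \<le> \<kappa>" for k
      using wallis_antimono[of 5 "Suc (k + 4)"] wallis_values(5) \<kappa> by linarith
    then show "(\<Sum>k<n. (wallis (Suc (k + 4)) - \<kappa>) * c (k + 4)) \<le> 0"
      using c0 by (intro sum_nonpos mult_nonpos_nonneg) (auto simp del: wallis.simps)
  qed
  also have "(\<Sum>k<4. (wallis (Suc k) - \<kappa>) * c k) + 0 =
    (4 / 3 - \<kappa>) * h\<^sup>2 / 2 - (\<kappa> - 16 / 15) * (h\<^sup>2)\<^sup>2 / 24 - (\<kappa> - 32 / 35) * (h\<^sup>2) ^ 3 / 720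
      - (\<kappa> - 256 / 315) * (h\<^sup>2) ^ 4 / 40320"
  proof -
    have c: "c 0 = h\<^sup>2 / 2" "c 1 = (h\<^sup>2)\<^sup>2 / 24" "c 2 = (h\<^sup>2) ^ 3 / 720"
      "c 3 = (h\<^sup>2) ^ 4 / 40320"
      by (simp_all add: c_def power2_eq_square power3_eq_cube eval_nat_numeral)
    have eq: "(\<Sum>k<4. (wallis (Suc k) - \<kappa>) * c k) =
        (4 / 3 - \<kappa>) * c 0 + (16 / 15 - \<kappa>) * c 1 + (32 / 35 - \<kappa>) * c 2 + (256 / 315 - \<kappa>) * c 3"
      by (simp add: eval_nat_numeral)
    show ?thesis unfolding eq c by (simp add: field_simps)
  qed
  finally show ?thesis using a by linarith
qed

text \<open>For \<open>\<kappa>\<close> at least \<open>wallis 2 = 16 / 15\<close> the polynomial in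
  \<open>ball_series_le_cosh\<close> is concave in \<open>h\<^sup>2\<close> and lies below its
  tangent at \<open>y\<close>. By \<open>slope\<close> this tangent does not increase, so its value
  at 0, which \<open>a\<close> bounds, is an upper bound. Little is lost when \<open>y\<close> is
  close to the squared radius and the slope to 0.\<close>

lemma ball_series_le_tangent:
  assumes \<kappa>: "16 / 15 \<le> \<kappa>" and y: "0 \<le> y"
    and slope: "(4 / 3 - \<kappa>) / 2 - (\<kappa> - 16 / 15) * y / 12 - (\<kappa> - 32 / 35) * y\<^sup>2 / 240
      - (\<kappa> - 256 / 315) * y ^ 3 / 10080 \<le> 0"
    and a: "(\<kappa> - 16 / 15) * y\<^sup>2 / 24 + (\<kappa> - 32 / 35) * y ^ 3 / 360 + (\<kappa> - 256 / 315) * y ^ 4 / 13440 \<le> a"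
  shows "ball_series h \<le> \<kappa> * (cosh h - 1) + a"
proof (rule ball_series_le_cosh)
  show "512 / 693 \<le> \<kappa>" using \<kappa> by simp
  define x where "x = h\<^sup>2"
  define B C D where "B = (\<kappa> - 16 / 15) / 24" and "C = (\<kappa> - 32 / 35) / 720" and "D = (\<kappa> - 256 / 315) / 40320"
  have BCD: "0 \<le> B" "0 \<le> C" "0 \<le> D" using \<kappa> by (auto simp: B_def C_def D_def)
  have x: "0 \<le> x" by (simp add: x_def)
  \<comment> \<open>The exact distance between the convex part of the polynomial and its tangent at
    \<open>y\<close>, with the double zero factored out.\<close>
  have "0 \<le> (x - y)\<^sup>2 * (B + C * (x + 2 * y) + D * ((x + y)\<^sup>2 + 2 * y\<^sup>2))"
    using BCD x y by (intro mult_nonneg_nonneg add_nonneg_nonneg) auto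
  also have "\<dots> = B * x\<^sup>2 + C * x ^ 3 + D * x ^ 4 - (B * 2 * y + C * 3 * y\<^sup>2 + D * 4 * y ^ 3) * x
      + (B * y\<^sup>2 + C * 2 * y ^ 3 + D * 3 * y ^ 4)"
    by (simp add: algebra_simps power2_eq_square power3_eq_cube power4_eq_xxxx)
  finally have 1: "(B * 2 * y + C * 3 * y\<^sup>2 + D * 4 * y ^ 3) * x - (B * x\<^sup>2 + C * x ^ 3 + D * x ^ 4)
      \<le> B * y\<^sup>2 + C * 2 * y ^ 3 + D * 3 * y ^ 4" by simp
  have "(4 / 3 - \<kappa>) / 2 \<le> B * 2 * y + C * 3 * y\<^sup>2 + D * 4 * y ^ 3"
  proof -
    have "B * 2 * y = (\<kappa> - 16 / 15) * y / 12" "C * 3 * y\<^sup>2 = (\<kappa> - 32 / 35) * y\<^sup>2 / 240"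
      "D * 4 * y ^ 3 = (\<kappa> - 256 / 315) * y ^ 3 / 10080"
      by (simp_all add: B_def C_def D_def)
    then show ?thesis using slope by linarith
  qed
  from mult_right_mono[OF this x]
  have "(4 / 3 - \<kappa>) / 2 * x - (B * x\<^sup>2 + C * x ^ 3 + D * x ^ 4) \<le> B * y\<^sup>2 + C * 2 * y ^ 3 + D * 3 * y ^ 4"
    using 1 by linarith
  also have "\<dots> \<le> a"
  proof -
    have "B * y\<^sup>2 = (\<kappa> - 16 / 15) * y\<^sup>2 / 24" "C * 2 * y ^ 3 = (\<kappa> - 32 / 35) * y ^ 3 / 360"
      "D * 3 * y ^ 4 = (\<kappa> - 256 / 315) * y ^ 4 / 13440"
      by (simp_all add: B_def C_def D_def)
    then show ?thesis using a by linarith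
  qed
  finally show "(4 / 3 - \<kappa>) * h\<^sup>2 / 2 - (\<kappa> - 16 / 15) * (h\<^sup>2)\<^sup>2 / 24 - (\<kappa> - 32 / 35) * (h\<^sup>2) ^ 3 / 720
      - (\<kappa> - 256 / 315) * (h\<^sup>2) ^ 4 / 40320 \<le> a"
    unfolding x_def[symmetric] B_def C_def D_def by (simp add: algebra_simps)
qed

lemma ball_series_le: "ball_series h \<le> 4 / 3 * (cosh h - 1)"
  using ball_series_le_tangent[of "4 / 3" 0 0 h] by simp

lemma ball_series_ge:
  "2 / 3 * h\<^sup>2 + 2 / 45 * (h\<^sup>2)\<^sup>2 + 4 / 3150 * (h\<^sup>2) ^ 3 + 256 / 315 / 40320 * (h\<^sup>2) ^ 4 \<le> ball_series h"
proof -
  have "(\<Sum>k<4. wallis (Suc k) * (h ^ (2 * k + 2) / fact (2 * k + 2))) \<le> ball_series h"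
    unfolding ball_series_def using wallis_pos
    by (intro sum_le_suminf sums_summable[OF ball_series_sums] mult_nonneg_nonneg divide_nonneg_pos zero_le_even_power)
      (auto simp: less_imp_le simp del: wallis.simps)
  moreover have "(\<Sum>k<4. wallis (Suc k) * (h ^ (2 * k + 2) / fact (2 * k + 2))) =
    2 / 3 * h\<^sup>2 + 2 / 45 * (h\<^sup>2)\<^sup>2 + 4 / 3150 * (h\<^sup>2) ^ 3 + 256 / 315 / 40320 * (h\<^sup>2) ^ 4"
    by (simp add: eval_nat_numeral)
  ultimately show ?thesis by simp
qed

section \<open>Dirichlet cells\<close>

instance vertex :: countable
  by countable_datatype

lemma lift_measurable [measurable]: "lift \<in> borel_measurable borel"
  unfolding lift_def[abs_def] by measurable

lemma mform_measurable [measurable]: "(\<lambda>x. mform v x) \<in> borel_measurable borel"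
  unfolding mform_def by (intro borel_measurable_continuous_onI continuous_intros)

text \<open>Rotations and reflections about the origin are treated together, because the orientation
  of the triangle is not known.\<close>

lemma linear_isometry:
  assumes e: "cmod e = 1" and L: "L = (\<lambda>z. e * z) \<or> L = (\<lambda>z. e * cnj z)"
  shows "L z \<bullet> L w = z \<bullet> w" "cmod (L z) = cmod z" "L (c *\<^sub>R z) = c *\<^sub>R L z"
    "lift (L z) = (L (fst (lift z)), snd (lift z))"
    "- (L u)\<^sup>2 * cnj (L z) = L (- u\<^sup>2 * cnj z)"
    "\<exists>x. L x = z"
    "S \<in> sets borel \<Longrightarrow> emeasure hyp_area {z \<in> hyp_plane. L z \<in> S} = emeasure hyp_area S"
proof -
  have ee: "e * cnj e = 1" "cnj e * e = 1" using complex_norm_square[of e] e by (simp_all add: mult.commute)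
  then have e0: "e \<noteq> 0" by auto
  have n: "cmod (L z) = cmod z" for z using L e by (auto simp: norm_mult)
  have s: "L (c *\<^sub>R z) = c *\<^sub>R L z" for c z using L by auto
  have ip: "x \<bullet> y = Re (x * cnj y)" for x y by (simp add: inner_complex_def)
  have "L z * cnj (L w) = z * cnj w \<or> L z * cnj (L w) = cnj (z * cnj w)"
    using L
  proof
    assume "L = (\<lambda>z. e * z)"
    then have "L z * cnj (L w) = (e * cnj e) * (z * cnj w)" by simp
    then show ?thesis using ee by simp
  next
    assume "L = (\<lambda>z. e * cnj z)"
    then have "L z * cnj (L w) = (e * cnj e) * (cnj z * w)" by simp
    then show ?thesis using ee by simp
  qed
  then show "L z \<bullet> L w = z \<bullet> w" unfolding ip by (metis complex_cnj_cnj complex_cnj_mult cnj.simps(1))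
  show "cmod (L z) = cmod z" "L (c *\<^sub>R z) = c *\<^sub>R L z" by (rule n, rule s)
  show "lift (L z) = (L (fst (lift z)), snd (lift z))" by (simp add: lift_def n s)
  show "- (L u)\<^sup>2 * cnj (L z) = L (- u\<^sup>2 * cnj z)"
    using L
  proof
    assume "L = (\<lambda>z. e * z)"
    then have "- (L u)\<^sup>2 * cnj (L z) = (e * cnj e) * (e * (- u\<^sup>2 * cnj z))"
      by (simp add: power2_eq_square mult_ac)
    then show ?thesis using ee \<open>L = _\<close> by simp
  next
    assume "L = (\<lambda>z. e * cnj z)"
    then have "- (L u)\<^sup>2 * cnj (L z) = (e * cnj e) * (e * cnj (- u\<^sup>2 * cnj z))"
      by (simp add: power2_eq_square mult_ac)
    then show ?thesis using ee \<open>L = _\<close> by simp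
  qed
  show "\<exists>x. L x = z"
    using L
  proof
    assume "L = (\<lambda>z. e * z)"
    then show ?thesis using e0 by (intro exI[of _ "z / e"]) simp
  next
    assume "L = (\<lambda>z. e * cnj z)"
    then show ?thesis using e0 by (intro exI[of _ "cnj (z / e)"]) simp
  qed
  show "S \<in> sets borel \<Longrightarrow> emeasure hyp_area {z \<in> hyp_plane. L z \<in> S} = emeasure hyp_area S"
    using L emeasure_hyp_area_rotate[OF e] emeasure_hyp_area_reflect[OF e] by auto
qed

section \<open>The cell of a vertex in the plane\<close>

context rotation_group
begin

definition cell :: "vertex \<Rightarrow> complex set" where
  "cell j = {x \<in> hyp_plane. \<forall>g\<in>G. hyp_dist (p j) x \<le> hyp_dist (g (p j)) x}"

definition triangle :: "complex set" where
  "triangle = {x \<in> hyp_plane. lift x \<in> chamber}"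

lemma cell_iff: "x \<in> cell j \<longleftrightarrow>
  x \<in> hyp_plane \<and> (\<forall>ws. mform (W ws (lift (p j))) (lift x) \<le> mform (lift (p j)) (lift x))"
proof (cases "x \<in> hyp_plane")
  case True
  have "x \<in> cell j \<longleftrightarrow> (\<forall>g\<in>G. mform (lift (g (p j))) (lift x) \<le> mform (lift (p j)) (lift x))"
    using hyp_dist_le_iff[OF p_plane True G_in_plane[OF _ p_plane] True] True by (simp add: cell_def)
  also have "\<dots> \<longleftrightarrow> (\<forall>y\<in>{lift (g (p j)) | g. g \<in> G}. mform y (lift x) \<le> mform (lift (p j)) (lift x))"
    by blast
  also have "\<dots> \<longleftrightarrow> (\<forall>ws. mform (W ws (lift (p j))) (lift x) \<le> mform (lift (p j)) (lift x))"
    unfolding orbit_eq by blast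
  finally show ?thesis using True by simp
qed (simp add: cell_def)

text \<open>A reflection in a side through \<open>p j\<close> fixes this vertex and permutes its
  orbit. Reflections are not elements of \<open>G\<close>; describing the cell by all words, as in
  \<open>cell_iff\<close>, makes them available.\<close>

lemma cell_reflect:
  assumes "x \<in> cell j" "y \<in> hyp_plane" "lift y = W [i] (lift x)" "i \<noteq> j"
  shows "y \<in> cell j"
proof -
  have "mform (W ws (lift (p j))) (lift y) \<le> mform (lift (p j)) (lift y)" for ws
  proof -
    have "mform (W ws (lift (p j))) (lift y) = mform (W (i # ws) (lift (p j))) (lift x)"
      unfolding assms(3) by (simp add: mrefl_adjoint)
    also have "\<dots> \<le> mform (lift (p j)) (lift x)" using assms(1) unfolding cell_iff by blast
    also have "\<dots> = mform (lift (p j)) (lift y)"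
      using W_isometry[of "[i]" "lift (p j)" "lift x"] unfolding W_fixes_vertex[OF assms(4)] assms(3) by simp
    finally show ?thesis .
  qed
  then show ?thesis using assms(2) by (simp add: cell_iff)
qed

lemma triangle_subset_cell: "triangle \<subseteq> cell j"
proof
  fix x assume "x \<in> triangle"
  then have "x \<in> hyp_plane" "lift x \<in> chamber" by (auto simp: triangle_def)
  then show "x \<in> cell j" unfolding cell_iff using chamber_closest[OF _ P_chamber] by (metis mform_commute)
qed

text \<open>Comparison with a single orbit point, the mirror image of \<open>p j\<close> in the
  opposite side, already yields the remaining inequality.\<close>

lemma cell_in_triangle:
  assumes x: "x \<in> cell j" and s: "\<And>i. i \<noteq> j \<Longrightarrow> 0 \<le> mform (lift x) (\<alpha> i)"
  shows "x \<in> triangle"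
proof -
  have "mform (W [j] (lift (p j))) (lift x) \<le> mform (lift (p j)) (lift x)"
    using x unfolding cell_iff by blast
  then have "0 \<le> h j * mform (lift x) (\<alpha> j)"
    by (simp add: mrefl_def mform_commute[of _ "\<alpha> j"] dual)
  then have "0 \<le> mform (lift x) (\<alpha> j)" using h_pos[of j] by (simp add: zero_le_mult_iff)
  then have "0 \<le> mform (lift x) (\<alpha> i)" for i using s by (cases "i = j") auto
  then show ?thesis using x by (simp add: triangle_def chamber_def cell_def)
qed

lemma cell_borel: "cell j \<in> sets borel"
proof -
  have [measurable]: "hyp_plane \<in> sets borel" by simp
  have "cell j = hyp_plane \<inter> (\<Inter>ws. {x. mform (W ws (lift (p j))) (lift x) \<le> mform (lift (p j)) (lift x)})"
    using cell_iff by auto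
  also have "\<dots> \<in> sets borel"
    by (intro sets.Int sets.countable_INT' borel_open) (auto intro!: borel_measurable_le)
  finally show ?thesis .
qed

lemma triangle_borel: "triangle \<in> sets borel"
proof -
  have "triangle = hyp_plane \<inter> (\<Inter>i. {x. 0 \<le> mform (\<alpha> i) (lift x)})"
    by (auto simp: triangle_def chamber_def mform_commute)
  also have "\<dots> \<in> sets borel"
    by (intro sets.Int sets.countable_INT' borel_open) (auto intro!: borel_measurable_le)
  finally show ?thesis .
qed

text \<open>Coordinates that move \<open>p j\<close> to the origin and the two sides of the triangle at \<open>p j\<close> to the
  rays with arguments \<open>0\<close> and \<open>\<beta>\<close>.\<close>

lemma normal_form:
  assumes ijk: "i \<noteq> j" "k \<noteq> j" "i \<noteq> k" and \<beta>: "\<beta> = pi / m i k"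
  obtains e L where "cmod e = 1" "L = (\<lambda>z. e * z) \<or> L = (\<lambda>z. e * cnj z)"
    "boost (p j) (\<alpha> k) = (L \<i>, 0)" "boost (p j) (\<alpha> i) = (L (cis (\<beta> - pi / 2)), 0)"
proof -
  define \<eta> \<kappa> where "\<eta> = fst (boost (p j) (\<alpha> i))" and "\<kappa> = fst (boost (p j) (\<alpha> k))"
  have o: "mform (\<alpha> i) (lift (p j)) = 0" "mform (\<alpha> k) (lift (p j)) = 0" using dual ijk by auto
  note A = boost_refl[OF p_plane unit o(1), folded \<eta>_def] and B = boost_refl[OF p_plane unit o(2), folded \<kappa>_def]
  have kk: "cnj \<kappa> * \<kappa> = 1" using complex_norm_square[of \<kappa>] B(1) by (simp add: mult.commute)
  define \<epsilon> where "\<epsilon> = \<eta> * cnj \<kappa>"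
  have \<eta>: "\<eta> = \<epsilon> * \<kappa>" using kk by (simp add: \<epsilon>_def mult.assoc)
  have re: "Re \<epsilon> = - cos \<beta>"
    using boost_isometry[OF p_plane, of j "\<alpha> i" "\<alpha> k"] gram[OF ijk(3)]
    by (simp add: A(2) B(2) mform_def \<epsilon>_def inner_complex_def \<beta>)
  have "cmod \<epsilon> = 1" by (simp add: \<epsilon>_def norm_mult A(1) B(1))
  then have "(Re \<epsilon>)\<^sup>2 + (Im \<epsilon>)\<^sup>2 = 1" by (metis cmod_power2 one_power2)
  then have "(Im \<epsilon>)\<^sup>2 = (sin \<beta>)\<^sup>2" using re sin_cos_squared_add[of \<beta>] by (metis add_diff_cancel_left' add.commute power2_minus)
  then consider "Im \<epsilon> = - sin \<beta>" | "Im \<epsilon> = sin \<beta>" by (auto simp: power2_eq_iff)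
  then show thesis
  proof cases
    case 1
    have "\<epsilon> = - \<i> * cis (\<beta> - pi / 2)" using re 1
      by (simp add: complex_eq_iff cos_diff sin_diff)
    then have "(- \<i> * \<kappa>) * cis (\<beta> - pi / 2) = \<eta>" unfolding \<eta> by (simp add: mult_ac)
    moreover have "(- \<i> * \<kappa>) * \<i> = \<kappa>" by (simp add: complex_eq_iff)
    ultimately show thesis using that[of "- \<i> * \<kappa>" "\<lambda>z. (- \<i> * \<kappa>) * z"] A(2) B(1,2) by (simp add: norm_mult)
  next
    case 2
    have "\<epsilon> = \<i> * cnj (cis (\<beta> - pi / 2))" using re 2
      by (simp add: complex_eq_iff cos_diff sin_diff)
    then have "(\<i> * \<kappa>) * cnj (cis (\<beta> - pi / 2)) = \<eta>" unfolding \<eta> by (simp add: mult_ac)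
    moreover have "(\<i> * \<kappa>) * cnj \<i> = \<kappa>" by (simp add: complex_eq_iff)
    ultimately show thesis using that[of "\<i> * \<kappa>" "\<lambda>z. (\<i> * \<kappa>) * cnj z"] A(2) B(1,2) by (simp add: norm_mult)
  qed
qed

text \<open>In the coordinates \<open>\<psi>\<close> the cell is invariant under the reflections in
  both bounding rays, so \<open>emeasure_dihedral\<close> applies. Inside the sector cell and
  triangle coincide, and outside it only a null part of the triangle remains.\<close>

lemma cell_triangle_polar:
  assumes ijk: "i \<noteq> j" "k \<noteq> j" "i \<noteq> k" and \<beta>: "\<beta> = pi / m i k"
    and e: "cmod e = 1" and L: "L = (\<lambda>z. e * z) \<or> L = (\<lambda>z. e * cnj z)"
    and bk: "boost (p j) (\<alpha> k) = (L \<i>, 0)" and bi: "boost (p j) (\<alpha> i) = (L (cis (\<beta> - pi / 2)), 0)"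
  defines "\<psi> \<equiv> \<lambda>z. Moebius_function 0 (- p j) (L z)"
  shows "z \<in> hyp_plane \<Longrightarrow> \<psi> z \<in> hyp_plane"
    and "z \<in> hyp_plane \<Longrightarrow> boost (p j) (lift (\<psi> z)) = (L (fst (lift z)), snd (lift z))"
    and "emeasure hyp_area (cell j) = of_nat (2 * m i k) * emeasure hyp_area triangle"
    and "emeasure hyp_area triangle = emeasure hyp_area ({z \<in> hyp_plane. \<psi> z \<in> triangle} \<inter> sector 0 \<beta>)"
    and "z \<in> hyp_plane \<Longrightarrow> z \<in> sector 0 \<beta> \<Longrightarrow> \<psi> z \<in> triangle \<longleftrightarrow> 0 \<le> mform (lift (\<psi> z)) (\<alpha> j)"
proof -
  note LL = linear_isometry[OF e L]
  have mp: "- p j \<in> hyp_plane" using p_plane[of j] by simp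
  have Lp: "L z \<in> hyp_plane" if "z \<in> hyp_plane" for z using that by (simp add: LL)
  have \<psi>p: "\<psi> z \<in> hyp_plane" if "z \<in> hyp_plane" for z
    unfolding \<psi>_def using Moebius_in_plane[OF mp Lp[OF that]] .
  show "z \<in> hyp_plane \<Longrightarrow> \<psi> z \<in> hyp_plane" by (rule \<psi>p)
  have b\<psi>: "boost (p j) (lift (\<psi> z)) = (L (fst (lift z)), snd (lift z))" if z: "z \<in> hyp_plane" for z
  proof -
    have "boost (p j) (lift (\<psi> z)) = lift (Moebius_function 0 (p j) (\<psi> z))"
      by (rule boost_lift[OF p_plane \<psi>p[OF z]])
    also have "Moebius_function 0 (p j) (\<psi> z) = L z"
      unfolding \<psi>_def using Moebius_inverse[OF mp Lp[OF z]] by simp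
    finally show ?thesis by (simp only: LL(4))
  qed
  show "z \<in> hyp_plane \<Longrightarrow> boost (p j) (lift (\<psi> z)) = (L (fst (lift z)), snd (lift z))" by (rule b\<psi>)
  have area: "emeasure hyp_area {z \<in> hyp_plane. \<psi> z \<in> S} = emeasure hyp_area S"
    and area_borel: "{z \<in> hyp_plane. \<psi> z \<in> S} \<in> sets borel" if S: "S \<in> sets borel" for S
  proof -
    define S' where "S' = {w \<in> hyp_plane. Moebius_function 0 (- p j) w \<in> S}"
    have "(\<lambda>z. Moebius_function 0 (- p j) z) \<in> borel_measurable borel"
      unfolding Moebius_function_def by (intro borel_measurable_divide borel_measurable_continuous_onI continuous_intros)
    from measurable_sets[OF this S] have "hyp_plane \<inter> (Moebius_function 0 (- p j) -` S \<inter> space borel) \<in> sets borel"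
      by (intro sets.Int) auto
    then have S': "S' \<in> sets borel" by (simp add: S'_def Int_def vimage_def)
    have eq: "{z \<in> hyp_plane. \<psi> z \<in> S} = {z \<in> hyp_plane. L z \<in> S'}"
      using Lp by (auto simp: S'_def \<psi>_def)
    show "emeasure hyp_area {z \<in> hyp_plane. \<psi> z \<in> S} = emeasure hyp_area S"
      unfolding eq using LL(7)[OF S'] emeasure_hyp_area_Moebius[OF mp S] by (simp add: S'_def)
    have "L \<in> borel_measurable borel"
      using L by (auto intro!: borel_measurable_continuous_onI continuous_intros)
    from measurable_sets[OF this S'] have "hyp_plane \<inter> (L -` S' \<inter> space borel) \<in> sets borel"
      by (intro sets.Int) auto
    then show "{z \<in> hyp_plane. \<psi> z \<in> S} \<in> sets borel" unfolding eq by (simp add: Int_def vimage_def)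
  qed
  define E where "E = {z \<in> hyp_plane. \<psi> z \<in> cell j}"
  define T where "T = {z \<in> hyp_plane. \<psi> z \<in> triangle}"
  \<comment> \<open>In these coordinates the reflection in a side through \<open>p j\<close> is the
    Euclidean reflection in the diameter with normal \<open>u\<close>; \<open>L\<close> is
    compatible with this by \<open>linear_isometry\<close>.\<close>
  have refl: "- u\<^sup>2 * cnj z \<in> E" if u: "cmod u = 1" "boost (p j) (\<alpha> l) = (L u, 0)" "l \<noteq> j" and z: "z \<in> E" for u l z
  proof -
    have zp: "z \<in> hyp_plane" and zc: "\<psi> z \<in> cell j" using z by (auto simp: E_def)
    define w where "w = - u\<^sup>2 * cnj z"
    have wp: "w \<in> hyp_plane" using zp u(1) by (simp add: w_def norm_mult norm_power)
    have o: "mform (\<alpha> l) (lift (p j)) = 0" using dual u(3) by simp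
    have "boost (p j) (W [l] (lift (\<psi> z))) = (- (L u)\<^sup>2 * cnj (L (fst (lift z))), snd (lift z))"
      using boost_refl(3)[OF p_plane unit o, of "lift (\<psi> z)"] by (simp add: u(2) b\<psi>[OF zp])
    also have "- (L u)\<^sup>2 * cnj (L (fst (lift z))) = L (- u\<^sup>2 * cnj (fst (lift z)))" by (rule LL(5))
    also have "- u\<^sup>2 * cnj (fst (lift z)) = fst (lift w)"
      using u(1) by (simp add: lift_def w_def norm_mult norm_power)
    also have "snd (lift z) = snd (lift w)"
      using u(1) by (simp add: lift_def w_def norm_mult norm_power)
    finally have "boost (p j) (W [l] (lift (\<psi> z))) = boost (p j) (lift (\<psi> w))" by (simp add: b\<psi>[OF wp])
    then have "lift (\<psi> w) = W [l] (lift (\<psi> z))" using boost_inj[OF p_plane] by metis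
    then show ?thesis using cell_reflect[OF zc \<psi>p[OF wp] _ u(3)] wp by (simp add: E_def w_def)
  qed
  have inv: "cnj z \<in> E" "cis (2 * \<beta>) * cnj z \<in> E" if "z \<in> E" for z
  proof -
    show "cnj z \<in> E" using refl[OF _ bk ijk(2) that] by simp
    have "- (cis (\<beta> - pi / 2))\<^sup>2 = cis (2 * \<beta>)"
      by (simp add: power2_eq_square cis_mult complex_eq_iff cos_diff sin_diff algebra_simps)
    then show "cis (2 * \<beta>) * cnj z \<in> E" using refl[OF _ bi ijk(1) that] by simp
  qed
  have m2: "m i k \<ge> 2" using m_ge2[OF ijk(3)] .
  have "pi / real (m i k) \<le> pi / 2" using m2 by (intro divide_left_mono) auto
  then have \<beta>0: "0 < \<beta>" "\<beta> \<le> pi / 2" using m2 by (auto simp: \<beta>)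
  have fk: "mform (lift (\<psi> z)) (\<alpha> k) = 2 / (1 - (cmod z)\<^sup>2) * Im z" if "z \<in> hyp_plane" for z
    using boost_isometry[OF p_plane, of j "lift (\<psi> z)" "\<alpha> k"]
    by (simp add: b\<psi>[OF that] bk mform_def LL(1)) (simp add: lift_def inner_complex_def)
  have fi: "mform (lift (\<psi> z)) (\<alpha> i) = 2 / (1 - (cmod z)\<^sup>2) * (cis (\<beta> - pi / 2) \<bullet> z)" if "z \<in> hyp_plane" for z
    using boost_isometry[OF p_plane, of j "lift (\<psi> z)" "\<alpha> i"]
    by (simp add: b\<psi>[OF that] bi mform_def LL(1)) (simp add: lift_def inner_commute)
  have rot: "cis (\<beta> - pi / 2) \<bullet> (of_real r * cis t) = r * sin (\<beta> - t)" for r t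
    by (simp add: inner_complex_def cos_diff sin_diff algebra_simps)
  have in_sector: "0 \<le> mform (lift (\<psi> z)) (\<alpha> l)" if z: "z \<in> hyp_plane" "z \<in> sector 0 \<beta>" and l: "l \<noteq> j" for z l
  proof -
    obtain r t where rt: "z = of_real r * cis t" "0 < r" "0 < t" "t < \<beta>" using z(2) by (auto simp: sector_def)
    have "0 \<le> sin t" using rt \<beta>0 by (intro sin_ge_zero) auto
    then have 1: "0 \<le> Im z" using rt by simp
    have "0 \<le> sin (\<beta> - t)" using rt \<beta>0 by (intro sin_ge_zero) auto
    then have 2: "0 \<le> cis (\<beta> - pi / 2) \<bullet> z" using rt(2) unfolding rt(1) rot by simp
    have "l = i \<or> l = k" using ijk l by (cases i; cases j; cases k; cases l) simp_all
    then show ?thesis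
      using 1 2 hyp_plane_norm[OF z(1)] by (auto simp: fk[OF z(1)] fi[OF z(1)])
  qed
  have tri: "\<psi> z \<in> triangle \<longleftrightarrow> 0 \<le> mform (lift (\<psi> z)) (\<alpha> j)" if "z \<in> hyp_plane" "z \<in> sector 0 \<beta>" for z
  proof -
    have "(\<forall>l. 0 \<le> mform (lift (\<psi> z)) (\<alpha> l)) \<longleftrightarrow> 0 \<le> mform (lift (\<psi> z)) (\<alpha> j)"
      using in_sector[OF that] by metis
    then show ?thesis using \<psi>p[OF that(1)] by (simp add: triangle_def chamber_def)
  qed
  then show "z \<in> hyp_plane \<Longrightarrow> z \<in> sector 0 \<beta> \<Longrightarrow> \<psi> z \<in> triangle \<longleftrightarrow> 0 \<le> mform (lift (\<psi> z)) (\<alpha> j)" .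
  have ET: "E \<inter> sector 0 \<beta> = T \<inter> sector 0 \<beta>"
    using triangle_subset_cell[of j] cell_in_triangle[of _ j] in_sector by (auto simp: E_def T_def)
  have Tb: "T \<in> sets borel" unfolding T_def by (rule area_borel[OF triangle_borel])
  have sb: "sector 0 \<beta> \<in> sets borel" using \<beta>0 pi_gt_zero by (intro sector_borel) linarith
  have "emeasure hyp_area T = emeasure hyp_area (T \<inter> sector 0 \<beta>)"
  proof (rule emeasure_eq_AE)
    \<comment> \<open>The lines carrying the two sides; off them both inequalities are strict and
      force the argument into the open sector.\<close>
    define N where "N = {z. \<i> \<bullet> z = 0} \<union> {z. cis (\<beta> - pi / 2) \<bullet> z = 0}"
    have N: "N \<in> null_sets hyp_area" unfolding N_def by (intro null_sets.Un line_null) (auto simp: cis_neq_zero)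
    show "AE z in hyp_area. z \<in> T \<longleftrightarrow> z \<in> T \<inter> sector 0 \<beta>"
    proof (rule AE_mp[OF AE_not_in[OF N]], rule AE_I2, rule impI)
      fix z assume zN: "z \<notin> N"
      have "z \<in> sector 0 \<beta>" if zT: "z \<in> T"
      proof -
        have zp: "z \<in> hyp_plane" using zT by (simp add: T_def)
        have s: "0 < 2 / (1 - (cmod z)\<^sup>2)" using hyp_plane_norm[OF zp] by simp
        have "0 \<le> mform (lift (\<psi> z)) (\<alpha> l)" for l
          using zT by (auto simp: T_def triangle_def chamber_def)
        from this[of k] this[of i] have "0 \<le> Im z" "0 \<le> cis (\<beta> - pi / 2) \<bullet> z"
          unfolding fk[OF zp] fi[OF zp] using s by (simp_all only: zero_le_mult_iff) auto
        moreover have "Im z \<noteq> 0" "cis (\<beta> - pi / 2) \<bullet> z \<noteq> 0"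
          using zN by (auto simp: N_def inner_complex_def)
        ultimately have pos: "0 < Im z" "0 < cis (\<beta> - pi / 2) \<bullet> z" by auto
        then obtain r t where rt: "z = of_real r * cis t" "0 < r" "t \<in> {0<..<2*pi}"
          using polar_form[of z] by (metis complex.sel(2) less_irrefl zero_complex.sel(2))
        have st: "0 < sin t" using pos(1) rt(1,2) by (simp add: zero_less_mult_iff)
        have "t < pi"
        proof (rule ccontr)
          assume "\<not> t < pi"
          then have "sin t \<le> 0" using rt(3) sin_le_zero[of t] by auto
          then show False using st by simp
        qed
        moreover have "0 < sin (\<beta> - t)" using pos(2) rt(2) unfolding rt(1) rot by (simp add: zero_less_mult_iff)
        ultimately have "t < \<beta>"
          using sin_ge_zero[of "t - \<beta>"] \<beta>0 sin_minus[of "t - \<beta>"] by (cases "t < \<beta>") auto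
        then show ?thesis using rt unfolding sector_def by auto
      qed
      then show "z \<in> T \<longleftrightarrow> z \<in> T \<inter> sector 0 \<beta>" by blast
    qed
  qed (use Tb sb in auto)
  then show t: "emeasure hyp_area triangle = emeasure hyp_area ({z \<in> hyp_plane. \<psi> z \<in> triangle} \<inter> sector 0 \<beta>)"
    using area[OF triangle_borel] by (simp add: T_def)
  have "emeasure hyp_area (cell j) = emeasure hyp_area E" using area[OF cell_borel] by (simp add: E_def)
  also have "\<dots> = of_nat (2 * m i k) * emeasure hyp_area (E \<inter> sector 0 \<beta>)"
  proof (rule emeasure_dihedral[OF _ _ _ \<beta> inv])
    show "E \<in> sets borel" unfolding E_def by (rule area_borel[OF cell_borel])
    show "E \<subseteq> hyp_plane" by (auto simp: E_def)
  qed (use m2 in auto)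
  also have "E \<inter> sector 0 \<beta> = {z \<in> hyp_plane. \<psi> z \<in> triangle} \<inter> sector 0 \<beta>" unfolding ET T_def ..
  finally show "emeasure hyp_area (cell j) = of_nat (2 * m i k) * emeasure hyp_area triangle"
    unfolding t .
qed

lemma cell_area:
  assumes "i \<noteq> j" "k \<noteq> j" "i \<noteq> k"
  shows "emeasure hyp_area (cell j) = of_nat (2 * m i k) * emeasure hyp_area triangle"
proof -
  obtain e L where *: "cmod e = 1" "L = (\<lambda>z. e * z) \<or> L = (\<lambda>z. e * cnj z)"
    "boost (p j) (\<alpha> k) = (L \<i>, 0)" "boost (p j) (\<alpha> i) = (L (cis (pi / m i k - pi / 2)), 0)"
    using normal_form[OF assms refl] by metis
  show ?thesis by (rule cell_triangle_polar(3)[OF assms refl *])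
qed

end

text \<open>An antiderivative of the integrand is \<open>arcsin (c * sin t) - t\<close>. The
  integrand will be the area of the triangle per unit of angle at a vertex.\<close>

lemma nn_integral_triangle:
  fixes c \<beta> :: real
  assumes \<beta>: "0 < \<beta>" "\<beta> < pi / 2" and c: "0 < c" "c * sin \<beta> < 1"
    and nonneg: "\<And>t. t \<in> {0<..<\<beta>} \<Longrightarrow> 0 \<le> c * cos t / sqrt (1 - (c * sin t)\<^sup>2) - 1"
  shows "(\<integral>\<^sup>+t. ennreal (c * cos t / sqrt (1 - (c * sin t)\<^sup>2) - 1) * indicator {0<..<\<beta>} t \<partial>lborel) =
    ennreal (arcsin (c * sin \<beta>) - \<beta>)"
proof -
  let ?f = "\<lambda>t. c * cos t / sqrt (1 - (c * sin t)\<^sup>2) - 1"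
  let ?F = "\<lambda>t. arcsin (c * sin t) - t"
  have rng: "0 \<le> c * sin t \<and> c * sin t < 1" if "0 \<le> t" "t \<le> \<beta>" for t
  proof -
    have 1: "sin t \<le> sin \<beta>" using that \<beta> by (intro sin_monotone_2pi_le) auto
    have 2: "0 \<le> sin t" using that \<beta> by (intro sin_ge_zero) auto
    have "c * sin t \<le> c * sin \<beta>" "0 \<le> c * sin t" using 1 2 c(1) by (auto intro: mult_left_mono)
    then show ?thesis using c(2) by linarith
  qed
  have "(?f has_integral (?F \<beta> - ?F 0)) {0..\<beta>}"
  proof (rule fundamental_theorem_of_calculus)
    fix t assume t: "t \<in> {0..\<beta>}"
    have "-1 < c * sin t" "c * sin t < 1" using rng[of t] t by auto
    then have "(?F has_real_derivative ?f t) (at t within {0..\<beta>})"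
      by (auto intro!: derivative_eq_intros simp: divide_inverse)
    then show "(?F has_vector_derivative ?f t) (at t within {0..\<beta>})"
      by (simp add: has_real_derivative_iff_has_vector_derivative)
  qed (use \<beta> in simp)
  then have "(?f has_integral (arcsin (c * sin \<beta>) - \<beta>)) {0<..<\<beta>}"
    by (subst has_integral_Icc_iff_Ioo[symmetric]) simp
  from nn_integral_has_integral_lebesgue'[OF nonneg this] show ?thesis .
qed

text \<open>Polar coordinates at \<open>B\<close> with the leg \<open>AB\<close> on the ray of
  argument 0; the right angle makes the normal \<open>\<nu>\<close> of the opposite side real. At
  \<open>t = \<beta>\<close> the argument of the arcsine is \<open>cos \<gamma>\<close>, and this
  produces the angle defect.\<close>

lemma (in rotation_group) triangle_area:
  assumes right: "m VB VC = 2" and ang: "pi / m VA VC + pi / m VA VB < pi / 2"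
  shows "emeasure hyp_area triangle = ennreal (pi / 2 - pi / m VA VC - pi / m VA VB)"
proof -
  define \<beta> \<gamma> where "\<beta> = pi / m VA VC" and "\<gamma> = pi / m VA VB"
  have pos: "0 < \<beta>" "0 < \<gamma>" using m_ge2[of VA VC] m_ge2[of VA VB] by (auto simp: \<beta>_def \<gamma>_def)
  have \<beta>2: "\<beta> < pi / 2" "\<gamma> < pi / 2" using pos ang unfolding \<beta>_def \<gamma>_def by linarith+
  have ijk: "VA \<noteq> VB" "VC \<noteq> VB" "VA \<noteq> VC" by auto
  obtain e L where e: "cmod e = 1" and L: "L = (\<lambda>z. e * z) \<or> L = (\<lambda>z. e * cnj z)"
    and bk: "boost (p VB) (\<alpha> VC) = (L \<i>, 0)" and bi: "boost (p VB) (\<alpha> VA) = (L (cis (\<beta> - pi / 2)), 0)"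
    using normal_form[OF ijk \<beta>_def] by metis
  note CP = cell_triangle_polar[OF ijk \<beta>_def e L bk bi]
  note LL = linear_isometry[OF e L]
  define \<psi> where "\<psi> = (\<lambda>z. Moebius_function 0 (- p VB) (L z))"
  obtain \<nu> where \<nu>: "L \<nu> = fst (boost (p VB) (\<alpha> VB))" using LL(6) by blast
  have bj: "boost (p VB) (\<alpha> VB) = (L \<nu>, - h VB)"
    by (simp add: prod_eq_iff \<nu> snd_boost dual)
  define c where "c = - Re \<nu>"
  have "mform (L \<nu>, - h VB) (L \<i>, 0) = \<nu> \<bullet> \<i>" by (simp add: mform_def LL(1))
  then have "\<nu> \<bullet> \<i> = 0"
    using boost_isometry[OF p_plane, of VB "\<alpha> VB" "\<alpha> VC"] gram[of VB VC] by (simp add: bj bk right)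
  then have im: "Im \<nu> = 0" by (simp add: inner_complex_def)
  have cs: "c * sin \<beta> = cos \<gamma>"
  proof -
    have "\<nu> \<bullet> cis (\<beta> - pi / 2) = - cos \<gamma>"
      using boost_isometry[OF p_plane, of VB "\<alpha> VB" "\<alpha> VA"] gram[of VB VA] m_sym[of VA VB]
      by (simp add: bj bi mform_def LL(1) \<gamma>_def)
    then show ?thesis by (simp add: inner_complex_def im c_def cos_diff)
  qed
  have c2: "c\<^sup>2 = 1 + (h VB)\<^sup>2"
    using boost_isometry[OF p_plane, of VB "\<alpha> VB" "\<alpha> VB"] unit[of VB]
    by (simp add: bj mform_self LL(2) c_def cmod_power2 im)
  have sb: "0 < sin \<beta>" using pos \<beta>2 by (intro sin_gt_zero) auto
  have cg: "0 < cos \<gamma>" "cos \<gamma> < 1"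
    using pos \<beta>2 cos_gt_zero_pi[of \<gamma>] cos_monotone_0_pi[of 0 \<gamma>] by auto
  have c0: "0 < c" using cs cg sb by (metis zero_less_mult_pos2)
  have hB: "0 < h VB" by (rule h_pos)
  \<comment> \<open>The opposite side is \<open>r = R t\<close>, the smaller root of
    \<open>h VB * (1 + r\<^sup>2) = 2 * Q t * r\<close>; the larger root is its reciprocal, and
    \<open>S t\<close> comes from the discriminant.\<close>
  define Q S where "Q t = c * cos t" and "S t = sqrt (1 - (c * sin t)\<^sup>2)" for t
  define R where "R t = (Q t - S t) / h VB" for t
  have t_facts: "0 < Q t" "0 < S t" "(S t)\<^sup>2 = (Q t)\<^sup>2 - (h VB)\<^sup>2" "S t < Q t" "0 < R t" "R t < 1"
    "R t * (Q t + S t) = h VB" if t: "t \<in> {0<..<\<beta>}" for t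
  proof -
    show Q0: "0 < Q t" using c0 t \<beta>2 cos_gt_zero_pi[of t] by (auto simp: Q_def)
    have "sin t < sin \<beta>" using t \<beta>2 by (intro sin_monotone_2pi) auto
    then have "c * sin t < 1" using mult_strict_left_mono[OF _ c0, of "sin t" "sin \<beta>"] cs cg(2) by linarith
    moreover have "0 \<le> c * sin t" using c0 t \<beta>2 sin_ge_zero[of t] by auto
    ultimately have "(c * sin t)\<^sup>2 < 1" by (simp add: abs_square_less_1)
    then show S0: "0 < S t" and "(S t)\<^sup>2 = (Q t)\<^sup>2 - (h VB)\<^sup>2"
      using c2 by (simp_all add: S_def Q_def power_mult_distrib cos_squared_eq algebra_simps)
    note S2 = this(2)
    have h2: "0 < (h VB)\<^sup>2" "0 < (S t)\<^sup>2" using hB S0 by simp_all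
    have "(S t)\<^sup>2 < (Q t)\<^sup>2" using S2 h2 by linarith
    from power2_less_imp_less[OF this less_imp_le[OF Q0]] show SQ: "S t < Q t" .
    then show R0: "0 < R t" using hB by (simp add: R_def)
    have "(Q t - S t) * (Q t + S t) = (h VB)\<^sup>2" using S2 by (simp add: power2_eq_square algebra_simps)
    then show RQ: "R t * (Q t + S t) = h VB" using hB by (simp add: R_def power2_eq_square)
    have "h VB < Q t + S t"
    proof -
      have "(h VB)\<^sup>2 < (Q t)\<^sup>2" using S2 h2 by linarith
      from power2_less_imp_less[OF this less_imp_le[OF Q0]] have "h VB < Q t" .
      then show ?thesis using S0 by linarith
    qed
    then show "R t < 1" using RQ R0 Q0 S0 by (smt (verit) mult_less_cancel_right1 mult_le_cancel_right1)
  qed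
  have cond: "0 \<le> mform (lift (\<psi> z)) (\<alpha> VB) \<longleftrightarrow> r \<le> R t"
    if z: "z \<in> hyp_plane" "z = of_real r * cis t" "0 < r" "t \<in> {0<..<\<beta>}" for z r t
  proof -
    note tf = t_facts[OF z(4)]
    have r: "cmod z = r" using z by (simp add: norm_mult)
    have r1: "0 < 1 - r\<^sup>2" "r < 1" using hyp_plane_norm[OF z(1)] z(1) r by auto
    define Z where "Z = (Q t + S t - h VB * r) / (1 - r\<^sup>2)"
    have "mform (lift (\<psi> z)) (\<alpha> VB) = fst (lift z) \<bullet> \<nu> + snd (lift z) * h VB"
      using boost_isometry[OF p_plane, of VB "lift (\<psi> z)" "\<alpha> VB"] CP(2)[OF z(1)]
      by (simp add: \<psi>_def bj mform_def LL(1))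
    also have "\<dots> = (h VB * (1 + r\<^sup>2) - 2 * Q t * r) / (1 - r\<^sup>2)"
      by (simp add: lift_def r) (simp add: z(2) inner_complex_def im c_def Q_def add_divide_distrib diff_divide_distrib algebra_simps)
    also have "h VB * (1 + r\<^sup>2) - 2 * Q t * r = (R t - r) * (Q t + S t - h VB * r)"
    proof -
      have "h VB * R t = Q t - S t" using hB by (simp add: R_def)
      then have "r * (h VB * R t) = r * (Q t - S t)" by simp
      then show ?thesis using tf(7) by (simp add: algebra_simps power2_eq_square)
    qed
    finally have m: "mform (lift (\<psi> z)) (\<alpha> VB) = (R t - r) * Z" by (simp add: Z_def)
    have "h VB * r < Q t + S t"
    proof -
      have "h VB * r = R t * r * (Q t + S t)" using tf(7) by (metis mult.assoc mult.commute)
      also have "\<dots> < 1 * (Q t + S t)"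
        using tf r1(2) z(3) mult_strict_mono[of "R t" 1 r 1] by (intro mult_strict_right_mono) auto
      finally show ?thesis by simp
    qed
    then have "0 < Z" using r1 by (simp add: Z_def)
    then show ?thesis unfolding m by (auto simp: zero_le_mult_iff)
  qed
  have J: "{0<..<\<beta>} \<subseteq> {0<..<2*pi}" using \<beta>2 pi_gt_zero by auto
  have "{z \<in> hyp_plane. \<psi> z \<in> triangle} \<inter> sector 0 \<beta> = polar_region {0<..<\<beta>} R"
  proof (intro equalityI subsetI)
    fix z assume z: "z \<in> {z \<in> hyp_plane. \<psi> z \<in> triangle} \<inter> sector 0 \<beta>"
    then obtain r t where rt: "z = of_real r * cis t" "0 < r" "t \<in> {0<..<\<beta>}" by (auto simp: sector_def)
    have "0 \<le> mform (lift (\<psi> z)) (\<alpha> VB)" using z CP(5)[of z] by (simp add: \<psi>_def)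
    then have "r \<le> R t" using cond[of z r t] z rt by blast
    then show "z \<in> polar_region {0<..<\<beta>} R" using rt unfolding polar_region_def by blast
  next
    fix z assume "z \<in> polar_region {0<..<\<beta>} R"
    then obtain r t where rt: "z = of_real r * cis t" "0 < r" "t \<in> {0<..<\<beta>}" "r \<le> R t"
      by (auto simp: polar_region_def)
    have "cmod z < 1" using rt t_facts(6)[OF rt(3)] by (simp add: norm_mult)
    then have zp: "z \<in> hyp_plane" by simp
    have zs: "z \<in> sector 0 \<beta>" using rt unfolding sector_def by auto
    have "0 \<le> mform (lift (\<psi> z)) (\<alpha> VB)" using cond[OF zp rt(1-3)] rt(4) by blast
    then show "z \<in> {z \<in> hyp_plane. \<psi> z \<in> triangle} \<inter> sector 0 \<beta>"
      using CP(5)[OF zp zs] zp zs by (simp add: \<psi>_def)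
  qed
  then have "emeasure hyp_area triangle = emeasure hyp_area (polar_region {0<..<\<beta>} R)"
    using CP(4) by (simp add: \<psi>_def)
  also have "\<dots> = (\<integral>\<^sup>+t. ennreal (2 * (R t)\<^sup>2 / (1 - (R t)\<^sup>2)) * indicator {0<..<\<beta>} t \<partial>lborel)"
  proof (rule emeasure_polar_region[OF _ J])
    show "R \<in> borel_measurable borel"
      unfolding R_def[abs_def] Q_def S_def by measurable
  qed (use t_facts in auto)
  also have "\<dots> = (\<integral>\<^sup>+t. ennreal (c * cos t / sqrt (1 - (c * sin t)\<^sup>2) - 1) * indicator {0<..<\<beta>} t \<partial>lborel)"
  proof (rule nn_integral_cong)
    fix t
    have "2 * (R t)\<^sup>2 / (1 - (R t)\<^sup>2) = Q t / S t - 1" if t: "t \<in> {0<..<\<beta>}"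
    proof -
      note tf = t_facts[OF t]
      have hR: "h VB * R t = Q t - S t" using hB by (simp add: R_def)
      have "h VB * (1 - (R t)\<^sup>2) = R t * (Q t + S t) - R t * (h VB * R t)"
        by (simp only: tf(7)) (simp add: power2_eq_square algebra_simps)
      also have "\<dots> = 2 * S t * R t" unfolding hR by (simp add: algebra_simps)
      finally have "h VB * (1 - (R t)\<^sup>2) = 2 * S t * R t" .
      moreover have "(R t)\<^sup>2 < 1" using tf(5,6) by (simp add: abs_square_less_1)
      ultimately have eq: "1 - (R t)\<^sup>2 = 2 * S t * R t / h VB" using hB by (simp add: field_simps)
      have "2 * (R t)\<^sup>2 / (1 - (R t)\<^sup>2) = h VB * R t / S t"
        unfolding eq using tf hB by (simp add: power2_eq_square)
      also have "\<dots> = Q t / S t - 1" unfolding hR using tf(2) by (simp add: diff_divide_distrib)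
      finally show ?thesis .
    qed
    then show "ennreal (2 * (R t)\<^sup>2 / (1 - (R t)\<^sup>2)) * indicator {0<..<\<beta>} t =
        ennreal (c * cos t / sqrt (1 - (c * sin t)\<^sup>2) - 1) * indicator {0<..<\<beta>} t"
      by (auto simp: Q_def S_def indicator_def)
  qed
  also have "\<dots> = ennreal (arcsin (c * sin \<beta>) - \<beta>)"
  proof (rule nn_integral_triangle)
    show "0 \<le> c * cos t / sqrt (1 - (c * sin t)\<^sup>2) - 1" if "t \<in> {0<..<\<beta>}" for t
      using t_facts[OF that] by (simp add: Q_def S_def)
  qed (use pos \<beta>2 c0 cs cg in auto)
  also have "arcsin (c * sin \<beta>) = pi / 2 - \<gamma>"
  proof -
    have "cos \<gamma> = sin (pi / 2 - \<gamma>)" by (simp add: sin_diff)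
    then show ?thesis unfolding cs using pos \<beta>2 by (simp add: arcsin_sin)
  qed
  also have "pi / 2 - \<gamma> - \<beta> = pi / 2 - \<beta> - \<gamma>" by simp
  finally show ?thesis unfolding \<beta>_def \<gamma>_def .
qed

section \<open>Packing radii and densities\<close>

lemma arcosh_measurable [measurable]: "(arcosh :: real \<Rightarrow> real) \<in> borel_measurable borel"
  unfolding arcosh_def[abs_def] by measurable

lemma hyp_dist_measurable [measurable]: "hyp_dist c \<in> borel_measurable borel"
  unfolding hyp_dist_def[abs_def] by measurable

lemma sigma_finite_hyp_area: "sigma_finite_measure hyp_area"
proof -
  have "hyp_area = density lborel hyp_density"
    by (simp add: hyp_area_def hyp_density_def[abs_def])
  moreover have "sigma_finite_measure (density lborel hyp_density)"
    using hyp_density_measurable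
    by (subst sigma_finite_measure.sigma_finite_iff_density_finite[OF sigma_finite_lborel])
      (auto simp: hyp_density_def indicator_def)
  ultimately show ?thesis by simp
qed

interpretation hyp_line: pair_sigma_finite hyp_area lborel
  by (simp add: pair_sigma_finite_def sigma_finite_hyp_area lborel.sigma_finite_measure_axioms)

lemma sets_hyp_line: "sets (hyp_area \<Otimes>\<^sub>M (lborel :: real measure)) = sets (borel \<Otimes>\<^sub>M borel)"
  by (rule sets_pair_measure_cong) auto

text \<open>The bound on the right is the square of \<open>tanh (s / 2)\<close>, the Euclidean
  radius of a hyperbolic disc of radius \<open>s\<close> about the origin.\<close>

lemma hyp_dist_le_iff_Moebius:
  assumes c: "c \<in> hyp_plane" and z: "z \<in> hyp_plane" and s: "0 \<le> s"
  shows "hyp_dist c z \<le> s \<longleftrightarrow> (cmod (Moebius_function 0 c z))\<^sup>2 \<le> (cosh s - 1) / (cosh s + 1)"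
proof -
  define w where "w = Moebius_function 0 c z"
  have w1: "0 < 1 - (cmod w)\<^sup>2" using hyp_plane_norm Moebius_in_plane[OF c z] by (simp add: w_def)
  have ch: "1 \<le> cosh s" by (rule cosh_real_ge_1)
  have "hyp_dist c z \<le> s \<longleftrightarrow> cosh (hyp_dist c z) \<le> cosh s"
    using s hyp_dist_nonneg[OF c z] by (simp add: cosh_real_nonneg_le_iff)
  also have "cosh (hyp_dist c z) = (1 + (cmod w)\<^sup>2) / (1 - (cmod w)\<^sup>2)"
    using snd_boost[of c "lift z"] boost_lift[OF c z] cosh_hyp_dist[OF c z]
    by (simp add: mform_commute w_def lift_def)
  also have "\<dots> \<le> cosh s \<longleftrightarrow> (cmod w)\<^sup>2 * (cosh s + 1) \<le> cosh s - 1"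
    using w1 by (simp add: divide_le_eq algebra_simps)
  also have "\<dots> \<longleftrightarrow> (cmod w)\<^sup>2 \<le> (cosh s - 1) / (cosh s + 1)"
    using ch by (simp add: le_divide_eq)
  finally show ?thesis by (simp add: w_def)
qed

lemma emeasure_hyp_ball:
  assumes c: "c \<in> hyp_plane" and s: "0 \<le> s"
  shows "emeasure hyp_area {z \<in> hyp_plane. hyp_dist c z \<le> s} = ennreal (2 * pi * (cosh s - 1))"
proof (cases "s = 0")
  case True
  have "{z \<in> hyp_plane. hyp_dist c z \<le> s} \<subseteq> {c}"
  proof
    fix z assume "z \<in> {z \<in> hyp_plane. hyp_dist c z \<le> s}"
    then have "z \<in> hyp_plane" "cosh (hyp_dist c z) = 1"
      using True hyp_dist_nonneg[OF c, of z] by auto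
    then show "z \<in> {c}" using mform_lift_gt1[OF c, of z] cosh_hyp_dist[OF c, of z] by auto
  qed
  moreover have "{c} \<in> null_sets hyp_area" by (rule hyp_area_null) auto
  moreover have "{z \<in> hyp_plane. hyp_dist c z \<le> s} \<in> sets borel"
  proof -
    have "{z \<in> hyp_plane. hyp_dist c z \<le> s} = hyp_plane \<inter> {z. hyp_dist c z \<le> s}" by auto
    also have "\<dots> \<in> sets borel" by (intro sets.Int) auto
    finally show ?thesis .
  qed
  ultimately have "emeasure hyp_area {z \<in> hyp_plane. hyp_dist c z \<le> s} = 0"
    by (metis null_setsD1 null_sets_subset sets_hyp_area)
  then show ?thesis using True by simp
next
  case False
  define R where "R = sqrt ((cosh s - 1) / (cosh s + 1))"
  have ch: "1 < cosh s" using False s cosh_real_nonneg_less_iff[of 0 s] by simp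
  have R2: "R\<^sup>2 = (cosh s - 1) / (cosh s + 1)" using ch by (simp add: R_def)
  have R0: "0 < R" using ch by (simp add: R_def)
  have "R\<^sup>2 < 1" unfolding R2 using ch by simp
  then have R1: "R < 1" using R0 by (simp add: abs_square_less_1)
  have "{z \<in> hyp_plane. hyp_dist c z \<le> s} = {z \<in> hyp_plane. Moebius_function 0 c z \<in> cball 0 R}"
    using hyp_dist_le_iff_Moebius[OF c _ s] R0 unfolding R2[symmetric]
    by (auto simp: abs_le_square_iff[symmetric])
  then have "emeasure hyp_area {z \<in> hyp_plane. hyp_dist c z \<le> s} = ennreal (4 * pi * R\<^sup>2 / (1 - R\<^sup>2))"
    using emeasure_hyp_area_Moebius[OF c, of "cball 0 R"] emeasure_hyp_area_disc[OF R0 R1] by simp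
  also have "4 * pi * R\<^sup>2 / (1 - R\<^sup>2) = 2 * pi * (cosh s - 1)"
  proof -
    have "1 - R\<^sup>2 = 2 / (cosh s + 1)" unfolding R2 using ch by (simp add: field_simps)
    then show ?thesis unfolding R2 using ch by (simp add: field_simps)
  qed
  finally show ?thesis .
qed

lemma H2R_ball_volume:
  assumes K: "fst K \<in> hyp_plane" and \<rho>: "0 \<le> \<rho>"
  shows "H2R_vol (H2R_ball K \<rho>) = 2 * pi * \<rho> * ball_series \<rho>"
proof -
  define c t0 where "c = fst K" and "t0 = snd K"
  have c: "c \<in> hyp_plane" using K by (simp add: c_def)
  have B: "H2R_ball K \<rho> \<in> sets (hyp_area \<Otimes>\<^sub>M lborel)"
  proof -
    have [measurable]: "hyp_plane \<in> sets borel" by simp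
    have "H2R_ball K \<rho> = {X \<in> space (borel \<Otimes>\<^sub>M borel). fst X \<in> hyp_plane \<and>
        sqrt ((hyp_dist c (fst X))\<^sup>2 + (t0 - snd X)\<^sup>2) \<le> \<rho>}"
      by (auto simp: H2R_ball_def H2R_def H2R_dist_def c_def t0_def space_pair_measure)
    also have "\<dots> \<in> sets (borel \<Otimes>\<^sub>M borel)" by measurable
    finally show ?thesis unfolding sets_hyp_line .
  qed
  have slice: "(\<lambda>x. (x, t)) -` H2R_ball K \<rho> = (if t - t0 \<in> {-\<rho>..\<rho>}
      then {z \<in> hyp_plane. hyp_dist c z \<le> sqrt (\<rho>\<^sup>2 - (t - t0)\<^sup>2)} else {})" for t
  proof -
    have iff: "sqrt ((hyp_dist c z)\<^sup>2 + (t0 - t)\<^sup>2) \<le> \<rho> \<longleftrightarrow>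
      t - t0 \<in> {-\<rho>..\<rho>} \<and> hyp_dist c z \<le> sqrt (\<rho>\<^sup>2 - (t - t0)\<^sup>2)" if z: "z \<in> hyp_plane" for z
    proof -
      have sq: "(t0 - t)\<^sup>2 = (t - t0)\<^sup>2" by (rule power2_commute)
      have "sqrt ((hyp_dist c z)\<^sup>2 + (t0 - t)\<^sup>2) \<le> \<rho> \<longleftrightarrow> (hyp_dist c z)\<^sup>2 \<le> \<rho>\<^sup>2 - (t - t0)\<^sup>2"
        using \<rho> by (simp add: sqrt_le_D sq real_sqrt_le_iff' le_diff_eq)
      also have "\<dots> \<longleftrightarrow> (t - t0)\<^sup>2 \<le> \<rho>\<^sup>2 \<and> (hyp_dist c z)\<^sup>2 \<le> \<rho>\<^sup>2 - (t - t0)\<^sup>2"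
        using zero_le_power2[of "hyp_dist c z"] by linarith
      also have "\<dots> \<longleftrightarrow> (t - t0)\<^sup>2 \<le> \<rho>\<^sup>2 \<and> hyp_dist c z \<le> sqrt (\<rho>\<^sup>2 - (t - t0)\<^sup>2)"
        using hyp_dist_nonneg[OF c z] by (metis diff_ge_0_iff_ge real_le_lsqrt real_le_rsqrt real_sqrt_pow2 real_sqrt_ge_0_iff power_mono)
      also have "(t - t0)\<^sup>2 \<le> \<rho>\<^sup>2 \<longleftrightarrow> t - t0 \<in> {-\<rho>..\<rho>}"
        using \<rho> abs_le_square_iff[of "t - t0" \<rho>] by (auto simp: abs_le_iff)
      finally show ?thesis .
    qed
    then show ?thesis
      by (auto simp: H2R_ball_def H2R_def H2R_dist_def c_def t0_def)
  qed
  have "emeasure (hyp_area \<Otimes>\<^sub>M lborel) (H2R_ball K \<rho>) =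
      (\<integral>\<^sup>+t. emeasure hyp_area ((\<lambda>x. (x, t)) -` H2R_ball K \<rho>) \<partial>lborel)"
    by (rule hyp_line.emeasure_pair_measure_alt2[OF B])
  also have "\<dots> = (\<integral>\<^sup>+t. ennreal (2 * pi * (cosh (sqrt (\<rho>\<^sup>2 - (t - t0)\<^sup>2)) - 1)) * indicator {-\<rho>..\<rho>} (t - t0) \<partial>lborel)"
  proof (rule nn_integral_cong)
    fix t
    show "emeasure hyp_area ((\<lambda>x. (x, t)) -` H2R_ball K \<rho>) =
        ennreal (2 * pi * (cosh (sqrt (\<rho>\<^sup>2 - (t - t0)\<^sup>2)) - 1)) * indicator {-\<rho>..\<rho>} (t - t0)"
    proof (cases "t - t0 \<in> {-\<rho>..\<rho>}")
      case True
      then have "(t - t0)\<^sup>2 \<le> \<rho>\<^sup>2" using abs_le_square_iff[of "t - t0" \<rho>] \<rho> by (auto simp: abs_le_iff)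
      then have "0 \<le> sqrt (\<rho>\<^sup>2 - (t - t0)\<^sup>2)" by simp
      then show ?thesis unfolding slice if_P[OF True] using True by (simp only: emeasure_hyp_ball[OF c]) simp
    next
      case False
      then show ?thesis unfolding slice if_not_P[OF False] by (simp add: indicator_def)
    qed
  qed
  also have "\<dots> = (\<integral>\<^sup>+t. ennreal (2 * pi * (cosh (sqrt (\<rho>\<^sup>2 - t\<^sup>2)) - 1)) * indicator {-\<rho>..\<rho>} t \<partial>lborel)"
  proof -
    have [measurable]: "(cosh :: real \<Rightarrow> real) \<in> borel_measurable borel"
      by (intro borel_measurable_continuous_onI continuous_intros)
    have "(\<lambda>t. ennreal (2 * pi * (cosh (sqrt (\<rho>\<^sup>2 - (t - t0)\<^sup>2)) - 1)) * indicator {-\<rho>..\<rho>} (t - t0)) \<in> borel_measurable borel"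
      by measurable
    from nn_integral_real_affine[OF this, of 1 t0] show ?thesis by simp
  qed
  also have "\<dots> = ennreal (2 * pi * \<rho> * ball_series \<rho>)" by (rule ball_integral[OF \<rho>])
  finally show ?thesis
    unfolding H2R_vol_def measure_def using \<rho> ball_series_nonneg[OF \<rho>] by simp
qed

section \<open>Packings centred at a vertex\<close>

context rotation_group
begin

text \<open>The vertex \<open>j\<close> lies on the two other sides, so their Coxeter label is the
  order of the rotation about it.\<close>

definition rot_order :: "vertex \<Rightarrow> nat" where
  "rot_order j = (case j of VA \<Rightarrow> m VB VC | VB \<Rightarrow> m VA VC | VC \<Rightarrow> m VA VB)"

lemma rot_order_ge2: "2 \<le> rot_order j"
  using m_ge2 by (cases j) (auto simp: rot_order_def)

lemma cell_area_rot_order: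
  "emeasure hyp_area (cell j) = of_nat (2 * rot_order j) * emeasure hyp_area triangle"
  using cell_area[of VB VA VC] cell_area[of VA VB VC] cell_area[of VA VC VB]
  by (cases j) (auto simp: rot_order_def)

lemma identity_in_G: "\<exists>g\<in>G. \<forall>z\<in>hyp_plane. g z = z"
proof -
  obtain g where g: "g \<in> G" "tracks \<alpha> [] g" using word_element[of "[]"] by auto
  then have "g z = z" if "z \<in> hyp_plane" for z
    using that lift_inj[of "g z" z] unfolding tracks_def by auto
  then show ?thesis using g(1) by blast
qed

lemma Gamma_iff: "g \<in> Gamma G r \<longleftrightarrow> (\<exists>f\<in>G. \<exists>k::int. g = map_prod f (\<lambda>t. t + of_int k * r))"
  by (auto simp: Gamma_def)

text \<open>The two candidates are the translation by \<open>r\<close> and the nearest orbit point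
  in the plane; a motion that changes both coordinates is at least as far away as its planar
  part.\<close>

lemma packing_radius_vertex:
  assumes r: "r > 0"
  shows "packing_radius (Gamma G r) (p j, t) = min (r / 2) (arsinh (h j))"
  unfolding packing_radius_def
proof (rule Least_equality)
  have d0: "hyp_dist (p j) (p j) = 0"
    using hyp_dist_lift[OF p_plane p_plane, of j j] P_hyperboloid[of j] by (simp add: hyperboloid_def)
  show "\<exists>g\<in>Gamma G r - stabilizer_at (Gamma G r) (p j, t). min (r / 2) (arsinh (h j)) = H2R_dist (p j, t) (g (p j, t)) / 2"
  proof (cases "r / 2 \<le> arsinh (h j)")
    case True
    obtain f where f: "f \<in> G" "\<forall>z\<in>hyp_plane. f z = z" using identity_in_G by blast
    let ?g = "map_prod f (\<lambda>t. t + of_int 1 * r)"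
    have g: "?g (p j, t) = (p j, t + r)" using f(2) p_plane by simp
    then have ne: "?g (p j, t) \<noteq> (p j, t)" using r by simp
    have "?g \<in> Gamma G r" using f(1) Gamma_iff by blast
    then have "?g \<in> Gamma G r - stabilizer_at (Gamma G r) (p j, t)"
      using ne unfolding stabilizer_at_def by blast
    moreover have "min (r / 2) (arsinh (h j)) = H2R_dist (p j, t) (?g (p j, t)) / 2"
      unfolding g using True r by (simp add: H2R_dist_def d0)
    ultimately show ?thesis by blast
  next
    case False
    obtain f where f: "f \<in> G" "f (p j) \<noteq> p j" "hyp_dist (p j) (f (p j)) = 2 * arsinh (h j)"
      using vertex_gap_attained[of j] by blast
    let ?g = "map_prod f (\<lambda>t. t + of_int 0 * r)"
    have ne: "?g (p j, t) \<noteq> (p j, t)" using f(2) by simp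
    have "?g \<in> Gamma G r" using f(1) Gamma_iff by blast
    then have "?g \<in> Gamma G r - stabilizer_at (Gamma G r) (p j, t)"
      using ne unfolding stabilizer_at_def by blast
    moreover have "H2R_dist (p j, t) (?g (p j, t)) = 2 * arsinh (h j)"
    proof -
      have "H2R_dist (p j, t) (?g (p j, t)) = sqrt ((hyp_dist (p j) (f (p j)))\<^sup>2)"
        by (simp add: H2R_dist_def)
      then show ?thesis unfolding f(3) real_sqrt_abs using gap_pos[of j] by simp
    qed
    then have "min (r / 2) (arsinh (h j)) = H2R_dist (p j, t) (?g (p j, t)) / 2"
      using False by simp
    ultimately show ?thesis by blast
  qed
next
  fix y assume "\<exists>g\<in>Gamma G r - stabilizer_at (Gamma G r) (p j, t). y = H2R_dist (p j, t) (g (p j, t)) / 2"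
  then obtain g where g: "g \<in> Gamma G r" "g (p j, t) \<noteq> (p j, t)" "y = H2R_dist (p j, t) (g (p j, t)) / 2"
    unfolding stabilizer_at_def by blast
  then obtain f k where f: "f \<in> G" and gf: "g = map_prod f (\<lambda>t. t + of_int k * r)"
    unfolding Gamma_iff by blast
  have ne: "(f (p j), t + of_int k * r) \<noteq> (p j, t)"
    and y: "y = H2R_dist (p j, t) (f (p j), t + of_int k * r) / 2"
    using g(2,3) unfolding gf map_prod_simp .
  show "min (r / 2) (arsinh (h j)) \<le> y"
  proof (cases "f (p j) = p j")
    case True
    then have "k \<noteq> 0" using ne by auto
    then have "1 \<le> \<bar>real_of_int k\<bar>" by linarith
    then have "r \<le> \<bar>real_of_int k\<bar> * r" using r by simp
    also have "\<dots> \<le> H2R_dist (p j, t) (f (p j), t + of_int k * r)"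
      unfolding H2R_dist_def using r by (intro real_le_rsqrt) (simp add: power_mult_distrib)
    finally show ?thesis using y by simp
  next
    case False
    have "2 * arsinh (h j) \<le> hyp_dist (p j) (f (p j))" by (rule vertex_gap[OF f False])
    also have "\<dots> \<le> H2R_dist (p j, t) (f (p j), t + of_int k * r)"
      unfolding H2R_dist_def by (intro real_le_rsqrt) simp
    finally show ?thesis using y by simp
  qed
qed

text \<open>Squared distances add and the planar and fibre parts of a motion vary independently, so
  the cell is a product: taking one part trivial isolates the condition of the other.\<close>

lemma dirichlet_cell_vertex:
  assumes r: "r > 0"
  shows "dirichlet_cell (Gamma G r) (p j, t) = cell j \<times> {t - r / 2..t + r / 2}"
proof (intro equalityI subsetI)
  fix X assume X: "X \<in> dirichlet_cell (Gamma G r) (p j, t)"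
  obtain x s where xs: "X = (x, s)" by (cases X)
  have x: "x \<in> hyp_plane" using X by (simp add: dirichlet_cell_def H2R_def xs)
  have le: "(hyp_dist (p j) x)\<^sup>2 + (t - s)\<^sup>2 \<le> (hyp_dist (f (p j)) x)\<^sup>2 + (t + of_int k * r - s)\<^sup>2"
    if "f \<in> G" for f and k :: int
  proof -
    have "map_prod f (\<lambda>t. t + of_int k * r) \<in> Gamma G r" unfolding Gamma_iff using that by blast
    then have "H2R_dist (p j, t) X \<le> H2R_dist (map_prod f (\<lambda>t. t + of_int k * r) (p j, t)) X"
      using X unfolding dirichlet_cell_def by blast
    then show ?thesis by (simp add: H2R_dist_def xs)
  qed
  have "hyp_dist (p j) x \<le> hyp_dist (f (p j)) x" if f: "f \<in> G" for f
  proof (rule power2_le_imp_le)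
    show "(hyp_dist (p j) x)\<^sup>2 \<le> (hyp_dist (f (p j)) x)\<^sup>2" using le[OF f, of 0] by simp
    show "0 \<le> hyp_dist (f (p j)) x" by (rule hyp_dist_nonneg[OF G_in_plane[OF f p_plane] x])
  qed
  then have xc: "x \<in> cell j" using x by (simp add: cell_def)
  obtain f where f: "f \<in> G" "\<forall>z\<in>hyp_plane. f z = z" using identity_in_G by blast
  have fp: "f (p j) = p j" using f(2) p_plane by blast
  have "(t - s)\<^sup>2 \<le> (t + r - s)\<^sup>2" "(t - s)\<^sup>2 \<le> (t - r - s)\<^sup>2"
    using le[OF f(1), of 1] le[OF f(1), of "-1"] unfolding fp by simp_all
  moreover have "(t + r - s)\<^sup>2 = (t - s)\<^sup>2 + r * (2 * (t - s) + r)" "(t - r - s)\<^sup>2 = (t - s)\<^sup>2 + r * (r - 2 * (t - s))"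
    by (simp_all add: power2_eq_square algebra_simps)
  ultimately have "0 \<le> r * (2 * (t - s) + r)" "0 \<le> r * (r - 2 * (t - s))" by linarith+
  then have s: "s \<in> {t - r / 2..t + r / 2}" using r by (simp add: zero_le_mult_iff)
  show "X \<in> cell j \<times> {t - r / 2..t + r / 2}" using xc s by (simp add: xs)
next
  fix X assume "X \<in> cell j \<times> {t - r / 2..t + r / 2}"
  then obtain x s where xs: "X = (x, s)" "x \<in> cell j" and ts: "t - r / 2 \<le> s" "s \<le> t + r / 2"
    by auto
  have s: "\<bar>t - s\<bar> \<le> r / 2" using ts by linarith
  have x: "x \<in> hyp_plane" using xs(2) by (simp add: cell_def)
  have "H2R_dist (p j, t) X \<le> H2R_dist (map_prod f (\<lambda>t. t + of_int k * r) (p j, t)) X" if f: "f \<in> G" for f k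
  proof -
    have "hyp_dist (p j) x \<le> hyp_dist (f (p j)) x" using xs(2) f by (simp add: cell_def)
    then have 1: "(hyp_dist (p j) x)\<^sup>2 \<le> (hyp_dist (f (p j)) x)\<^sup>2"
      using hyp_dist_nonneg[OF p_plane x] by (intro power_mono) auto
    have "\<bar>t - s\<bar> \<le> \<bar>t + of_int k * r - s\<bar>"
    proof (cases "k = 0")
      case False
      then have "1 \<le> \<bar>real_of_int k\<bar>" by linarith
      then have "r \<le> \<bar>real_of_int k * r\<bar>" using r by (simp add: abs_mult)
      then show ?thesis using s by linarith
    qed simp
    then have 2: "(t - s)\<^sup>2 \<le> (t + of_int k * r - s)\<^sup>2" by (simp add: abs_le_square_iff)
    show ?thesis using 1 2 by (simp add: H2R_dist_def xs(1))
  qed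
  then have "H2R_dist (p j, t) X \<le> H2R_dist (g (p j, t)) X" if "g \<in> Gamma G r" for g
    using that unfolding Gamma_iff by blast
  moreover have "X \<in> H2R" using x by (simp add: H2R_def xs(1))
  ultimately show "X \<in> dirichlet_cell (Gamma G r) (p j, t)"
    unfolding dirichlet_cell_def by blast
qed

definition tri_area :: real where
  "tri_area = pi / 2 - pi / m VA VC - pi / m VA VB"

lemma packing_density_vertex:
  assumes right: "m VB VC = 2" and ang: "pi / m VA VC + pi / m VA VB < pi / 2" and r: "r > 0"
  shows "packing_density (Gamma G r) (p j, t) =
    2 * pi * min (r / 2) (arsinh (h j)) * ball_series (min (r / 2) (arsinh (h j))) /
      (2 * real (rot_order j) * tri_area * r)"
proof -
  have F: "0 < tri_area" using ang unfolding tri_area_def by linarith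
  have "emeasure hyp_area (cell j) = ennreal (2 * real (rot_order j) * tri_area)"
    unfolding cell_area_rot_order triangle_area[OF right ang] tri_area_def[symmetric]
    using F by (simp add: ennreal_mult' ennreal_of_nat_eq_real_of_nat)
  then have "emeasure (hyp_area \<Otimes>\<^sub>M lborel) (cell j \<times> {t - r / 2..t + r / 2}) =
      ennreal (2 * real (rot_order j) * tri_area) * ennreal r"
    using r cell_borel by (subst lborel.emeasure_pair_measure_Times) auto
  then have "H2R_vol (dirichlet_cell (Gamma G r) (p j, t)) = 2 * real (rot_order j) * tri_area * r"
    unfolding H2R_vol_def dirichlet_cell_vertex[OF r] measure_def using F r
    by (simp add: ennreal_mult'[symmetric])
  moreover have "H2R_vol (H2R_ball (p j, t) (min (r / 2) (arsinh (h j)))) =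
      2 * pi * min (r / 2) (arsinh (h j)) * ball_series (min (r / 2) (arsinh (h j)))"
  proof (rule H2R_ball_volume)
    show "0 \<le> min (r / 2) (arsinh (h j))" using r less_imp_le[OF gap_pos[of j]] by (intro min.boundedI) auto
  qed (use p_plane in auto)
  ultimately show ?thesis unfolding packing_density_def packing_radius_vertex[OF r] by simp
qed

text \<open>The density at \<open>r = 2 * arsinh (h j)\<close>, where the radius in the ball volume
  cancels against the height of the cell.\<close>

definition vertex_density :: "vertex \<Rightarrow> real" where
  "vertex_density j = pi * ball_series (arsinh (h j)) / (2 * real (rot_order j) * tri_area)"

lemma packing_density_le:
  assumes right: "m VB VC = 2" and ang: "pi / m VA VC + pi / m VA VB < pi / 2" and r: "r > 0"
  shows "packing_density (Gamma G r) (p j, t) \<le> vertex_density j"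
    and "r = 2 * arsinh (h j) \<Longrightarrow> packing_density (Gamma G r) (p j, t) = vertex_density j"
proof -
  let ?a = "arsinh (h j)" and ?N = "2 * real (rot_order j) * tri_area"
  have "0 < tri_area" using ang unfolding tri_area_def by linarith
  then have N: "0 < ?N" using rot_order_ge2[of j] by simp
  note pd = packing_density_vertex[OF right ang r, of j t]
  show "packing_density (Gamma G r) (p j, t) \<le> vertex_density j"
  \<comment> \<open>For small \<open>r\<close> the radius is \<open>r / 2\<close> and the density
    grows with it; beyond that the ball stays fixed and only the cell grows.\<close>
  proof (cases "r / 2 \<le> ?a")
    case True
    then have "packing_density (Gamma G r) (p j, t) = pi * ball_series (r / 2) / ?N"
      unfolding pd using r by simp
    also have "\<dots> \<le> vertex_density j"
      unfolding vertex_density_def using N True r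
      by (intro divide_right_mono mult_left_mono ball_series_mono) auto
    finally show ?thesis .
  next
    case False
    then have "packing_density (Gamma G r) (p j, t) = vertex_density j * (2 * ?a / r)"
      unfolding pd vertex_density_def using r by (simp add: mult_ac)
    also have "\<dots> \<le> vertex_density j * 1"
    proof (rule mult_left_mono)
      show "2 * ?a / r \<le> 1" using False r by (simp add: divide_le_eq)
      show "0 \<le> vertex_density j"
        unfolding vertex_density_def using N ball_series_nonneg[OF less_imp_le[OF gap_pos]]
        by (intro divide_nonneg_pos mult_nonneg_nonneg) auto
    qed
    finally show ?thesis by simp
  qed
  show "r = 2 * ?a \<Longrightarrow> packing_density (Gamma G r) (p j, t) = vertex_density j"
    unfolding pd vertex_density_def using gap_pos[of j] by simp
qed

text \<open>The product of the reflections in the two sides through \<open>p j\<close> fixes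
  \<open>p j\<close> and moves the vertex \<open>p i\<close>.\<close>

lemma vertex_multiply_transitive:
  assumes "r > 0"
  shows "multiply_transitive G r (p j, t)"
proof -
  obtain i k where ik: "i \<noteq> j" "k \<noteq> j" "i \<noteq> k" by (cases j) auto
  obtain f where f: "f \<in> G" "tracks \<alpha> [i, k] f" using word_element[of "[i, k]"] by auto
  have fj: "f (p j) = p j"
  proof -
    have "lift (f (p j)) = lift (p j)"
      using f(2) p_plane W_fixes_vertex[OF ik(1)] W_fixes_vertex[OF ik(2)] by (simp add: tracks_def)
    then show ?thesis using lift_inj[OF G_in_plane[OF f(1) p_plane] p_plane] by blast
  qed
  have "f (p i) \<noteq> p i"
  proof
    assume "f (p i) = p i"
    moreover have "lift (f (p i)) = W [i, k] (lift (p i))"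
      using f(2) p_plane unfolding tracks_def by blast
    ultimately have "lift (p i) = W [i] (W [k] (lift (p i)))" by simp
    also have "W [k] (lift (p i)) = lift (p i)" using W_fixes_vertex[of k i] ik by simp
    also have "W [i] (lift (p i)) = lift (p i) - (2 * h i) *\<^sub>R \<alpha> i"
      by (simp add: mrefl_def mform_commute[of _ "\<alpha> i"] dual)
    finally have "(2 * h i) *\<^sub>R \<alpha> i = 0" by simp
    then show False using h_pos[of i] unit[of i] by auto
  qed
  then have "map_prod f (\<lambda>t. t + of_int 0 * r) (p i, 0) \<noteq> (p i, 0)" by simp
  moreover have "(p i, 0) \<in> H2R" using p_plane by (simp add: H2R_def)
  moreover have "map_prod f (\<lambda>t. t + of_int 0 * r) \<in> Gamma G r" unfolding Gamma_iff using f(1) by blast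
  then have "map_prod f (\<lambda>t. t + of_int 0 * r) \<in> stabilizer_at (Gamma G r) (p j, t)"
    using fj by (simp add: stabilizer_at_def)
  ultimately have "nontrivial_stabilizer (Gamma G r) (p j, t)" unfolding nontrivial_stabilizer_def by blast
  then show ?thesis using assms p_plane by (simp add: multiply_transitive_def H2R_def)
qed

lemma multiply_transitive_vertex:
  assumes "multiply_transitive G r K"
  shows "\<exists>f\<in>G. \<exists>j. fst K = f (p j)"
proof -
  obtain z t where K: "K = (z, t)" by (cases K)
  have r: "r > 0" and z: "z \<in> hyp_plane" using assms by (auto simp: multiply_transitive_def H2R_def K)
  obtain g X where g: "g \<in> Gamma G r" "g K = K" and X: "X \<in> H2R" "g X \<noteq> X"
    using assms unfolding multiply_transitive_def nontrivial_stabilizer_def stabilizer_at_def by blast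
  obtain f k where f: "f \<in> G" "g = map_prod f (\<lambda>t. t + of_int k * r)" using g(1) Gamma_iff by blast
  have fz: "f z = z" and "of_int k * r = 0" using g(2) by (simp_all add: f K)
  then have k: "k = 0" using r by simp
  obtain x s where "X = (x, s)" by (cases X)
  then have "x \<in> hyp_plane" "f x \<noteq> x" using X by (auto simp: f k H2R_def)
  then show ?thesis using fixed_point_vertex[OF f(1) z fz] K by auto
qed

text \<open>The centre is a vertex of an image triangle, to which \<open>transport\<close> extends
  all results; the density depends only on the shared data \<open>m\<close> and
  \<open>h\<close>.\<close>

lemma packing_density_le_vertex:
  assumes right: "m VB VC = 2" and ang: "pi / m VA VC + pi / m VA VB < pi / 2"
    and K: "fst K = f (p j)" "f \<in> G" and r: "r > 0"
  shows "packing_density (Gamma G r) K \<le> vertex_density j"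
proof -
  obtain \<alpha>' where "rotation_group \<alpha>' m (\<lambda>i. f (p i)) h G" using transport[OF K(2)] by blast
  then interpret T: rotation_group \<alpha>' m "\<lambda>i. f (p i)" h G .
  have "T.vertex_density j = vertex_density j"
    by (simp add: T.vertex_density_def vertex_density_def T.rot_order_def rot_order_def T.tri_area_def tri_area_def)
  then show ?thesis using T.packing_density_le(1)[OF right ang r, of j "snd K"] K(1) by (metis prod.collapse)
qed

theorem opt_density_eq:
  assumes right: "m VB VC = 2" and ang: "pi / m VA VC + pi / m VA VB < pi / 2"
    and j: "\<And>i. vertex_density i \<le> vertex_density j"
  shows "opt_density G = vertex_density j"
    and "optimal_packing G (2 * arsinh (h j)) (p j, t)"
proof -
  have r: "2 * arsinh (h j) > 0" using gap_pos by simp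
  have mt: "multiply_transitive G (2 * arsinh (h j)) (p j, t)" for t by (rule vertex_multiply_transitive[OF r])
  have pd: "packing_density (Gamma G (2 * arsinh (h j))) (p j, t) = vertex_density j" for t
    by (rule packing_density_le(2)[OF right ang r refl])
  show o: "opt_density G = vertex_density j"
    unfolding opt_density_def
  proof (rule Greatest_equality)
    show "\<exists>r K. multiply_transitive G r K \<and> vertex_density j = packing_density (Gamma G r) K"
      using mt pd by metis
    fix y assume "\<exists>r K. multiply_transitive G r K \<and> y = packing_density (Gamma G r) K"
    then obtain r K where K: "multiply_transitive G r K" "y = packing_density (Gamma G r) K" by blast
    then obtain f i where "f \<in> G" "fst K = f (p i)" using multiply_transitive_vertex by blast
    then have "y \<le> vertex_density i"
      using packing_density_le_vertex[OF right ang] K by (auto simp: multiply_transitive_def)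
    then show "y \<le> vertex_density j" using j[of i] by linarith
  qed
  show "optimal_packing G (2 * arsinh (h j)) (p j, t)"
    unfolding optimal_packing_def o using mt pd by blast
qed

lemma optimal_packing_vertex:
  assumes right: "m VB VC = 2" and ang: "pi / m VA VC + pi / m VA VB < pi / 2"
    and j: "\<And>i. i \<noteq> j \<Longrightarrow> vertex_density i < vertex_density j" and K: "optimal_packing G r K"
  shows "\<exists>f\<in>G. fst K = f (p j)"
proof -
  have le: "vertex_density i \<le> vertex_density j" for i using j[of i] by (cases "i = j") auto
  have mt: "multiply_transitive G r K" and pd: "packing_density (Gamma G r) K = vertex_density j"
    using K opt_density_eq(1)[OF right ang le] by (auto simp: optimal_packing_def)
  obtain f i where f: "f \<in> G" "fst K = f (p i)" using multiply_transitive_vertex[OF mt] by blast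
  have r: "r > 0" using mt by (simp add: multiply_transitive_def)
  have "vertex_density j \<le> vertex_density i"
    using packing_density_le_vertex[OF right ang f(2,1) r] pd by linarith
  then have "i = j" using j[of i] by fastforce
  then show ?thesis using f by blast
qed

end

section \<open>Numerical estimates\<close>

lemma sin_Taylor_bound:
  "\<bar>sin x - (x - x ^ 3 / 6 + x ^ 5 / 120 - x ^ 7 / 5040)\<bar> \<le> \<bar>x\<bar> ^ 9 / 362880" for x :: real
proof -
  have "{..<9} = {0, 1, 2, 3, 4, 5, 6, 7, 8 :: nat}" by auto
  then have "(\<Sum>m<9. sin_coeff m * x ^ m) = x - x ^ 3 / 6 + x ^ 5 / 120 - x ^ 7 / 5040"
    by (simp add: sin_coeff_def fact_numeral)
  moreover have "inverse (fact 9 :: real) * \<bar>x\<bar> ^ 9 = \<bar>x\<bar> ^ 9 / 362880"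
    by (simp add: fact_numeral)
  ultimately show ?thesis using Maclaurin_sin_bound[of x 9] by (simp only:)
qed

lemma sin_ge:
  assumes "0 \<le> l" "l \<le> x" "x \<le> pi / 2" "s \<le> l - l ^ 3 / 6 + l ^ 5 / 120 - l ^ 7 / 5040 - l ^ 9 / 362880"
  shows "s \<le> sin x"
proof -
  have "s \<le> sin l" using sin_Taylor_bound[of l, unfolded abs_of_nonneg[OF assms(1)]] assms(4) by linarith
  also have "\<dots> \<le> sin x" using assms by (intro sin_monotone_2pi_le) auto
  finally show ?thesis .
qed

lemma sin_le:
  assumes "0 \<le> x" "x \<le> u" "u \<le> pi / 2" "u - u ^ 3 / 6 + u ^ 5 / 120 - u ^ 7 / 5040 + u ^ 9 / 362880 \<le> s"
  shows "sin x \<le> s"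
proof -
  have "sin x \<le> sin u" using assms by (intro sin_monotone_2pi_le) auto
  moreover have "0 \<le> u" using assms by simp
  then have "sin u \<le> s"
    using sin_Taylor_bound[of u, unfolded abs_of_nonneg[OF \<open>0 \<le> u\<close>]] assms(4) by linarith
  ultimately show ?thesis by linarith
qed

text \<open>The exponential is expanded at \<open>x\<close> and \<open>- x\<close> so that odd terms
  cancel; \<open>exp 1 \<le> 3\<close> bounds both remainders.\<close>

lemma cosh_le_Taylor:
  assumes "0 \<le> x" "x \<le> (1 :: real)"
  shows "cosh x \<le> 1 + x\<^sup>2 / 2 + x ^ 4 / 24 + x ^ 6 / 720 + x ^ 8 / 40320 + x ^ 10 / 3628800 + 3 * x ^ 12 / 479001600"
proof -
  have e: "exp y \<le> (\<Sum>m<12. y ^ m / fact m) + 3 * x ^ 12 / 479001600" if "\<bar>y\<bar> = x" for y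
  proof -
    obtain t where t: "\<bar>t\<bar> \<le> \<bar>y\<bar>" "exp y = (\<Sum>m<12. y ^ m / fact m) + exp t / fact 12 * y ^ 12"
      using Maclaurin_exp_le[of y 12] by blast
    have "exp t \<le> exp 1" using t(1) that assms by auto
    then have "exp t \<le> 3" using exp_le by linarith
    moreover have "y ^ 12 = x ^ 12" using that by (metis even_numeral power_even_abs)
    ultimately have "exp t / fact 12 * y ^ 12 \<le> 3 / fact 12 * x ^ 12"
      using assms by (intro mult_mono divide_right_mono) auto
    then show ?thesis using t(2) by (simp add: fact_numeral)
  qed
  have "2 * cosh x = exp x + exp (- x)" by (simp add: cosh_field_def)
  also have "\<dots> \<le> (\<Sum>m<12. x ^ m / fact m) + (\<Sum>m<12. (- x) ^ m / fact m) + 2 * (3 * x ^ 12 / 479001600)"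
    using e[of x] e[of "- x"] assms by simp
  also have "(\<Sum>m<12. x ^ m / fact m) + (\<Sum>m<12. (- x) ^ m / fact m) =
      2 * (1 + x\<^sup>2 / 2 + x ^ 4 / 24 + x ^ 6 / 720 + x ^ 8 / 40320 + x ^ 10 / 3628800)"
  proof -
    have "{..<12} = {0, 1, 2, 3, 4, 5, 6, 7, 8, 9, 10, 11 :: nat}" by (auto, presburger)
    then show ?thesis by (simp add: fact_numeral)
  qed
  finally show ?thesis by simp
qed

section \<open>Vertices whose companion has order 3\<close>

lemma pi_bounds: "3.141592653588 \<le> pi" "pi \<le> 3.1415926535899"
  using pi_approx by auto

lemma half_div_sin_le:
  assumes "0 < s" "s \<le> sin x" "1 / (2 * s) \<le> c"
  shows "1 / 2 / sin x \<le> (c :: real)"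
proof -
  have "1 / 2 / sin x \<le> 1 / 2 / s" using assms by (intro divide_left_mono) auto
  then show ?thesis using assms(3) by simp
qed

lemma small_n_bound:
  assumes c: "cosh h = 1 / 2 / sin (pi / n)" and s: "0 < s" "s \<le> sin (pi / n)"
    and \<kappa>: "16 / 15 \<le> \<kappa>" "0 \<le> y"
    "(4 / 3 - \<kappa>) / 2 - (\<kappa> - 16 / 15) * y / 12 - (\<kappa> - 32 / 35) * y\<^sup>2 / 240 - (\<kappa> - 256 / 315) * y ^ 3 / 10080 \<le> 0"
    "(\<kappa> - 16 / 15) * y\<^sup>2 / 24 + (\<kappa> - 32 / 35) * y ^ 3 / 360 + (\<kappa> - 256 / 315) * y ^ 4 / 13440 \<le> a"
    and b: "\<kappa> * (1 / (2 * s) - 1) + a < b"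
  shows "ball_series h < b"
proof -
  have "cosh h \<le> 1 / (2 * s)" unfolding c by (rule half_div_sin_le[OF s order_refl])
  then have "\<kappa> * (cosh h - 1) \<le> \<kappa> * (1 / (2 * s) - 1)" using \<kappa>(1) by (intro mult_left_mono) auto
  then show ?thesis using ball_series_le_tangent[OF \<kappa>, of h] b by linarith
qed

text \<open>In the bounds for 7 to 10, \<open>s\<close> rounds the sine down, \<open>y\<close> is
  the squared radius to a few digits, \<open>\<kappa>\<close> makes the slope at \<open>y\<close>
  vanish up to rounding, and \<open>a\<close> rounds up the value of the tangent at 0. The factor
  \<open>7 / 3 - 2\<close> is \<open>2 * n / pi\<close> times the area of the triangle.\<close>

lemma bound_7:
  assumes "cosh h = 1 / 2 / sin (pi / 7)"
  shows "ball_series h < 0.607267 * (7 / 3 - 2)"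
proof (rule small_n_bound[OF assms, of "86776747/200000000" "330114061/250000000" "2973/10000" "96461/100000000"])
  show "86776747/200000000 \<le> sin (pi / 7)"
    using pi_bounds by (intro sin_ge[of "897597901/2000000000"]) (simp_all add: power_divide)
qed (simp_all add: power_divide)

lemma bound_8:
  assumes "cosh h = 1 / 2 / sin (pi / 8)"
  shows "ball_series h < 0.607267 * (8 / 3 - 2)"
proof (rule small_n_bound[OF assms, of "382683431/1000000000" "654320389/500000000" "73/125" "366109/100000000"])
  show "382683431/1000000000 \<le> sin (pi / 8)"
    using pi_bounds by (intro sin_ge[of "122718463/312500000"]) (simp_all add: power_divide)
qed (simp_all add: power_divide)

text \<open>Here \<open>n / 3 - 2\<close> is 1, so the density is \<open>ball_series h\<close>
  itself and this bound is the upper half of the claimed digits.\<close>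

lemma bound_9:
  assumes "cosh h = 1 / 2 / sin (pi / 9)"
  shows "ball_series h < 0.607268"
proof (rule small_n_bound[OF assms, of "171010071/500000000" "1297769277/1000000000" "86033/100000" "391269/50000000"])
  show "171010071/500000000 \<le> sin (pi / 9)"
    using pi_bounds by (intro sin_ge[of "3490658503/10000000000"]) (simp_all add: power_divide)
qed (simp_all add: power_divide)

lemma bound_10:
  assumes "cosh h = 1 / 2 / sin (pi / 10)"
  shows "ball_series h < 0.607267 * (10 / 3 - 2)"
proof (rule small_n_bound[OF assms, of "154508497/500000000" "1287760773/1000000000" "563/500" "1321789/100000000"])
  show "154508497/500000000 \<le> sin (pi / 10)"
    using pi_bounds by (intro sin_ge[of "3141592653/10000000000"]) (simp_all add: power_divide)
qed (simp_all add: power_divide)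

text \<open>\<open>?y\<close> is a lower approximation of the radius to seven decimals, certified by
  the Taylor bound for cosh; four terms of the series then reach the claimed digits.\<close>

lemma lower_bound_9:
  assumes c: "cosh h = 1 / 2 / sin (pi / 9)" and h: "0 \<le> h"
  shows "0.607267 \<le> ball_series h"
proof -
  let ?y = "9275385 / 10000000 :: real"
  have su: "sin (pi / 9) \<le> 21376259/62500000"
    using pi_bounds by (intro sin_le[of _ "436332313/1250000000"]) (simp_all add: power_divide)
  have s0: "0 < sin (pi / 9)" by (intro sin_gt_zero) auto
  have "cosh ?y \<le> 62500000 / (2 * 21376259)"
    by (rule order_trans[OF cosh_le_Taylor]) (simp_all add: power_divide)
  also have "\<dots> = 1 / 2 / (21376259/62500000)" by simp
  also have "\<dots> \<le> cosh h" unfolding c using su s0 by (intro divide_left_mono) auto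
  finally have "?y \<le> h" using h by (subst (asm) cosh_real_nonneg_le_iff) auto
  then have "ball_series ?y \<le> ball_series h" by (intro ball_series_mono) auto
  moreover have "0.607267 \<le> ball_series ?y"
    by (rule order_trans[OF _ ball_series_ge]) (simp add: power_divide)
  ultimately show ?thesis by linarith
qed

lemma sin_ge_cubic: "0 \<le> x \<Longrightarrow> x - x ^ 3 / 6 \<le> sin (x :: real)"
proof -
  assume "0 \<le> x"
  have "((\<lambda>x. sin x - (x - x ^ 3 / 6)) has_real_derivative (cos y - (1 - y\<^sup>2 / 2))) (at y)" for y :: real
    by (auto intro!: derivative_eq_intros)
  moreover have "0 \<le> cos y - (1 - y\<^sup>2 / 2)" for y :: real
  proof -
    have "cos y = 1 - 2 * (sin (y / 2))\<^sup>2" using cos_double_sin[of "y / 2"] by simp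
    moreover have "(sin (y / 2))\<^sup>2 \<le> (y / 2)\<^sup>2"
      using abs_sin_x_le_abs_x[of "y / 2"] abs_le_square_iff by blast
    ultimately show ?thesis by (simp add: power_divide)
  qed
  ultimately have "\<exists>D. ((\<lambda>x. sin x - (x - x ^ 3 / 6)) has_real_derivative D) (at y) \<and> 0 \<le> D" for y
    by blast
  then have "sin 0 - (0 - 0 ^ 3 / 6) \<le> sin x - (x - x ^ 3 / 6)"
    by (intro DERIV_nonneg_imp_nondecreasing[OF \<open>0 \<le> x\<close>, of "\<lambda>x. sin x - (x - x ^ 3 / 6)"])
  then show ?thesis by simp
qed

text \<open>The cubic lower bound for the sine gives the correction
  \<open>x / (6 - x\<^sup>2)\<close> to \<open>1 / x\<close>, which increases with
  \<open>x\<close>.\<close>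

lemma inverse_sin_le:
  fixes x v :: real
  assumes x: "0 < x" "x \<le> v" and v: "v < 2"
  shows "1 / sin x \<le> 1 / x + v / (6 - v\<^sup>2)"
proof -
  have xx: "x\<^sup>2 \<le> v\<^sup>2" "v\<^sup>2 < 6" using x v power_strict_mono[of v 2 2] by (auto intro: power_mono)
  then have d: "0 < 6 - x\<^sup>2" by linarith
  have "0 < x * (1 - x\<^sup>2 / 6)" using x d by simp
  moreover have "x * (1 - x\<^sup>2 / 6) \<le> sin x"
    using sin_ge_cubic[of x] x by (simp add: algebra_simps power2_eq_square power3_eq_cube)
  ultimately have "1 / sin x \<le> 1 / (x * (1 - x\<^sup>2 / 6))" by (intro divide_left_mono) auto
  also have "\<dots> = 1 / x + x / (6 - x\<^sup>2)" using x d by (simp add: field_simps power2_eq_square)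
  also have "x / (6 - x\<^sup>2) \<le> v / (6 - v\<^sup>2)" using x xx by (intro frac_le) auto
  finally show ?thesis by simp
qed

text \<open>As \<open>cosh h\<close> grows like \<open>n / (2 * pi)\<close>, the slope has to stay
  below \<open>2 * pi * 0.607267 / 3\<close>, about 1.2718; the choice 1.27 leaves just enough room
  for the constants at \<open>n = 11\<close>. At \<open>y = 1.63\<close> the tangent is almost
  horizontal, and 0.2856 is \<open>pi / 11\<close> rounded up.\<close>

lemma bound_ge_11:
  assumes c: "cosh h = 1 / 2 / sin (pi / real n)" and n: "11 \<le> n"
  shows "ball_series h < 0.607267 * (real n / 3 - 2)"
proof -
  have n': "11 \<le> real n" using n by simp
  have x: "0 < pi / real n" "pi / real n \<le> 0.2856"
  proof -
    have "pi / real n \<le> pi / 11" using n' by (intro divide_left_mono) auto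
    then show "pi / real n \<le> 0.2856" using pi_bounds by simp
  qed (use n' in simp)
  have "1 / sin (pi / real n) \<le> 1 / (pi / real n) + 0.2856 / (6 - (0.2856)\<^sup>2)"
    by (rule inverse_sin_le[OF x]) simp
  also have "1 / (pi / real n) \<le> real n * 0.3183099"
  proof -
    have "1 / pi \<le> 0.3183099" using pi_bounds by (simp add: divide_le_eq)
    then show ?thesis using mult_left_mono[of "1 / pi" "0.3183099" "real n"] by simp
  qed
  also have "0.2856 / (6 - (0.2856)\<^sup>2) \<le> (0.0484 :: real)" by (simp add: power_divide)
  finally have "cosh h \<le> (real n * 0.3183099 + 0.0484) / 2" unfolding c by simp
  then have ch: "cosh h \<le> real n * (3183099 / 20000000) + 242 / 10000" by simp
  have "ball_series h \<le> 1.27 * (cosh h - 1) + 0.0271"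
    by (rule ball_series_le_tangent[of _ "1.63"]) (simp_all add: power_divide)
  moreover have "1.27 * (cosh h - 1) + 0.0271 = 127 / 100 * cosh h - 12429 / 10000"
    by (simp add: field_simps)
  ultimately have "ball_series h \<le> 127 / 100 * cosh h - 12429 / 10000" by linarith
  then have "ball_series h < 607267 / 3000000 * real n - 1214534 / 1000000" using ch n' by linarith
  then show ?thesis by (simp add: field_simps)
qed

lemma bound_three:
  assumes c: "cosh h = 1 / 2 / sin (pi / real n)" and n: "7 \<le> n" "n \<noteq> 9"
  shows "ball_series h < 0.607267 * (real n / 3 - 2)"
proof -
  consider "n = 7" | "n = 8" | "n = 10" | "11 \<le> n" using n by linarith
  then show ?thesis
    using bound_7[of h] bound_8[of h] bound_10[of h] bound_ge_11[OF c] c by cases auto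
qed

text \<open>In terms of \<open>q = 1 - 2 / k\<close> the numerator of \<open>cosh h\<close> is the
  concave function \<open>sin (pi * q / 2)\<close>, bounded by a tangent. For \<open>n\<close> at
  most 4 the tangent is taken at the degenerate value \<open>q = 2 / n\<close>, which makes both
  sides multiples of \<open>n * q - 2\<close>; for larger \<open>n\<close> it is taken at
  \<open>q = 1 / 2\<close>, that is \<open>k = 4\<close>.\<close>

lemma bound_ge_four:
  assumes c: "cosh h = cos (pi / real k) / sin (pi / real n)" and nk: "3 \<le> n" "4 \<le> k"
    and hyp: "1 / real n + 1 / real k < 1 / 2"
  shows "ball_series h < 0.607267 * (real n * (1 - 2 / real k) - 2)"
proof -
  define q where "q = 1 - 2 / real k"
  have n': "3 \<le> real n" using nk by simp
  have q: "1 / 2 \<le> q" "q < 1" using nk by (simp_all add: q_def field_simps)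
  have nq: "0 < real n * q - 2"
  proof -
    have "2 / real n < q" using hyp by (simp add: q_def)
    then show ?thesis using n' by (simp add: field_simps)
  qed
  have ck: "cos (pi / real k) = sin (pi * q / 2)"
  proof -
    have eq: "pi * q / 2 = pi / 2 - pi / real k" by (simp add: q_def algebra_simps diff_divide_distrib)
    show ?thesis unfolding eq by (simp add: sin_diff)
  qed
  have sn: "0 < sin (pi / real n)" using n' by (intro sin_gt_zero) (auto simp: divide_less_eq)
  have tangent: "sin y \<le> sin z + cos z * (y - z)" if "0 \<le> z" "z \<le> y" "y \<le> pi / 2" for y z :: real
  proof -
    have "sin y - sin z = 2 * sin ((y - z) / 2) * cos ((y + z) / 2)" by (simp add: sin_diff_sin)
    also have "\<dots> \<le> 2 * ((y - z) / 2) * cos z"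
    proof (rule mult_mono)
      show "2 * sin ((y - z) / 2) \<le> 2 * ((y - z) / 2)" using that sin_x_le_x[of "(y - z) / 2"] by simp
      show "cos ((y + z) / 2) \<le> cos z" using that by (intro cos_monotone_0_pi_le) auto
      show "0 \<le> cos ((y + z) / 2)" using that by (intro cos_ge_zero) auto
    qed (use that in auto)
    also have "\<dots> = cos z * (y - z)" by simp
    finally show ?thesis by linarith
  qed
  have goal: "4 / 3 * (cosh h - 1) < 0.607267 * (real n * q - 2)"
  proof (cases "n \<le> 4")
    case True
    then have n34: "n = 3 \<or> n = 4" using nk by linarith
    define y z where "y = pi * q / 2" and "z = pi / real n"
    have yz: "0 \<le> z" "z \<le> y" "y \<le> pi / 2"
    proof -
      have "2 / real n \<le> q" using nq n' by (simp add: field_simps)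
      then have "pi / 2 * (2 / real n) \<le> pi / 2 * q" by (intro mult_left_mono) auto
      then show "z \<le> y" by (simp add: y_def z_def)
    qed (use n' q in \<open>auto simp: y_def z_def\<close>)
    have "cosh h - 1 \<le> cos z / sin z * (y - z)"
    proof -
      have "cosh h \<le> (sin z + cos z * (y - z)) / sin z"
        unfolding c ck using tangent[OF yz] sn by (simp add: y_def z_def divide_right_mono)
      then show ?thesis using sn by (simp add: z_def add_divide_distrib)
    qed
    also have "y - z = pi / (2 * real n) * (real n * q - 2)" using n' by (simp add: y_def z_def field_simps)
    finally have "4 / 3 * (cosh h - 1) \<le> 4 / 3 * (cos z / sin z * (pi / (2 * real n) * (real n * q - 2)))"
      by (rule mult_left_mono) simp
    also have "\<dots> = (4 / 3 * (cos z / sin z) * (pi / (2 * real n))) * (real n * q - 2)"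
      by (simp only: mult.assoc)
    also have "\<dots> < 0.607267 * (real n * q - 2)"
    proof (rule mult_strict_right_mono[OF _ nq])
      from n34 show "4 / 3 * (cos z / sin z) * (pi / (2 * real n)) < 0.607267"
      proof
        assume "n = 3"
        have "1 / sqrt 3 \<le> (0.58 :: real)"
        proof -
          have "1.73 \<le> sqrt 3" by (rule real_le_rsqrt) (simp add: power2_eq_square)
          then have "1 / sqrt 3 \<le> 1 / 1.73" by (intro divide_left_mono) auto
          then show ?thesis by simp
        qed
        moreover have "cos z / sin z = 1 / sqrt 3" using \<open>n = 3\<close> by (simp add: z_def sin_60 cos_60)
        ultimately have "4 / 3 * (cos z / sin z) * (pi / (2 * real n)) \<le> 4 / 3 * 0.58 * (pi / (2 * real n))"
          by (intro mult_right_mono mult_left_mono) auto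
        then show ?thesis using pi_bounds \<open>n = 3\<close> by simp
      next
        assume "n = 4"
        then have "cos z / sin z = 1" by (simp add: z_def sin_45 cos_45)
        then show ?thesis using pi_bounds \<open>n = 4\<close> by simp
      qed
    qed
    finally show ?thesis .
  next
    case False
    then have n5: "5 \<le> real n" by simp
    define p where "p = q - 1 / 2"
    have p: "0 \<le> p" "p \<le> 1 / 2" using q by (auto simp: p_def)
    have "sin (pi * q / 2) \<le> sin (pi / 4) + cos (pi / 4) * (pi * q / 2 - pi / 4)"
      using q by (intro tangent) (auto simp: field_simps)
    also have "\<dots> = sqrt 2 / 2 * (1 + pi / 2 * p)" by (simp add: sin_45 cos_45 p_def algebra_simps)
    also have "\<dots> \<le> 0.70711 * (1 + 1.5708 * p)"
    proof (intro mult_mono add_left_mono mult_right_mono)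
      have "sqrt 2 \<le> 1.41422" by (rule real_le_lsqrt) (simp_all add: power2_eq_square)
      then show "sqrt 2 / 2 \<le> 0.70711" by simp
      show "pi / 2 \<le> 1.5708" using pi_bounds by simp
    qed (use p in auto)
    finally have num: "sin (pi * q / 2) \<le> 0.70711 * (1 + 1.5708 * p)" .
    have den: "1 / sin (pi / real n) \<le> 0.31831 * real n + 0.1122"
    proof -
      have x: "0 < pi / real n" "pi / real n \<le> 0.62832"
      proof -
        have "pi / real n \<le> pi / 5" using n5 by (intro divide_left_mono) auto
        then show "pi / real n \<le> 0.62832" using pi_bounds by simp
      qed (use n5 in simp)
      have "1 / sin (pi / real n) \<le> 1 / (pi / real n) + 0.62832 / (6 - (0.62832)\<^sup>2)"
        by (rule inverse_sin_le[OF x]) simp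
      also have "1 / (pi / real n) \<le> 0.31831 * real n"
      proof -
        have "1 / pi \<le> 0.31831" using pi_bounds by (simp add: divide_le_eq)
        then show ?thesis using mult_left_mono[of "1 / pi" "0.31831" "real n"] by simp
      qed
      also have "0.62832 / (6 - (0.62832)\<^sup>2) \<le> (0.1122 :: real)" by (simp add: power_divide)
      finally show ?thesis by simp
    qed
    have "cosh h = sin (pi * q / 2) * (1 / sin (pi / real n))" unfolding c ck by simp
    also have "\<dots> \<le> (0.70711 * (1 + 1.5708 * p)) * (0.31831 * real n + 0.1122)"
      using num den sn p by (intro mult_mono) auto
    finally have "4 / 3 * (cosh h - 1) \<le> 4 / 3 * ((0.70711 * (1 + 1.5708 * p)) * (0.31831 * real n + 0.1122) - 1)" by simp
    also have "\<dots> < 0.607267 * (real n * (p + 1 / 2) - 2)"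
    proof -
      \<comment> \<open>The inequality is bilinear in \<open>p\<close> and \<open>n\<close>; this
        product handles the mixed term for linear arithmetic.\<close>
      have "0 \<le> p * (real n - 5)" using p n5 by simp
      then show ?thesis using p n5 by (simp add: algebra_simps)
    qed
    finally show ?thesis by (simp add: p_def)
  qed
  then show ?thesis using ball_series_le[of h] by (simp add: q_def)
qed

section \<open>The optimal packing\<close>

lemma triangle_rotation_group:
  assumes adm: "admissible p1 p2" and T: "right_triangle p1 p2 A B C"
    and R: "rotation_generators p1 p2 A B C g0 g1"
  obtains \<alpha> h where
    "rotation_group \<alpha> (cox_m p1 p2) (\<lambda>i. case i of VA \<Rightarrow> A | VB \<Rightarrow> B | VC \<Rightarrow> C) h (Gamma0 g0 g1)"
    "(h VB)\<^sup>2 + 1 = (cos (pi / p2) / sin (pi / p1))\<^sup>2"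
    "(h VC)\<^sup>2 + 1 = (cos (pi / p1) / sin (pi / p2))\<^sup>2"
    "(h VA)\<^sup>2 = (cos (pi / p1))\<^sup>2 + (cos (pi / p2))\<^sup>2 - 1"
proof -
  define p where "p = (\<lambda>i. case i of VA \<Rightarrow> A | VB \<Rightarrow> B | VC \<Rightarrow> C)"
  obtain \<alpha> h where cs: "coxeter_system \<alpha> (cox_m p1 p2) (\<lambda>i. lift (p i)) h"
    and h: "(h VB)\<^sup>2 + 1 = (cos (pi / p2) / sin (pi / p1))\<^sup>2"
      "(h VC)\<^sup>2 + 1 = (cos (pi / p1) / sin (pi / p2))\<^sup>2"
      "(h VA)\<^sup>2 = (cos (pi / p1))\<^sup>2 + (cos (pi / p2))\<^sup>2 - 1"
    using right_triangle_roots[OF adm T] unfolding p_def by metis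
  have pl: "p i \<in> hyp_plane" for i using T unfolding right_triangle_def p_def by (cases i) auto
  have R': "rotation_generators p1 p2 (p VA) (p VB) (p VC) g0 g1" using R by (simp add: p_def)
  have "rotation_group \<alpha> (cox_m p1 p2) p h (Gamma0 g0 g1)"
    by (rule rotation_group.intro[OF cs], rule rotation_group_axioms.intro[OF pl])
      (rule Gamma0_words[OF cs pl R'], assumption)+
  then show thesis using that h unfolding p_def by blast
qed

text \<open>The density of the optimal packing centred at a rotation centre of order \<open>n\<close>, where \<open>k\<close> is
  the order of the other rotation: \<open>cosh x\<close> is the hyperbolic cosine of the packing radius.\<close>

lemma density_bound:
  assumes c: "cosh x = cos (pi / real k) / sin (pi / real n)"
    and nk: "3 \<le> n" "3 \<le> k" "1 / real n + 1 / real k < 1 / 2" "\<not> (n = 9 \<and> k = 3)"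
  shows "ball_series x / (real n * (1 - 2 / real k) - 2) < 0.607267"
proof -
  have "2 / real n + 2 / real k < 1" using nk(3) by simp
  then have "real n * (2 / real n + 2 / real k) < real n * 1" using nk(1) by (intro mult_strict_left_mono) auto
  then have pos: "0 < real n * (1 - 2 / real k) - 2" using nk(1) by (simp add: algebra_simps)
  have "ball_series x < 0.607267 * (real n * (1 - 2 / real k) - 2)"
  proof (cases "k = 3")
    case True
    have "7 \<le> n"
    proof (rule ccontr)
      assume "\<not> 7 \<le> n"
      then have "1 / 6 \<le> 1 / real n" using nk(1) by (intro divide_left_mono) auto
      then show False using nk(3) True by simp
    qed
    moreover have "n \<noteq> 9" using nk(4) True by simp
    moreover have "cosh x = 1 / 2 / sin (pi / real n)" using c True by (simp add: cos_60)
    ultimately have "ball_series x < 0.607267 * (real n / 3 - 2)" by (intro bound_three)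
    then show ?thesis using True by simp
  next
    case False
    then show ?thesis using nk by (intro bound_ge_four[OF c]) auto
  qed
  then show ?thesis using pos by (simp only: pos_divide_less_eq)
qed

text \<open>The squared hyperbolic sine of the altitude from the right angle is
  \<open>cos (\<beta> + \<gamma>) * cos (\<beta> - \<gamma>)\<close>, at most the sine of the area
  and so at most the area. With slope 4/3 the density is at most \<open>pi / 6\<close>, about
  0.524.\<close>

lemma vertex_A_bound:
  fixes \<beta> \<gamma> x :: real
  assumes h: "(sinh x)\<^sup>2 = (cos \<beta>)\<^sup>2 + (cos \<gamma>)\<^sup>2 - 1"
    and pos: "0 < \<beta>" "0 < \<gamma>" and F: "0 < pi / 2 - \<beta> - \<gamma>"
  shows "pi * ball_series x / (2 * 2 * (pi / 2 - \<beta> - \<gamma>)) < 0.607267"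
proof -
  have "(cosh x - 1) * 2 \<le> (cosh x - 1) * (cosh x + 1)"
    using cosh_real_ge_1[of x] by (intro mult_left_mono) auto
  also have "\<dots> = (cosh x)\<^sup>2 - 1" by (simp add: power2_eq_square algebra_simps)
  also have "\<dots> = (sinh x)\<^sup>2" by (simp add: sinh_square_eq)
  also have "\<dots> = cos (\<beta> + \<gamma>) * cos (\<beta> - \<gamma>)"
  proof -
    have "cos (\<beta> + \<gamma>) * cos (\<beta> - \<gamma>) = (cos \<beta>)\<^sup>2 * (cos \<gamma>)\<^sup>2 - (sin \<beta>)\<^sup>2 * (sin \<gamma>)\<^sup>2"
      by (simp add: cos_add cos_diff power2_eq_square algebra_simps)
    then show ?thesis unfolding h sin_squared_eq by (simp add: algebra_simps)
  qed
  also have "\<dots> \<le> cos (\<beta> + \<gamma>) * 1"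
    using pos F by (intro mult_left_mono cos_ge_zero) auto
  also have "cos (\<beta> + \<gamma>) = sin (pi / 2 - (\<beta> + \<gamma>))" by (simp add: sin_diff)
  also have "\<dots> * 1 \<le> pi / 2 - (\<beta> + \<gamma>)" using F sin_x_le_x[of "pi / 2 - (\<beta> + \<gamma>)"] by simp
  finally have "(cosh x - 1) * 2 \<le> pi / 2 - \<beta> - \<gamma>" by simp
  then have "2 / 3 * ((cosh x - 1) * 2) \<le> 2 / 3 * (pi / 2 - \<beta> - \<gamma>)" by (rule mult_left_mono) simp
  moreover have "4 / 3 * (cosh x - 1) = 2 / 3 * ((cosh x - 1) * 2)" by simp
  ultimately have "ball_series x \<le> 2 / 3 * (pi / 2 - \<beta> - \<gamma>)" using ball_series_le[of x] by (metis order_trans)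
  then have "pi * ball_series x \<le> pi * (2 / 3 * (pi / 2 - \<beta> - \<gamma>))" by (intro mult_left_mono) auto
  then have "pi * ball_series x / (2 * 2 * (pi / 2 - \<beta> - \<gamma>)) \<le>
      pi * (2 / 3 * (pi / 2 - \<beta> - \<gamma>)) / (2 * 2 * (pi / 2 - \<beta> - \<gamma>))"
    using F by (intro divide_right_mono) auto
  also have "\<dots> = pi / 6"
  proof -
    have "pi * (2 / 3 * z) / (2 * 2 * z) = pi / 6" if "0 < z" for z :: real using that by simp
    then show ?thesis using F by blast
  qed
  also have "pi / 6 < 0.607267" using pi_bounds by simp
  finally show ?thesis .
qed

text \<open>Named independently of any triangle, so that the maximal value can be compared across
  all parameters.\<close>

definition optimal_radius :: real where
  "optimal_radius = arcosh (1 / 2 / sin (pi / 9))"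

lemma optimal_radius:
  assumes "cosh x = 1 / 2 / sin (pi / 9)" "0 \<le> x"
  shows "x = optimal_radius"
  using arcosh_cosh_real[OF assms(2)] assms(1) by (simp add: optimal_radius_def)

lemma vertex_densities:
  assumes rg: "rotation_group \<alpha> (cox_m p1 p2) p h G" and adm: "admissible p1 p2"
    and h: "(h VB)\<^sup>2 + 1 = (cos (pi / p2) / sin (pi / p1))\<^sup>2"
      "(h VC)\<^sup>2 + 1 = (cos (pi / p1) / sin (pi / p2))\<^sup>2"
      "(h VA)\<^sup>2 = (cos (pi / p1))\<^sup>2 + (cos (pi / p2))\<^sup>2 - 1"
  shows "rotation_group.vertex_density (cox_m p1 p2) h VA < 0.607267"
    and "if p1 = 9 \<and> p2 = 3 then rotation_group.vertex_density (cox_m p1 p2) h VB = ball_series optimal_radius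
      else rotation_group.vertex_density (cox_m p1 p2) h VB < 0.607267"
    and "if p2 = 9 \<and> p1 = 3 then rotation_group.vertex_density (cox_m p1 p2) h VC = ball_series optimal_radius
      else rotation_group.vertex_density (cox_m p1 p2) h VC < 0.607267"
proof -
  interpret rotation_group \<alpha> "cox_m p1 p2" p h G by fact
  have p: "3 \<le> p1" "3 \<le> p2" and hyp: "1 / real p1 + 1 / real p2 < 1 / 2"
    using adm by (auto simp: admissible_def)
  have F: "tri_area = pi / 2 - pi / p1 - pi / p2" by (simp add: tri_area_def)
  have Fpos: "0 < pi / 2 - pi / real p1 - pi / real p2"
  proof -
    have "pi * (1 / real p1 + 1 / real p2) < pi * (1 / 2)" using hyp by (intro mult_strict_left_mono) auto
    then show ?thesis by (simp add: algebra_simps)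
  qed
  have "vertex_density VA = pi * ball_series (arsinh (h VA)) / (2 * 2 * (pi / 2 - pi / p1 - pi / p2))"
    by (simp add: vertex_density_def rot_order_def F)
  also have "\<dots> < 0.607267"
    using h(3) p Fpos by (intro vertex_A_bound) auto
  finally show "vertex_density VA < 0.607267" .
  \<comment> \<open>One computation for \<open>B\<close> and \<open>C\<close>, with \<open>n\<close>
    the order at the centre and \<open>k\<close> the other order. Up to the factor
    \<open>pi\<close>, the denominator is \<open>n * (1 - 2 / k) - 2\<close>, which is 1 for the
    orders 9 and 3.\<close>
  have dens: "if n = 9 \<and> k = 3 then d = ball_series optimal_radius else d < 0.607267"
    if d: "d = pi * ball_series (arsinh x) / (2 * real n * (pi / 2 - pi / real n - pi / real k))"
      and x: "x\<^sup>2 + 1 = (cos (pi / real k) / sin (pi / real n))\<^sup>2"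
      and nk: "3 \<le> n" "3 \<le> k" "1 / real n + 1 / real k < 1 / 2" and x0: "0 < x" for d x :: real and n k :: nat
  proof -
    have "0 < pi / real k" "0 < pi / real n" using nk(1,2) by simp_all
    moreover have "pi / real j < pi / 2" if "3 \<le> j" for j
      using that by (intro divide_strict_left_mono) auto
    note this[OF nk(1)] this[OF nk(2)]
    ultimately have cp: "0 < cos (pi / real k)" "0 < sin (pi / real n)"
      by (simp_all add: cos_gt_zero sin_gt_zero2)
    have "(cosh (arsinh x))\<^sup>2 = (cos (pi / real k) / sin (pi / real n))\<^sup>2"
      using x by (simp add: cosh_square_eq)
    then have c: "cosh (arsinh x) = cos (pi / real k) / sin (pi / real n)"
      using cp by (simp add: power2_eq_iff_nonneg less_imp_le)
    have "2 * real n * (pi / 2 - pi / real n - pi / real k) = pi * (real n * (1 - 2 / real k) - 2)"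
      using nk(1) by (simp add: algebra_simps)
    then have d': "d = ball_series (arsinh x) / (real n * (1 - 2 / real k) - 2)" unfolding d by simp
    show ?thesis
    proof (cases "n = 9 \<and> k = 3")
      case True
      have "arsinh x = optimal_radius"
        using c True x0 by (intro optimal_radius) (auto simp: cos_60 less_imp_le)
      then show ?thesis using True d' by simp
    next
      case False
      show ?thesis unfolding d' if_not_P[OF False] by (rule density_bound[OF c nk False])
    qed
  qed
  show "if p1 = 9 \<and> p2 = 3 then vertex_density VB = ball_series optimal_radius else vertex_density VB < 0.607267"
    by (rule dens[OF _ h(1) p hyp h_pos]) (simp add: vertex_density_def rot_order_def F)
  show "if p2 = 9 \<and> p1 = 3 then vertex_density VC = ball_series optimal_radius else vertex_density VC < 0.607267"
  proof (rule dens[OF _ h(2) p(2,1) _ h_pos])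
    have "pi / 2 - pi / real p1 - pi / real p2 = pi / 2 - pi / real p2 - pi / real p1" by simp
    then show "vertex_density VC = pi * ball_series (arsinh (h VC)) / (2 * real p2 * (pi / 2 - pi / real p2 - pi / real p1))"
      unfolding vertex_density_def F by (simp add: rot_order_def)
  qed (use hyp in simp)
qed

lemma optimal_density_bounds:
  "0.607267 \<le> ball_series optimal_radius" "ball_series optimal_radius < 0.607268"
proof -
  have s: "0 < sin (pi / 9)" by (intro sin_gt_zero) auto
  have "sin (pi / 9) \<le> sin (pi / 6)"
  proof (rule sin_monotone_2pi_le)
    show "- (pi / 2) \<le> pi / 9" "pi / 9 \<le> pi / 6" "pi / 6 \<le> pi / 2" using pi_gt_zero by linarith+
  qed
  then have "1 \<le> 1 / 2 / sin (pi / 9)" using s by (simp add: sin_30 le_divide_eq)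
  then have c: "cosh optimal_radius = 1 / 2 / sin (pi / 9)" "0 \<le> optimal_radius"
    unfolding optimal_radius_def by (rule cosh_arcosh_real, rule arcosh_nonneg_real)
  show "0.607267 \<le> ball_series optimal_radius" by (rule lower_bound_9[OF c])
  show "ball_series optimal_radius < 0.607268" by (rule bound_9[OF c(1)])
qed

theorem theorem4p7:
  fixes A B C :: "nat \<Rightarrow> nat \<Rightarrow> complex"
    and g0 g1 :: "nat \<Rightarrow> nat \<Rightarrow> complex \<Rightarrow> complex"
  assumes "\<And>p1 p2. admissible p1 p2 \<Longrightarrow> right_triangle p1 p2 (A p1 p2) (B p1 p2) (C p1 p2)"
    and "\<And>p1 p2. admissible p1 p2 \<Longrightarrow>
           rotation_generators p1 p2 (A p1 p2) (B p1 p2) (C p1 p2) (g0 p1 p2) (g1 p1 p2)"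
  shows
    "is_arg_max (\<lambda>(p1, p2). opt_density (Gamma0 (g0 p1 p2) (g1 p1 p2)))
                (\<lambda>(p1, p2). admissible p1 p2) (9, 3) \<and>
     (\<exists>r. optimal_packing (Gamma0 (g0 9 3) (g1 9 3)) r (B 9 3, 0)) \<and>
     (\<forall>r K. optimal_packing (Gamma0 (g0 9 3) (g1 9 3)) r K \<longrightarrow>
            (\<exists>g \<in> Gamma0 (g0 9 3) (g1 9 3). fst K = g (B 9 3))) \<and>
     \<lfloor>10 ^ 6 * opt_density (Gamma0 (g0 9 3) (g1 9 3))\<rfloor> = 607267"
proof -
  note D = optimal_density_bounds
  have ang: "pi / real (cox_m p1 p2 VA VC) + pi / real (cox_m p1 p2 VA VB) < pi / 2" if "admissible p1 p2" for p1 p2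
  proof -
    have "pi * (1 / real p1 + 1 / real p2) < pi * (1 / 2)"
      using that by (intro mult_strict_left_mono) (auto simp: admissible_def)
    then show ?thesis by (simp add: algebra_simps)
  qed
  \<comment> \<open>Not strict: the parameters \<open>(3, 9)\<close> exchange the roles of
    \<open>B\<close> and \<open>C\<close> and reach the same value.\<close>
  have le: "opt_density (Gamma0 (g0 p1 p2) (g1 p1 p2)) \<le> ball_series optimal_radius"
    if adm: "admissible p1 p2" for p1 p2
  proof -
    obtain \<alpha> h where rg: "rotation_group \<alpha> (cox_m p1 p2)
        (\<lambda>i. case i of VA \<Rightarrow> A p1 p2 | VB \<Rightarrow> B p1 p2 | VC \<Rightarrow> C p1 p2) h (Gamma0 (g0 p1 p2) (g1 p1 p2))"
      and h: "(h VB)\<^sup>2 + 1 = (cos (pi / p2) / sin (pi / p1))\<^sup>2"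
        "(h VC)\<^sup>2 + 1 = (cos (pi / p1) / sin (pi / p2))\<^sup>2"
        "(h VA)\<^sup>2 = (cos (pi / p1))\<^sup>2 + (cos (pi / p2))\<^sup>2 - 1"
      using triangle_rotation_group[OF adm assms(1)[OF adm] assms(2)[OF adm]] by metis
    interpret rotation_group \<alpha> "cox_m p1 p2" "\<lambda>i. case i of VA \<Rightarrow> A p1 p2 | VB \<Rightarrow> B p1 p2 | VC \<Rightarrow> C p1 p2" h
      "Gamma0 (g0 p1 p2) (g1 p1 p2)" by (rule rg)
    note vd = vertex_densities[OF rg adm h]
    have d: "vertex_density i \<le> ball_series optimal_radius" for i
      using vd D(1) by (cases i) (auto split: if_splits)
    \<comment> \<open>\<open>opt_density_eq\<close> asks for a vertex of greatest density; which of
      the three it is does not matter for the upper bound.\<close>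
    have "Max (range vertex_density) \<in> range vertex_density" by (rule Max_in) auto
    then obtain j where j: "vertex_density j = Max (range vertex_density)" by force
    then have "vertex_density i \<le> vertex_density j" for i by simp
    from opt_density_eq(1)[OF _ ang[OF adm] this] d[of j] show ?thesis by simp
  qed
  have adm: "admissible 9 3" by (simp add: admissible_def)
  obtain \<alpha> h where rg: "rotation_group \<alpha> (cox_m 9 3)
      (\<lambda>i. case i of VA \<Rightarrow> A 9 3 | VB \<Rightarrow> B 9 3 | VC \<Rightarrow> C 9 3) h (Gamma0 (g0 9 3) (g1 9 3))"
    and h: "(h VB)\<^sup>2 + 1 = (cos (pi / real 3) / sin (pi / real 9))\<^sup>2"
      "(h VC)\<^sup>2 + 1 = (cos (pi / real 9) / sin (pi / real 3))\<^sup>2"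
      "(h VA)\<^sup>2 = (cos (pi / real 9))\<^sup>2 + (cos (pi / real 3))\<^sup>2 - 1"
    using triangle_rotation_group[OF adm assms(1)[OF adm] assms(2)[OF adm]] by metis
  interpret rotation_group \<alpha> "cox_m 9 3" "\<lambda>i. case i of VA \<Rightarrow> A 9 3 | VB \<Rightarrow> B 9 3 | VC \<Rightarrow> C 9 3" h
    "Gamma0 (g0 9 3) (g1 9 3)" by (rule rg)
  note vd = vertex_densities[OF rg adm h]
  have B: "vertex_density VB = ball_series optimal_radius" using vd(2) by simp
  \<comment> \<open>Strictness is what forces every optimal centre into the orbit of
    \<open>B\<close>.\<close>
  have less: "vertex_density i < vertex_density VB" if "i \<noteq> VB" for i
    using vd(1,3) D(1) that unfolding B by (cases i) auto
  then have max: "vertex_density i \<le> vertex_density VB" for i by (cases "i = VB") (auto simp: less_imp_le)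
  have right: "cox_m 9 3 VB VC = 2" by simp
  have opt: "opt_density (Gamma0 (g0 9 3) (g1 9 3)) = ball_series optimal_radius"
    using opt_density_eq(1)[OF right ang[OF adm] max] B by simp
  have "is_arg_max (\<lambda>(p1, p2). opt_density (Gamma0 (g0 p1 p2) (g1 p1 p2)))
      (\<lambda>(p1, p2). admissible p1 p2) (9, 3)"
    unfolding is_arg_max_def using adm le opt by (auto simp: not_less)
  moreover have "\<exists>r. optimal_packing (Gamma0 (g0 9 3) (g1 9 3)) r (B 9 3, 0)"
    using opt_density_eq(2)[OF right ang[OF adm] max, of 0] by auto
  moreover have "\<exists>g \<in> Gamma0 (g0 9 3) (g1 9 3). fst K = g (B 9 3)"
    if "optimal_packing (Gamma0 (g0 9 3) (g1 9 3)) r K" for r K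
    using optimal_packing_vertex[OF right ang[OF adm] less that] by simp
  moreover have "\<lfloor>10 ^ 6 * opt_density (Gamma0 (g0 9 3) (g1 9 3))\<rfloor> = 607267"
    unfolding opt floor_eq_iff using D by simp
  ultimately show ?thesis by blast
qed

end
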